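(* Let $-\frac14<a<0$ and $\sigma=\frac12-\sqrt{\frac14+a}$. If $p\ge 3/\sigma$, then there is $f\in\dot H^1(\mathbb R^3)\cap L^{p'}(\mathbb R^3)$ such that $e^{-it\mathcal L_a}f\notin L^p(\mathbb R^3)$ for every $t\in\mathbb R$.
   Context: $\mathcal L_a=-\Delta+a|x|^{-2}$ on $\mathbb R^3$ is the Friedrichs extension of the quadratic form $Q_a(f)=\int_{\mathbb R^3}(|\nabla f|^2+\frac{a}{|x|^2}|f|^2)\,dx$, $f\in C_c^\infty(\mathbb R^3\setminus\{0\})$; it is a nonnegative self-adjoint operator on $L^2(\mathbb R^3)$ and $e^{-it\mathcal L_a}$ is the associated unitary group. $p'$ is the Hölder conjugate of $p$. *)

theory Defs
  imports "HOL-Analysis.Analysis"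
begin

text \<open>
  Elements of the Lebesgue spaces are represented by Borel functions on \<open>\<real>\<^sup>3\<close> with complex
  values, and equality in such a space is equality almost everywhere. The Lebesgue
  spaces, the homogeneous Sobolev space and the graph of the operator are invariant under
  almost-everywhere equality.
\<close>

type_synonym wave = "real^3 \<Rightarrow> complex"

section \<open>Lebesgue spaces\<close>

definition Lp :: "ennreal \<Rightarrow> wave set" where
  "Lp p = {f \<in> borel_measurable lborel.
     if p = \<infinity> then (\<exists>C::real. AE x in lborel. norm (f x) \<le> C)
     else integrable lborel (\<lambda>x. norm (f x) powr enn2real p)}"

text \<open>Only meaningful for functions in \<open>Lp (ennreal p)\<close>, since non-integrable functions have
  integral 0.\<close>

definition Lp_norm :: "real \<Rightarrow> wave \<Rightarrow> real" where
  "Lp_norm p f = (LINT x|lborel. norm (f x) powr p) powr (1 / p)"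

definition L2_inner :: "wave \<Rightarrow> wave \<Rightarrow> complex" where
  "L2_inner f g = (LINT x|lborel. f x * cnj (g x))"

text \<open>The conjugate exponent of \<open>p \<ge> 1\<close>; the conventions for inverses in \<^typ>\<open>ennreal\<close> yield
  the pairs \<open>(1, \<infinity>)\<close> and \<open>(\<infinity>, 1)\<close>.\<close>

definition holder_conjugate :: "ennreal \<Rightarrow> ennreal" where
  "holder_conjugate p = inverse (1 - inverse p)"

section \<open>Test functions and the homogeneous Sobolev space\<close>

definition partial_deriv :: "3 \<Rightarrow> wave \<Rightarrow> wave" where
  "partial_deriv i f x = frechet_derivative f (at x) (axis i 1)"

primrec C_k :: "nat \<Rightarrow> wave \<Rightarrow> bool" where
  "C_k 0 f \<longleftrightarrow> continuous_on UNIV f"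
| "C_k (Suc k) f \<longleftrightarrow> (\<forall>x. f differentiable (at x)) \<and> (\<forall>i. C_k k (partial_deriv i f))"

definition test_functions :: "(real^3) set \<Rightarrow> wave set" where
  "test_functions \<Omega> = {f. (\<forall>k. C_k k f) \<and>
     compact (closure {x. f x \<noteq> 0}) \<and> closure {x. f x \<noteq> 0} \<subseteq> \<Omega>}"

definition grad_sq :: "wave \<Rightarrow> real^3 \<Rightarrow> real" where
  "grad_sq f x = (\<Sum>i\<in>UNIV. (norm (partial_deriv i f x))\<^sup>2)"

text \<open>The completion of \<open>C\<^sub>c\<^sup>\<infinity>(\<real>\<^sup>3)\<close> for the norm \<open>\<parallel>\<nabla>f\<parallel>\<close> of \<open>L\<^sup>2\<close>, realised as a space of functions
  by means of the Sobolev embedding into \<open>L\<^sup>6\<close>.\<close>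

definition homogeneous_H1 :: "wave set" where
  "homogeneous_H1 = {f \<in> Lp 6. \<exists>\<phi>. (\<forall>n. \<phi> n \<in> test_functions UNIV) \<and>
     (\<forall>e>0. \<exists>N::nat. \<forall>m\<ge>N. \<forall>n\<ge>N.
        (LINT x|lborel. grad_sq (\<lambda>y. \<phi> m y - \<phi> n y) x) < e) \<and>
     (\<lambda>n. Lp_norm 6 (\<lambda>x. \<phi> n x - f x)) \<longlonglongrightarrow> 0}"

section \<open>The operator with inverse-square potential\<close>

definition quad_form :: "real \<Rightarrow> wave \<Rightarrow> real" where
  "quad_form a f = (LINT x|lborel. grad_sq f x + a / (norm x)\<^sup>2 * (norm (f x))\<^sup>2)"

definition sesq_form :: "real \<Rightarrow> wave \<Rightarrow> wave \<Rightarrow> complex" where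
  "sesq_form a f g = (LINT x|lborel.
     (\<Sum>i\<in>UNIV. partial_deriv i f x * cnj (partial_deriv i g x))
     + complex_of_real (a / (norm x)\<^sup>2) * f x * cnj (g x))"

lemma sesq_form_diagonal: "sesq_form a f f = complex_of_real (quad_form a f)"
proof -
  have "sesq_form a f f = (LINT x|lborel.
      complex_of_real (grad_sq f x + a / (norm x)\<^sup>2 * (norm (f x))\<^sup>2))"
    unfolding sesq_form_def grad_sq_def
    by (intro Bochner_Integration.integral_cong refl)
       (simp add: complex_norm_square mult.assoc del: of_real_power)
  then show ?thesis
    unfolding quad_form_def by (simp only: integral_complex_of_real)
qed

text \<open>The sequence \<open>\<phi>\<close> in \<open>C\<^sub>c\<^sup>\<infinity>(\<real>\<^sup>3 - {0})\<close> is Cauchy for the form norm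
  \<open>(Q\<^sub>a(f) + \<parallel>f\<parallel>\<^sup>2)\<^sup>1\<^sup>/\<^sup>2\<close> and tends to \<open>u\<close> in \<open>L\<^sup>2\<close>.\<close>

definition form_approx :: "real \<Rightarrow> (nat \<Rightarrow> wave) \<Rightarrow> wave \<Rightarrow> bool" where
  "form_approx a \<phi> u \<longleftrightarrow> (\<forall>n. \<phi> n \<in> test_functions (- {0})) \<and>
     (\<lambda>n. Lp_norm 2 (\<lambda>x. \<phi> n x - u x)) \<longlonglongrightarrow> 0 \<and>
     (\<forall>e>0. \<exists>N. \<forall>m\<ge>N. \<forall>n\<ge>N. quad_form a (\<lambda>x. \<phi> m x - \<phi> n x) < e)"

definition form_domain :: "real \<Rightarrow> wave set" where
  "form_domain a = {u \<in> Lp 2. \<exists>\<phi>. form_approx a \<phi> u}"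

text \<open>The closure of the form. The limit exists and is independent of the approximating sequences
  because the form is nonnegative (for \<open>a \<ge> -1/4\<close>, by the Hardy inequality) and closable.\<close>

definition closed_form :: "real \<Rightarrow> wave \<Rightarrow> wave \<Rightarrow> complex" where
  "closed_form a u v = (THE c. \<forall>\<phi> \<psi>. form_approx a \<phi> u \<longrightarrow> form_approx a \<psi> v \<longrightarrow>
     (\<lambda>n. sesq_form a (\<phi> n) (\<psi> n)) \<longlonglongrightarrow> c)"

text \<open>The graph of the Friedrichs extension, that is, of the self-adjoint operator associated with
  the closed form.\<close>

definition friedrichs :: "real \<Rightarrow> (wave \<times> wave) set" where
  "friedrichs a = {(u, g). u \<in> form_domain a \<and> g \<in> Lp 2 \<and>
     (\<forall>v \<in> form_domain a. closed_form a u v = L2_inner g v)}"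

section \<open>Unitary groups\<close>

text \<open>Strongly continuous one-parameter unitary groups on \<open>L\<^sup>2\<close>. Surjectivity of each \<open>U t\<close>
  follows from the group law.\<close>

definition unitary_group :: "(real \<Rightarrow> wave \<Rightarrow> wave) \<Rightarrow> bool" where
  "unitary_group U \<longleftrightarrow>
     (\<forall>t. \<forall>f \<in> Lp 2. U t f \<in> Lp 2) \<and>
     (\<forall>t c. \<forall>f \<in> Lp 2. \<forall>g \<in> Lp 2.
        AE x in lborel. U t (\<lambda>y. c * f y + g y) x = c * U t f x + U t g x) \<and>
     (\<forall>t. \<forall>f \<in> Lp 2. \<forall>g \<in> Lp 2. L2_inner (U t f) (U t g) = L2_inner f g) \<and>
     (\<forall>f \<in> Lp 2. AE x in lborel. U 0 f x = f x) \<and>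
     (\<forall>s t. \<forall>f \<in> Lp 2. AE x in lborel. U (s + t) f x = U s (U t f) x) \<and>
     (\<forall>f \<in> Lp 2. ((\<lambda>t. Lp_norm 2 (\<lambda>x. U t f x - f x)) \<longlongrightarrow> 0) (at 0))"

text \<open>\<open>U t = e\<^sup>-\<^sup>i\<^sup>t\<^sup>L\<close> in the sense of Stone's theorem: \<open>U\<close> is the unitary group whose
  infinitesimal generator is \<open>-iL\<close>, including equality of domains. For self-adjoint \<open>L\<close> it exists
  and is unique up to almost-everywhere equality.\<close>

definition is_schroedinger_group ::
    "(wave \<times> wave) set \<Rightarrow> (real \<Rightarrow> wave \<Rightarrow> wave) \<Rightarrow> bool" where
  "is_schroedinger_group L U \<longleftrightarrow> unitary_group U \<and>
     (\<forall>u \<in> Lp 2. \<forall>g \<in> Lp 2. (u, g) \<in> L \<longleftrightarrow>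
        ((\<lambda>h. Lp_norm 2 (\<lambda>x. (U h u x - u x) / complex_of_real h - (- \<i> * g x)))
          \<longlongrightarrow> 0) (at 0))"

end

theory Submission
  imports Defs
begin

text \<open>
  For \<open>z t = 1 / (1 + 4it)\<close> the function \<open>u t x = z t\<^sup>3\<^sup>/\<^sup>2\<^sup>-\<^sup>\<sigma> |x|\<^sup>-\<^sup>\<sigma> exp (- z t |x|\<^sup>2)\<close> solves the
  Schroedinger equation explicitly, because \<open>|x|\<^sup>-\<^sup>\<sigma>\<close> is annihilated by \<open>-\<Delta> + a / |x|\<^sup>2\<close>. All these
  functions have the singularity \<open>|x|\<^sup>-\<^sup>\<sigma>\<close> at the origin and hence are not in \<open>L\<^sup>p\<close> for \<open>p \<ge> 3 / \<sigma>\<close>,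
  whereas \<open>u 0\<close> is in \<open>L\<^sup>q\<close> for every \<open>q < 3 / \<sigma>\<close> and has a gradient in \<open>L\<^sup>2\<close> since \<open>\<sigma> < 1 / 2\<close>.
  That \<open>u t\<close> lies in the domain of the Friedrichs extension is seen by smooth cutoffs at the
  origin and at infinity, whose gradients are controlled by \<open>u t / |x|\<close> and \<open>|x| u t\<close>, and by
  integration by parts against functions supported away from the origin.
\<close>

section \<open>Partial derivatives and integration by parts\<close>

text \<open>Writing u = |x|^(-\<sigma>) w with w radial turns -Delta + a / |x|^2 into minus the
  radial Laplacian of dimension d = 3 - 2 \<sigma>, because a = \<sigma>^2 - \<sigma>. The Gaussian
  z^(d/2) exp (- z |x|^2) of that dimension solves the free equation when z' = -4 i z^2, and z(0) =
  1 gives 1 / (1 + 4 i t), whose real part is positive at all times. The other root 1 - \<sigma> of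
  the same quadratic gives a second power annihilated pointwise, but its gradient is not square
  integrable at the origin. Pointwise computation therefore cannot single out the Friedrichs
  extension; membership in the form domain does. The group \<open>U\<close> is known only through
  its generator, so the explicit functions have to form a curve inside the graph that is
  differentiable in L^2, and uniqueness of such curves identifies it with the orbit. The closed form
  is a \<open>THE\<close> over all approximating sequences, so limits are required for every pair of
  sequences and not only for the cutoffs.\<close>

abbreviation has_pd :: "3 \<Rightarrow> wave \<Rightarrow> complex \<Rightarrow> real^3 \<Rightarrow> bool" where
  "has_pd i F D x \<equiv> ((\<lambda>s. F (x + s *\<^sub>R axis i 1)) has_vector_derivative D) (at 0)"

text \<open>The mean value estimate along a line needs the derivative at every parameter
  \<open>s\<close>, whereas \<open>has_pd\<close> speaks of parameter 0 only; the base point absorbs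
  the shift.\<close>

lemma has_pd_shift:
  assumes "has_pd i F D (x + s *\<^sub>R axis i 1)"
  shows "((\<lambda>s. F (x + s *\<^sub>R axis i 1)) has_vector_derivative D) (at s)"
proof -
  have "((\<lambda>r. r - s) has_vector_derivative 1) (at s)"
    by (auto intro!: derivative_eq_intros)
  from vector_diff_chain_at[OF this, of "\<lambda>r. F (x + s *\<^sub>R axis i 1 + r *\<^sub>R axis i 1)" D] assms
  have "((\<lambda>r. F (x + s *\<^sub>R axis i 1 + (r - s) *\<^sub>R axis i 1)) has_vector_derivative D) (at s)"
    by (simp add: o_def)
  then show ?thesis by (simp add: algebra_simps)
qed

lemma has_pd_transform_open:
  assumes "has_pd i F D x" "open S" "x \<in> S" "\<And>y. y \<in> S \<Longrightarrow> F y = F' y"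
  shows "has_pd i F' D x"
proof -
  have o: "open ((\<lambda>s. x + s *\<^sub>R axis i 1) -` S)"
    by (intro open_vimage assms continuous_intros)
  show ?thesis
    by (rule has_vector_derivative_transform_within_open[OF assms(1) o]) (use assms in auto)
qed

lemma integrable_continuous_bounded_support:
  fixes F :: "'a::euclidean_space \<Rightarrow> 'b::{banach, second_countable_topology}"
  assumes "continuous_on UNIV F" "\<And>x. F x \<noteq> 0 \<Longrightarrow> norm x \<le> R"
  shows "integrable lborel F"
proof -
  have "integrable lborel (\<lambda>x. indicator (cball 0 R) x *\<^sub>R F x)"
    by (rule borel_integrable_compact[OF compact_cball]) (use assms continuous_on_subset in blast)
  also have "(\<lambda>x. indicator (cball 0 R) x *\<^sub>R F x) = F"
    using assms(2) by (force simp: indicator_def)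
  finally show ?thesis .
qed

text \<open>By translation invariance all difference quotients in the direction \<open>i\<close> have integral 0.\<close>

lemma integral_has_pd_eq_0:
  assumes cF: "continuous_on UNIV F" and cG: "continuous_on UNIV G"
    and pd: "\<And>x. has_pd i F (G x) x" and supp: "\<And>x. F x \<noteq> 0 \<Longrightarrow> norm x \<le> R"
  shows "(LINT x|lborel. G x) = 0"
proof -
  define e :: "real^3" where "e = axis i 1"
  have ne: "norm e = 1" by (simp add: e_def norm_axis_1)
  have G0: "G x = 0" if "norm x > R" for x
  proof -
    have "has_pd i F 0 x"
    proof (rule has_pd_transform_open)
      show "((\<lambda>s. (\<lambda>_. 0) (x + s *\<^sub>R axis i 1)) has_vector_derivative 0) (at 0)" by simp
      show "x \<in> - cball 0 R" using that by simp
      show "0 = F y" if "y \<in> - cball 0 R" for y using supp[of y] that by auto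
    qed (simp add: open_Compl)
    with pd[of x] show ?thesis using vector_derivative_unique_at by blast
  qed
  have "bounded (G ` cball 0 R)"
    by (intro compact_imp_bounded compact_continuous_image continuous_on_subset[OF cG]) auto
  then obtain M0 where M0: "\<And>x. x \<in> cball 0 R \<Longrightarrow> norm (G x) \<le> M0"
    unfolding bounded_iff by blast
  define M where "M = max 0 M0"
  have M: "norm (G x) \<le> M" for x
    using G0[of x] M0[of x] by (cases "norm x \<le> R") (auto simp: M_def)
  have diff: "norm (F (x + h *\<^sub>R e) - F x) \<le> M * h" if "h \<ge> 0" for x h
  proof -
    have "norm ((\<lambda>s. F (x + s *\<^sub>R e)) h - (\<lambda>s. F (x + s *\<^sub>R e)) 0) \<le> M * norm (h - 0)"
    proof (rule differentiable_bound[where S = UNIV and f' = "\<lambda>s r. r *\<^sub>R G (x + s *\<^sub>R e)"])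
      show "((\<lambda>s. F (x + s *\<^sub>R e)) has_derivative (\<lambda>r. r *\<^sub>R G (x + s *\<^sub>R e))) (at s within UNIV)" for s
        using has_pd_shift[OF pd, of x s] by (simp add: has_vector_derivative_def e_def)
      show "onorm (\<lambda>r. r *\<^sub>R G (x + s *\<^sub>R e)) \<le> M" for s
        by (rule onorm_le) (use M[of "x + s *\<^sub>R e"] in \<open>simp add: mult.commute[of M] mult_left_mono\<close>)
    qed auto
    then show ?thesis using that by simp
  qed
  define D where "D n x = real (Suc n) *\<^sub>R (F (x + inverse (real (Suc n)) *\<^sub>R e) - F x)" for n x
  have iF: "integrable lborel F"
    by (rule integrable_continuous_bounded_support[OF cF supp])
  have [measurable]: "F \<in> borel_measurable borel" "G \<in> borel_measurable borel"
    using cF cG by (auto intro: borel_measurable_continuous_onI)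
  have "integrable (distr lborel borel ((+) v)) F" for v
    by (simp add: lborel_distr_plus iF)
  then have iFv: "integrable lborel (\<lambda>x. F (v + x))" for v
    by (subst (asm) integrable_distr_eq) auto
  have "integral\<^sup>L (distr lborel borel ((+) v)) F = integral\<^sup>L lborel F" for v
    by (simp add: lborel_distr_plus)
  then have IFv: "(LINT x|lborel. F (v + x)) = integral\<^sup>L lborel F" for v
    by (subst (asm) integral_distr) auto
  have ID: "(LINT x|lborel. D n x) = 0" for n
    using iFv[of "inverse (real (Suc n)) *\<^sub>R e"] IFv[of "inverse (real (Suc n)) *\<^sub>R e"] iF
    unfolding D_def by (simp add: add.commute)
  \<comment> \<open>The steps \<open>1 / (n + 1)\<close> are at most 1, so all quotients vanish
    outside the ball of radius \<open>R + 1\<close>; inside it the mean value bound \<open>M\<close>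
    dominates them.\<close>
  have "(\<lambda>n. LINT x|lborel. D n x) \<longlonglongrightarrow> (LINT x|lborel. G x)"
  proof (rule integral_dominated_convergence[where w = "\<lambda>x. M * indicator (cball 0 (R + 1)) x"])
    show "integrable lborel (\<lambda>x. M * indicator (cball (0::real^3) (R + 1)) x)"
      by (intro integrable_mult_right integrable_real_indicator) (use emeasure_lborel_cball_finite[of "0::real^3" "R + 1"] in auto)
    show "AE x in lborel. (\<lambda>n. D n x) \<longlonglongrightarrow> G x"
    proof (rule AE_I2)
      fix x
      have "(\<lambda>h. norm (F (x + h *\<^sub>R e) - F x - h *\<^sub>R G x) / norm h) \<midarrow>0\<rightarrow> 0"
        using pd[of x] unfolding has_vector_derivative_def has_derivative_at e_def by simp
      moreover have "filterlim (\<lambda>n. inverse (real (Suc n))) (at 0) sequentially"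
        unfolding filterlim_at using LIMSEQ_inverse_real_of_nat by auto
      ultimately have L: "(\<lambda>n. norm (F (x + inverse (real (Suc n)) *\<^sub>R e) - F x - inverse (real (Suc n)) *\<^sub>R G x)
          / norm (inverse (real (Suc n)))) \<longlonglongrightarrow> 0"
        by (rule filterlim_compose)
      have E: "norm (D n x - G x) = norm (F (x + inverse (real (Suc n)) *\<^sub>R e) - F x - inverse (real (Suc n)) *\<^sub>R G x)
          / norm (inverse (real (Suc n)))" for n
      proof -
        have "D n x - G x = real (Suc n) *\<^sub>R (F (x + inverse (real (Suc n)) *\<^sub>R e) - F x - inverse (real (Suc n)) *\<^sub>R G x)"
          by (simp add: D_def scaleR_diff_right del: of_nat_Suc)
        then show ?thesis by (simp add: divide_inverse mult.commute del: of_nat_Suc)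
      qed
      show "(\<lambda>n. D n x) \<longlonglongrightarrow> G x"
        unfolding LIM_zero_iff[of _ "G x", symmetric] tendsto_norm_zero_iff[symmetric, of "\<lambda>n. D n x - G x"] E by (rule L)
    qed
    show "AE x in lborel. norm (D n x) \<le> M * indicator (cball 0 (R + 1)) x" for n
    proof (rule AE_I2)
      fix x
      define h where "h = inverse (real (Suc n))"
      have h: "h > 0" "h \<le> 1" "real (Suc n) = inverse h" unfolding h_def by (auto simp: field_simps)
      show "norm (D n x) \<le> M * indicator (cball 0 (R + 1)) x"
      proof (cases "norm x \<le> R + 1")
        case True
        have "D n x = inverse h *\<^sub>R (F (x + h *\<^sub>R e) - F x)"
          by (simp add: D_def h_def)
        then have "norm (D n x) = norm (F (x + h *\<^sub>R e) - F x) / h"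
          using h(1) by (simp add: divide_inverse mult.commute)
        then show ?thesis
          using diff[of h x] h(1) True by (simp add: divide_le_eq)
      next
        case False
        have "norm (x + h *\<^sub>R e) \<ge> norm x - norm (h *\<^sub>R e)" by (metis norm_diff_ineq)
        then have "F (x + h *\<^sub>R e) = 0" "F x = 0" using supp[of "x + h *\<^sub>R e"] supp[of x] False h ne by auto
        then show ?thesis by (simp add: D_def h_def[symmetric] M_def del: of_nat_Suc)
      qed
    qed
  qed (auto simp: D_def)
  then show ?thesis by (simp add: ID LIMSEQ_const_iff)
qed

section \<open>Continuous functions supported in an annulus\<close>

definition annular :: "wave \<Rightarrow> bool" where
  "annular f \<longleftrightarrow> continuous_on UNIV f \<and> (\<exists>r>0. \<exists>R. \<forall>x. f x \<noteq> 0 \<longrightarrow> r \<le> norm x \<and> norm x \<le> R)"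

lemma annular_integrable: "annular f \<Longrightarrow> integrable lborel f"
  unfolding annular_def using integrable_continuous_bounded_support by blast

text \<open>Coefficients such as \<open>a / (norm x)\<^sup>2\<close> are continuous only off the
  origin. The product is identically 0 on a ball around the origin, so continuity on the two open
  sets glues together, whatever value the coefficient is given at 0.\<close>

lemma annular_mult_left:
  assumes "continuous_on (-{0}) c" "annular f"
  shows "annular (\<lambda>x. c x * f x)"
proof -
  obtain r R where r: "r > 0" "\<And>x. f x \<noteq> 0 \<Longrightarrow> r \<le> norm x \<and> norm x \<le> R" and f: "continuous_on UNIV f"
    using assms(2) unfolding annular_def by blast
  have "continuous_on (-{0}) (\<lambda>x. c x * f x)"
    by (intro continuous_intros assms continuous_on_subset[OF f]) auto
  moreover have "continuous_on (ball 0 r) (\<lambda>x. c x * f x)"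
    by (rule continuous_on_eq[OF continuous_on_const[of _ 0]]) (use r in force)
  ultimately have "continuous_on (-{0} \<union> ball 0 r) (\<lambda>x. c x * f x)"
    by (intro continuous_on_open_Un) auto
  moreover have "-{0} \<union> ball 0 r = (UNIV :: (real^3) set)" using r by auto
  ultimately show ?thesis unfolding annular_def using r by auto
qed

lemma annular_mult:
  assumes "annular f" "annular g" shows "annular (\<lambda>x. f x * g x)"
proof (rule annular_mult_left[OF _ assms(2)])
  show "continuous_on (-{0}) f"
    using assms(1) continuous_on_subset unfolding annular_def by auto
qed

lemma annular_cnj: "annular f \<Longrightarrow> annular (\<lambda>x. cnj (f x))"
  unfolding annular_def by (auto intro!: continuous_intros)

lemma annular_add:
  assumes "annular f" "annular g"
  shows "annular (\<lambda>x. f x + g x)"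
proof -
  obtain r R where r: "r > 0" "\<And>x. f x \<noteq> 0 \<Longrightarrow> r \<le> norm x \<and> norm x \<le> R" and f: "continuous_on UNIV f"
    using assms(1) unfolding annular_def by blast
  obtain r' R' where r': "r' > 0" "\<And>x. g x \<noteq> 0 \<Longrightarrow> r' \<le> norm x \<and> norm x \<le> R'" and g: "continuous_on UNIV g"
    using assms(2) unfolding annular_def by blast
  have "min r r' \<le> norm x \<and> norm x \<le> max R R'" if "f x + g x \<noteq> 0" for x
    using that r(2)[of x] r'(2)[of x] by (cases "f x = 0") auto
  then show ?thesis unfolding annular_def using r(1) r'(1) f g
    by (intro conjI continuous_intros exI[of _ "min r r'"] exI[of _ "max R R'"]) auto
qed

lemma annular_scale: "annular f \<Longrightarrow> annular (\<lambda>x. c * f x)"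
  by (rule annular_mult_left) auto

lemma annular_diff:
  assumes "annular f" "annular g"
  shows "annular (\<lambda>x. f x - g x)"
  using annular_add[OF assms(1) annular_scale[OF assms(2), of "-1"]] by simp

lemma annular_0: "annular (\<lambda>x. 0)"
  unfolding annular_def by (auto intro!: exI[of _ 1])

lemma annular_sum:
  "(\<And>i. i \<in> I \<Longrightarrow> annular (f i)) \<Longrightarrow> annular (\<lambda>x. \<Sum>i\<in>I. f i x)"
  by (induction I rule: infinite_finite_induct) (auto intro: annular_0 annular_add)

lemmas annular_intros = annular_mult annular_cnj annular_add annular_scale annular_diff annular_sum

section \<open>Calculus of partial derivatives and of the classes \<open>C_k\<close>\<close>

lemma partial_derivI:
  assumes "(f has_derivative f') (at x)"
  shows "partial_deriv i f x = f' (axis i 1)"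
  using frechet_derivative_at[OF assms] by (simp add: partial_deriv_def)

text \<open>Bridge from the Frechet derivative in the definitions to derivatives along coordinate
  lines. The latter also make sense for products with coefficients that are singular at the origin,
  and integration by parts asks for nothing more.\<close>

lemma has_pd_partial_deriv:
  assumes "f differentiable (at x)"
  shows "has_pd i f (partial_deriv i f x) x"
proof -
  have f: "(f has_derivative frechet_derivative f (at x)) (at x)"
    using assms frechet_derivative_works by blast
  then have l: "linear (frechet_derivative f (at x))"
    by (rule has_derivative_linear)
  have "((\<lambda>s::real. x + s *\<^sub>R axis i 1) has_derivative (\<lambda>s. s *\<^sub>R axis i 1)) (at 0)"
    by (auto intro!: derivative_eq_intros)
  then have "((\<lambda>s. f (x + s *\<^sub>R axis i 1)) has_derivative (\<lambda>s. frechet_derivative f (at x) (s *\<^sub>R axis i 1))) (at 0)"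
    by (rule has_derivative_compose) (simp add: f)
  then show ?thesis
    unfolding has_vector_derivative_def partial_deriv_def by (simp add: linear_scale[OF l])
qed

lemma has_pd_unique: "has_pd i f D x \<Longrightarrow> has_pd i f D' x \<Longrightarrow> D = D'"
  using vector_derivative_unique_at by blast

lemma has_pd_mult:
  "has_pd i f D x \<Longrightarrow> has_pd i g D' x \<Longrightarrow> has_pd i (\<lambda>x. f x * g x) (f x * D' + D * g x) x"
  using has_vector_derivative_mult[of "\<lambda>s. f (x + s *\<^sub>R axis i 1)" D 0 UNIV "\<lambda>s. g (x + s *\<^sub>R axis i 1)" D'] by simp

lemma has_pd_diff:
  "has_pd i f D x \<Longrightarrow> has_pd i g D' x \<Longrightarrow> has_pd i (\<lambda>x. f x - g x) (D - D') x"
  using has_vector_derivative_diff by blast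

lemma has_pd_cnj: "has_pd i f D x \<Longrightarrow> has_pd i (\<lambda>x. cnj (f x)) (cnj D) x"
  by (rule has_vector_derivative_cnj)

lemma has_pd_coord: "has_pd i (\<lambda>x. complex_of_real (x $ i)) 1 x"
proof -
  have "((\<lambda>s. complex_of_real (x $ i + s)) has_derivative complex_of_real) (at 0)"
    by (auto intro!: derivative_eq_intros)
  then show ?thesis
    by (simp add: axis_def has_vector_derivative_def of_real_def[abs_def])
qed

lemma norm_add_axis_sq:
  fixes x :: "real^'n"
  shows "(norm (x + s *\<^sub>R axis i 1))\<^sup>2 = (norm x)\<^sup>2 + 2 * s * x $ i + s\<^sup>2"
  unfolding power2_norm_eq_inner
  by (simp add: inner_add_left inner_add_right inner_axis inner_axis' power2_eq_square algebra_simps)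

text \<open>Radial functions are written in the variable |x|^2 throughout: along a coordinate line
  it is a quadratic polynomial, so the chain rule also covers the origin.\<close>

lemma has_pd_radial:
  assumes "(h has_vector_derivative D) (at ((norm x)\<^sup>2))"
  shows "has_pd i (\<lambda>x. h ((norm x)\<^sup>2)) (complex_of_real (2 * x $ i) * D) x"
proof -
  have "((\<lambda>s. (norm (x + s *\<^sub>R axis i 1))\<^sup>2) has_vector_derivative (2 * x $ i)) (at 0)"
    unfolding norm_add_axis_sq by (auto intro!: derivative_eq_intros simp: has_vector_derivative_def)
  from vector_diff_chain_at[OF this, of h D] assms show ?thesis
    by (simp add: o_def scaleR_conv_of_real)
qed

lemma C_k_Suc_imp: "C_k (Suc k) f \<Longrightarrow> C_k k f"
proof (induction k arbitrary: f)
  case 0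
  then show ?case
    by (auto intro!: continuous_at_imp_continuous_on differentiable_imp_continuous_within)
next
  case (Suc k)
  then show ?case by (metis C_k.simps(2))
qed

lemma C_k_continuous: "C_k k f \<Longrightarrow> continuous_on UNIV f"
  by (induction k) (use C_k_Suc_imp in \<open>auto simp del: C_k.simps(2)\<close>)

lemma C_k_add:
  "C_k k f \<Longrightarrow> C_k k g \<Longrightarrow> C_k k (\<lambda>x. f x + g x)"
proof (induction k arbitrary: f g)
  case 0
  then show ?case by (auto intro: continuous_intros)
next
  case (Suc k)
  have "partial_deriv i (\<lambda>x. f x + g x) = (\<lambda>x. partial_deriv i f x + partial_deriv i g x)" for i
    using Suc.prems by (auto simp: fun_eq_iff partial_deriv_def frechet_derivative_works
        intro!: partial_derivI[unfolded partial_deriv_def] has_derivative_add)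
  with Suc show ?case by auto
qed

lemma C_k_mult:
  "C_k k f \<Longrightarrow> C_k k g \<Longrightarrow> C_k k (\<lambda>x. f x * g x)"
proof (induction k arbitrary: f g)
  case 0
  then show ?case by (auto intro: continuous_intros)
next
  case (Suc k)
  have "partial_deriv i (\<lambda>x. f x * g x) = (\<lambda>x. f x * partial_deriv i g x + partial_deriv i f x * g x)" for i
    using Suc.prems by (auto simp: fun_eq_iff partial_deriv_def frechet_derivative_works
        intro!: partial_derivI[unfolded partial_deriv_def] has_derivative_mult)
  moreover have "C_k k (\<lambda>x. f x * partial_deriv i g x + partial_deriv i f x * g x)" for i
    by (intro C_k_add Suc.IH C_k_Suc_imp[OF Suc.prems(1)] C_k_Suc_imp[OF Suc.prems(2)]) (use Suc.prems in auto)
  ultimately show ?case using Suc.prems by auto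
qed

lemma partial_deriv_const: "partial_deriv i (\<lambda>x. c) = (\<lambda>x. 0)"
  by (auto simp: fun_eq_iff partial_deriv_def)

lemma C_k_const: "C_k k (\<lambda>x. c)"
  by (induction k arbitrary: c) (auto simp: partial_deriv_const)

lemma C_k_scale: "C_k k f \<Longrightarrow> C_k k (\<lambda>x. c * f x)"
  by (intro C_k_mult C_k_const)

lemma C_k_coord: "C_k k (\<lambda>x. complex_of_real (x $ j))"
proof (cases k)
  case 0
  then show ?thesis by (auto intro!: continuous_intros)
next
  case (Suc l)
  have d: "((\<lambda>x::real^3. complex_of_real (x $ j)) has_derivative (\<lambda>x. complex_of_real (x $ j))) (at x)" for x
    by (intro bounded_linear.has_derivative[OF bounded_linear_of_real] bounded_linear_imp_has_derivative bounded_linear_vec_nth)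
  have "partial_deriv i (\<lambda>x. complex_of_real (x $ j)) = (\<lambda>x. complex_of_real (axis i 1 $ j))" for i
    using partial_derivI[OF d] by auto
  then show ?thesis using Suc d by (auto simp: differentiable_def C_k_const)
qed

lemma partial_deriv_lin:
  assumes "C_k (Suc 0) f" "C_k (Suc 0) g"
  shows "partial_deriv i (\<lambda>x. f x + c * g x) x = partial_deriv i f x + c * partial_deriv i g x"
proof (rule has_pd_unique)
  have d: "f differentiable (at x)" "g differentiable (at x)" "(\<lambda>x. f x + c * g x) differentiable (at x)"
    using assms by auto
  show "has_pd i (\<lambda>x. f x + c * g x) (partial_deriv i (\<lambda>x. f x + c * g x) x) x"
    by (rule has_pd_partial_deriv[OF d(3)])
  show "has_pd i (\<lambda>x. f x + c * g x) (partial_deriv i f x + c * partial_deriv i g x) x"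
    by (intro has_vector_derivative_add has_vector_derivative_mult_right has_pd_partial_deriv d)
qed

lemma annular_partial_deriv:
  assumes "annular f" "C_k (Suc 0) f"
  shows "annular (partial_deriv i f)"
proof -
  obtain r R where r: "r > 0" "\<And>x. f x \<noteq> 0 \<Longrightarrow> r \<le> norm x \<and> norm x \<le> R"
    using assms(1) unfolding annular_def by blast
  have "r \<le> norm x \<and> norm x \<le> R" if "partial_deriv i f x \<noteq> 0" for x
  proof (rule ccontr)
    define S where "S = ball 0 r \<union> - cball (0::real^3) R"
    assume "\<not> (r \<le> norm x \<and> norm x \<le> R)"
    then have x: "x \<in> S" by (auto simp: S_def)
    have "has_pd i f 0 x"
    proof (rule has_pd_transform_open)
      show "((\<lambda>s. (\<lambda>_. 0) (x + s *\<^sub>R axis i 1)) has_vector_derivative 0) (at 0)" by simp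
      show "0 = f y" if "y \<in> S" for y using r(2)[of y] that by (cases "f y = 0") (auto simp: S_def)
    qed (auto simp: x S_def[symmetric], simp add: S_def open_Un open_Compl)
    moreover have "has_pd i f (partial_deriv i f x) x"
      by (rule has_pd_partial_deriv) (use assms(2) in simp)
    ultimately have "partial_deriv i f x = 0"
      using has_pd_unique by blast
    then show False using that by simp
  qed
  then show ?thesis using assms(2) r(1) unfolding annular_def by auto
qed

text \<open>A compact support that misses the origin lies between two positive radii. This trades
  the topological support for the bounds that make integrals with coefficients singular at 0
  harmless.\<close>

lemma test_functions_punctured_iff:
  "f \<in> test_functions (-{0}) \<longleftrightarrow> (\<forall>k. C_k k f) \<and> annular f"
proof
  assume f: "f \<in> test_functions (-{0})"
  let ?S = "closure {x. f x \<noteq> 0}"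
  have "bounded ?S" using f by (auto simp: test_functions_def compact_imp_bounded)
  then obtain R where R: "\<And>x. x \<in> ?S \<Longrightarrow> norm x \<le> R" unfolding bounded_iff by blast
  have "0 \<in> - ?S" using f by (auto simp: test_functions_def)
  moreover have "open (- ?S)" by auto
  ultimately obtain r where r: "r > 0" "ball 0 r \<subseteq> - ?S" by (meson openE)
  have "r \<le> norm x \<and> norm x \<le> R" if "f x \<noteq> 0" for x
  proof -
    have "x \<in> ?S" by (rule subsetD[OF closure_subset]) (use that in simp)
    then have "x \<notin> ball 0 r" using r(2) by blast
    then show ?thesis using R[OF \<open>x \<in> ?S\<close>] by simp
  qed
  then show "(\<forall>k. C_k k f) \<and> annular f"
    using f r(1) C_k_continuous by (auto simp: test_functions_def annular_def)
next
  assume f: "(\<forall>k. C_k k f) \<and> annular f"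
  then obtain r R where r: "r > 0" "\<And>x. f x \<noteq> 0 \<Longrightarrow> r \<le> norm x \<and> norm x \<le> R"
    unfolding annular_def by blast
  have s: "closure {x. f x \<noteq> 0} \<subseteq> cball 0 R - ball 0 r"
    by (rule closure_minimal) (use r(2) in \<open>force simp: closed_Diff not_less\<close>)+
  then have "bounded (closure {x. f x \<noteq> 0})"
    using bounded_subset by blast
  then have "compact (closure {x. f x \<noteq> 0})"
    by (simp add: compact_eq_bounded_closed)
  then show "f \<in> test_functions (-{0})"
    using s r(1) f by (auto simp: test_functions_def)
qed

section \<open>Semi-inner products\<close>

text \<open>Used for the L^2 product and for the form on smooth annular functions. Definiteness is
  not assumed because functions are not identified almost everywhere, and \<open>V\<close> is a set
  because neither pairing is well behaved on all functions.\<close>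

locale semi_inner_form =
  fixes V :: "wave set" and B :: "wave \<Rightarrow> wave \<Rightarrow> complex"
  assumes lin_mem: "f \<in> V \<Longrightarrow> g \<in> V \<Longrightarrow> (\<lambda>x. f x + c * g x) \<in> V"
    and lin: "f \<in> V \<Longrightarrow> g \<in> V \<Longrightarrow> h \<in> V \<Longrightarrow> B (\<lambda>x. f x + c * g x) h = B f h + c * B g h"
    and herm: "f \<in> V \<Longrightarrow> g \<in> V \<Longrightarrow> B g f = cnj (B f g)"
    and nonneg: "f \<in> V \<Longrightarrow> 0 \<le> Re (B f f)"
begin

lemma diff_mem: "f \<in> V \<Longrightarrow> g \<in> V \<Longrightarrow> (\<lambda>x. f x - g x) \<in> V"
  using lin_mem[of f g "-1"] by simp

lemma diff_left: "f \<in> V \<Longrightarrow> g \<in> V \<Longrightarrow> h \<in> V \<Longrightarrow> B (\<lambda>x. f x - g x) h = B f h - B g h"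
  using lin[of f g h "-1"] by simp

lemma lin_right:
  assumes "f \<in> V" "g \<in> V" "h \<in> V"
  shows "B h (\<lambda>x. f x + c * g x) = B h f + cnj c * B h g"
  using assms lin_mem by (simp add: herm[of _ h] lin)

lemma Re_lin:
  assumes "f \<in> V" "g \<in> V"
  shows "Re (B (\<lambda>x. f x + c * g x) (\<lambda>x. f x + c * g x)) =
    Re (B f f) + 2 * Re (cnj c * B f g) + (norm c)\<^sup>2 * Re (B g g)"
proof -
  have "Im (B g g) = 0" using herm[OF assms(2,2)] by (metis Im_complex_of_real Reals_cnj_iff complex_is_Real_iff)
  then have "B g g = complex_of_real (Re (B g g))" by (simp add: complex_eq_iff)
  have "B (\<lambda>x. f x + c * g x) (\<lambda>x. f x + c * g x) =
      B f f + cnj c * B f g + (c * cnj (B f g) + c * (cnj c * B g g))"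
    using assms lin_mem by (simp add: lin lin_right herm[OF assms] algebra_simps)
  also have "c * (cnj c * B g g) = complex_of_real ((norm c)\<^sup>2 * Re (B g g))"
    using complex_norm_square[of c] \<open>B g g = _\<close> by (simp add: mult.assoc[symmetric])
  finally show ?thesis by simp
qed

text \<open>Nonnegativity at \<open>f - t B(f,g) g\<close> for real \<open>t\<close> gives a real
  quadratic in \<open>t\<close>; for \<open>Re (B g g) > 0\<close> its minimiser is
  \<open>1 / Re (B g g)\<close>.\<close>

lemma Cauchy_Schwarz:
  assumes "f \<in> V" "g \<in> V"
  shows "(norm (B f g))\<^sup>2 \<le> Re (B f f) * Re (B g g)"
proof -
  define n where "n = (norm (B f g))\<^sup>2"
  have *: "0 \<le> Re (B f f) - 2 * t * n + t\<^sup>2 * n * Re (B g g)" for t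
  proof -
    have "cnj (- (complex_of_real t * B f g)) * B f g = - (complex_of_real t * (B f g * cnj (B f g)))"
      by simp
    also have "\<dots> = - complex_of_real (t * n)"
      unfolding n_def complex_norm_square[symmetric] by simp
    finally have "Re (cnj (- (complex_of_real t * B f g)) * B f g) = Re (- complex_of_real (t * n))"
      by (rule arg_cong)
    then have "Re (cnj (- (complex_of_real t * B f g)) * B f g) = - t * n"
      by (simp only: uminus_complex.sel Re_complex_of_real mult_minus_left)
    moreover have "(norm (- (complex_of_real t * B f g)))\<^sup>2 = t\<^sup>2 * n"
      by (simp add: norm_mult power_mult_distrib n_def)
    ultimately show ?thesis
      using nonneg[OF lin_mem[OF assms, of "- (complex_of_real t * B f g)"]]
      unfolding Re_lin[OF assms] by simp
  qed
  show ?thesis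
  proof (cases "Re (B g g) = 0")
    case True
    have "n = 0"
    proof (rule ccontr)
      assume "n \<noteq> 0"
      \<comment> \<open>In the degenerate case the quadratic is affine in \<open>t\<close>. This
        \<open>t\<close> makes its value \<open>- 1 - Re (B f f)\<close>, which is negative.\<close>
      then have e: "2 * ((2 * Re (B f f) + 1) / (2 * n)) * n = 2 * Re (B f f) + 1" by simp
      have "0 \<le> - 1 - Re (B f f)"
        using *[of "(2 * Re (B f f) + 1) / (2 * n)"] True unfolding e by simp
      with nonneg[OF assms(1)] show False by simp
    qed
    then show ?thesis using True by (simp add: n_def)
  next
    case False
    then have "Re (B g g) > 0" using nonneg[OF assms(2)] by simp
    then have "n \<le> Re (B f f) * Re (B g g)"
      using *[of "1 / Re (B g g)"] by (simp add: field_simps power2_eq_square)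
    then show ?thesis by (simp only: n_def)
  qed
qed

definition N :: "wave \<Rightarrow> real" where "N f = sqrt (Re (B f f))"

lemma N_nonneg: "f \<in> V \<Longrightarrow> 0 \<le> N f"
  by (simp add: N_def nonneg)

lemma N_sq: "f \<in> V \<Longrightarrow> (N f)\<^sup>2 = Re (B f f)"
  by (simp add: N_def nonneg)

lemma norm_le_N: "f \<in> V \<Longrightarrow> g \<in> V \<Longrightarrow> norm (B f g) \<le> N f * N g"
  by (rule power2_le_imp_le) (simp_all add: power_mult_distrib N_sq Cauchy_Schwarz N_nonneg)

lemma N_diff:
  assumes "f \<in> V" "g \<in> V"
  shows "N (\<lambda>x. f x - g x) \<le> N f + N g"
proof (rule power2_le_imp_le)
  have "(N (\<lambda>x. f x - g x))\<^sup>2 = (N f)\<^sup>2 - 2 * Re (B f g) + (N g)\<^sup>2"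
    using Re_lin[OF assms, of "-1"] diff_mem[OF assms] assms by (simp add: N_sq)
  moreover have "- Re (B f g) \<le> N f * N g"
    using norm_le_N[OF assms] abs_Re_le_cmod[of "B f g"] by linarith
  ultimately show "(N (\<lambda>x. f x - g x))\<^sup>2 \<le> (N f + N g)\<^sup>2"
    by (simp add: power2_sum)
qed (use assms N_nonneg in auto)

text \<open>Subtraction is the only operation at hand, so the triangle inequality is applied to f =
  (f - g) - (0 - g).\<close>

lemma N_le:
  assumes "f \<in> V" "g \<in> V"
  shows "N f \<le> N (\<lambda>x. f x - g x) + N g"
proof -
  have 1: "(\<lambda>x. 0) \<in> V" using diff_mem[OF assms(2,2)] by simp
  have 2: "(\<lambda>x. 0 - g x) \<in> V" using diff_mem[OF 1 assms(2)] .
  have "B (\<lambda>x. 0) (\<lambda>x. 0) = 0" using diff_left[OF assms(2,2) 1] by simp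
  then have "N (\<lambda>x. 0 - g x) \<le> N g" using N_diff[OF 1 assms(2)] by (simp add: N_def)
  then show ?thesis using N_diff[OF diff_mem[OF assms] 2] by simp
qed

end

section \<open>The form on smooth functions supported away from the origin\<close>

definition lap :: "wave \<Rightarrow> wave" where
  "lap f x = (\<Sum>i\<in>UNIV. partial_deriv i (partial_deriv i f) x)"

definition lop :: "real \<Rightarrow> wave \<Rightarrow> wave" where
  "lop a f x = complex_of_real (a / (norm x)\<^sup>2) * f x - lap f x"

text \<open>Two derivatives suffice to move the whole form onto \<open>lop a g\<close>. The class
  contains the test functions on the punctured space and is closed under linear
  combinations.\<close>

definition C2a :: "wave set" where "C2a = {f. C_k (Suc (Suc 0)) f \<and> annular f}"

lemma C2aD:
  assumes "f \<in> C2a"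
  shows "C_k (Suc (Suc 0)) f" "C_k (Suc 0) f" "C_k (Suc 0) (partial_deriv i f)"
    "f differentiable (at x)" "partial_deriv i f differentiable (at x)"
    "annular f" "annular (partial_deriv i f)" "annular (partial_deriv i (partial_deriv i f))"
proof -
  show *: "C_k (Suc (Suc 0)) f" "annular f" using assms by (auto simp: C2a_def)
  then show **: "C_k (Suc 0) f" "C_k (Suc 0) (partial_deriv i f)" by (blast intro: C_k_Suc_imp, simp)
  show "f differentiable (at x)" "partial_deriv i f differentiable (at x)" using * by auto
  show "annular (partial_deriv i f)" by (rule annular_partial_deriv[OF *(2) **(1)])
  then show "annular (partial_deriv i (partial_deriv i f))" by (rule annular_partial_deriv[OF _ **(2)])
qed

lemma continuous_on_inv_norm_sq:
  "continuous_on (-{0}) (\<lambda>x::real^3. complex_of_real (a / (norm x)\<^sup>2))"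
  by (auto intro!: continuous_intros)

lemma annular_lop: "f \<in> C2a \<Longrightarrow> annular (lop a f)"
  unfolding lop_def lap_def
  by (intro annular_diff annular_mult_left[OF continuous_on_inv_norm_sq] annular_sum C2aD)

lemma annular_sesq:
  assumes "f \<in> C2a" "g \<in> C2a"
  shows "annular (\<lambda>x. (\<Sum>i\<in>UNIV. partial_deriv i f x * cnj (partial_deriv i g x))
     + complex_of_real (a / (norm x)\<^sup>2) * f x * cnj (g x))"
  unfolding mult.assoc using assms
  by (intro annular_add annular_mult_left[OF continuous_on_inv_norm_sq] annular_sum annular_mult annular_cnj C2aD)

lemma annular_integral_pd:
  assumes "annular F" "annular G" "\<And>x. has_pd i F (G x) x"
  shows "(LINT x|lborel. G x) = 0"
  using assms integral_has_pd_eq_0 unfolding annular_def by blast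

text \<open>The two integrands differ by the divergence of
  \<open>f * cnj (partial_deriv i g)\<close>, an annular field whose divergence integrates to
  0.\<close>

lemma sesq_form_eq_lop:
  assumes f: "f \<in> C2a" and g: "g \<in> C2a"
  shows "sesq_form a f g = L2_inner f (lop a g)"
proof -
  define G where "G i x = f x * cnj (partial_deriv i (partial_deriv i g) x) +
      partial_deriv i f x * cnj (partial_deriv i g x)" for i x
  have aG: "annular (G i)" for i
    unfolding G_def using f g by (intro annular_intros C2aD)
  have "(LINT x|lborel. G i x) = 0" for i
  proof (rule annular_integral_pd)
    show "annular (\<lambda>x. f x * cnj (partial_deriv i g x))" using f g by (intro annular_intros C2aD)
    show "annular (G i)" by (rule aG)
    show "has_pd i (\<lambda>x. f x * cnj (partial_deriv i g x)) (G i x) x" for x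
      unfolding G_def using C2aD[OF f] C2aD[OF g]
      by (intro has_pd_mult has_pd_cnj has_pd_partial_deriv)
  qed
  then have 0: "(LINT x|lborel. (\<Sum>i\<in>UNIV. G i x)) = 0"
    using aG by (simp add: annular_integrable)
  have aL: "annular (\<lambda>x. f x * cnj (lop a g x))"
    using f g by (intro annular_intros C2aD annular_lop)
  have "sesq_form a f g = (LINT x|lborel. f x * cnj (lop a g x) + (\<Sum>i\<in>UNIV. G i x))"
    unfolding sesq_form_def
    by (intro Bochner_Integration.integral_cong refl)
      (simp add: lop_def lap_def G_def sum.distrib sum_distrib_left algebra_simps)
  also have "\<dots> = L2_inner f (lop a g)"
    unfolding L2_inner_def using aL aG 0 by (simp add: annular_integrable)
  finally show ?thesis .
qed

text \<open>At the origin both \<open>g\<close> and its derivative vanish, so the product rule reads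
  0 = 0 there for any \<open>D\<close>; the derivative of \<open>c\<close> is demanded only
  elsewhere.\<close>

lemma has_pd_mult_annular:
  assumes "annular g" "has_pd i g D' x" "x \<noteq> 0 \<Longrightarrow> has_pd i c D x"
  shows "has_pd i (\<lambda>x. c x * g x) (c x * D' + D * g x) x"
proof (cases "x = 0")
  case True
  obtain r where r: "r > 0" "\<And>x. g x \<noteq> 0 \<Longrightarrow> r \<le> norm x"
    using assms(1) unfolding annular_def by blast
  then have x: "x \<in> ball 0 r" and g: "\<And>y. y \<in> ball 0 r \<Longrightarrow> g y = 0" using True by force+
  have "has_pd i f 0 x" if "\<And>y. y \<in> ball 0 r \<Longrightarrow> f y = 0" for f
    by (rule has_pd_transform_open[where F = "\<lambda>_. 0", OF has_vector_derivative_const open_ball x]) (use that in simp)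
  from this[of g] this[of "\<lambda>x. c x * g x"] g[OF x] show ?thesis
    using has_pd_unique[OF assms(2), of 0] g by simp
qed (use assms has_pd_mult in blast)

text \<open>Green's formula with all singularities of \<open>u\<close> confined to the origin. Since
  \<open>g\<close> vanishes near 0, no boundary term arises there, and the difference of the
  integrands is the divergence of the field \<open>F\<close>.\<close>

lemma integral_cnj_lap_eq:
  fixes u :: wave
  assumes u: "continuous_on (-{0}) u" "\<And>i. continuous_on (-{0}) (u1 i)" "\<And>i. continuous_on (-{0}) (u2 i)"
    and d: "\<And>i x. x \<noteq> 0 \<Longrightarrow> has_pd i u (u1 i x) x" "\<And>i x. x \<noteq> 0 \<Longrightarrow> has_pd i (u1 i) (u2 i x) x"
    and g: "g \<in> C2a"
  shows "(LINT x|lborel. u x * cnj (lap g x)) = (LINT x|lborel. (\<Sum>i\<in>UNIV. u2 i x) * cnj (g x))"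
proof -
  define F where "F i x = u x * cnj (partial_deriv i g x) - u1 i x * cnj (g x)" for i x
  define G where "G i x = u x * cnj (partial_deriv i (partial_deriv i g) x) - u2 i x * cnj (g x)" for i x
  have aG: "annular (G i)" for i
    unfolding G_def using g by (intro annular_diff annular_mult_left[OF u(1)] annular_mult_left[OF u(3)] annular_cnj C2aD)
  have "(LINT x|lborel. G i x) = 0" for i
  proof (rule annular_integral_pd)
    show "annular (F i)" unfolding F_def using g
      by (intro annular_diff annular_mult_left[OF u(1)] annular_mult_left[OF u(2)] annular_cnj C2aD)
    show "annular (G i)" by (rule aG)
    show "has_pd i (F i) (G i x) x" for x
    proof -
      have "has_pd i (F i) (u x * cnj (partial_deriv i (partial_deriv i g) x) + u1 i x * cnj (partial_deriv i g x) -
         (u1 i x * cnj (partial_deriv i g x) + u2 i x * cnj (g x))) x"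
        unfolding F_def using C2aD[OF g] d
        by (intro has_pd_mult_annular has_pd_diff has_pd_cnj has_pd_partial_deriv annular_cnj)
      then show ?thesis by (simp add: G_def)
    qed
  qed
  then have 0: "(LINT x|lborel. (\<Sum>i\<in>UNIV. G i x)) = 0"
    using aG by (simp add: annular_integrable)
  have a: "annular (\<lambda>x. (\<Sum>i\<in>UNIV. u2 i x) * cnj (g x))"
    using g u(3) by (intro annular_mult_left annular_cnj C2aD continuous_on_sum)
  have "(LINT x|lborel. u x * cnj (lap g x)) = (LINT x|lborel. (\<Sum>i\<in>UNIV. u2 i x) * cnj (g x) + (\<Sum>i\<in>UNIV. G i x))"
    by (intro Bochner_Integration.integral_cong refl)
      (simp add: lap_def G_def sum_subtractf sum_distrib_left sum_distrib_right)
  then show ?thesis using a aG 0 by (simp add: annular_integrable)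
qed

section \<open>Hardy inequality and the Friedrichs extension\<close>

lemma norm_sq_sum: "(norm (x::real^3))\<^sup>2 = (\<Sum>i\<in>UNIV. (x $ i)\<^sup>2)"
  unfolding power2_norm_eq_inner inner_vec_def by (simp add: power2_eq_square)

text \<open>Ground state substitution: \<open>w + X * (s * q) * f\<close> stands for |x|^(-\<sigma>)
  times the gradient of |x|^\<sigma> f, with q = 1 / |x|^2, w the gradient of f, and v, f' the
  conjugates of w, f. The relation among \<open>X\<close> and \<open>q\<close> is |x|^2 q^2 = q
  rather than |x|^2 q = 1, so that it also holds at x = 0, where q is 0.\<close>

lemma hardy_identity:
  fixes s q f f' X1 X2 X3 w1 w2 w3 v1 v2 v3 :: complex
  assumes "(X1\<^sup>2 + X2\<^sup>2 + X3\<^sup>2) * q\<^sup>2 = q"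
  shows "w1 * v1 + w2 * v2 + w3 * v3 + (s * s - s) * q * f * f' +
    (X1 * (s * q) * (f * v1 + w1 * f') + (X1 * (2 * X1 * (- s * q\<^sup>2)) + 1 * (s * q)) * (f * f') +
     (X2 * (s * q) * (f * v2 + w2 * f') + (X2 * (2 * X2 * (- s * q\<^sup>2)) + 1 * (s * q)) * (f * f')) +
     (X3 * (s * q) * (f * v3 + w3 * f') + (X3 * (2 * X3 * (- s * q\<^sup>2)) + 1 * (s * q)) * (f * f'))) =
    (w1 + X1 * (s * q) * f) * (v1 + X1 * (s * q) * f') + (w2 + X2 * (s * q) * f) * (v2 + X2 * (s * q) * f') +
    (w3 + X3 * (s * q) * f) * (v3 + X3 * (s * q) * f')" (is "?l = ?r")
proof -
  have "?r - ?l = f * f' * (s * s + 2 * s) * ((X1\<^sup>2 + X2\<^sup>2 + X3\<^sup>2) * q\<^sup>2 - q)"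
    by (simp add: algebra_simps power2_eq_square)
  then show ?thesis using assms by simp
qed

text \<open>Hardy's inequality: with \<open>a = \<sigma>\<^sup>2 - \<sigma>\<close> the integrand of the form differs from
  \<open>|\<nabla>f + \<sigma> x f / |x|\<^sup>2|\<^sup>2\<close> by the divergence of \<open>\<sigma> x |f|\<^sup>2 / |x|\<^sup>2\<close>.\<close>

lemma sesq_form_nonneg:
  assumes f: "f \<in> C2a" and a: "a = \<sigma>\<^sup>2 - \<sigma>"
  shows "0 \<le> Re (sesq_form a f f)"
proof -
  define q where "q x = complex_of_real (1 / (norm x)\<^sup>2)" for x :: "real^3"
  define c where "c i x = complex_of_real (x $ i) * (complex_of_real \<sigma> * q x)" for i x
  define D where "D i x = complex_of_real (x $ i) * (complex_of_real (2 * x $ i) * (- complex_of_real \<sigma> * (q x)\<^sup>2))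
      + 1 * (complex_of_real \<sigma> * q x)" for i x
  define G where "G i x = c i x * (f x * cnj (partial_deriv i f x) + partial_deriv i f x * cnj (f x)) +
      D i x * (f x * cnj (f x))" for i x
  have qc: "continuous_on (-{0}) q" unfolding q_def by (rule continuous_on_inv_norm_sq)
  have cc: "continuous_on (-{0}) (c i)" for i unfolding c_def by (intro continuous_intros qc)
  have Dc: "continuous_on (-{0}) (D i)" for i unfolding D_def by (intro continuous_intros qc)
  have dc: "has_pd i (c i) (D i x) x" if "x \<noteq> 0" for i x
    unfolding c_def D_def
  proof (intro has_pd_mult has_pd_coord)
    have "((\<lambda>s. complex_of_real \<sigma> * complex_of_real (1 / s)) has_vector_derivative
        complex_of_real \<sigma> * complex_of_real (- (1 / ((norm x)\<^sup>2)\<^sup>2))) (at ((norm x)\<^sup>2))"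
      using that by (intro has_vector_derivative_mult_right has_vector_derivative_of_real)
        (auto intro!: derivative_eq_intros simp: power2_eq_square has_real_derivative_iff_has_vector_derivative[symmetric])
    from has_pd_radial[OF this, of i]
    show "has_pd i (\<lambda>x. complex_of_real \<sigma> * q x) (complex_of_real (2 * x $ i) * (- complex_of_real \<sigma> * (q x)\<^sup>2)) x"
      by (simp add: q_def power_divide)
  qed
  have aG: "annular (G i)" for i
    unfolding G_def using f by (intro annular_add annular_mult_left[OF cc] annular_mult_left[OF Dc] annular_mult annular_cnj C2aD)
  have "(LINT x|lborel. G i x) = 0" for i
  proof (rule annular_integral_pd)
    show "annular (\<lambda>x. c i x * (f x * cnj (f x)))"
      using f by (intro annular_mult_left[OF cc] annular_mult annular_cnj C2aD)
    show "has_pd i (\<lambda>x. c i x * (f x * cnj (f x))) (G i x) x" for x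
      unfolding G_def using C2aD[OF f]
      by (intro has_pd_mult_annular has_pd_mult has_pd_cnj has_pd_partial_deriv annular_mult annular_cnj dc)
  qed (rule aG)
  then have 0: "(LINT x|lborel. (\<Sum>i\<in>UNIV. G i x)) = 0"
    using aG by (simp add: annular_integrable)
  have pointwise: "(\<Sum>i\<in>UNIV. partial_deriv i f x * cnj (partial_deriv i f x))
      + complex_of_real (a / (norm x)\<^sup>2) * f x * cnj (f x) + (\<Sum>i\<in>UNIV. G i x)
    = complex_of_real (\<Sum>i\<in>UNIV. (norm (partial_deriv i f x + c i x * f x))\<^sup>2)" for x
  proof -
    have q: "((complex_of_real (x$1))\<^sup>2 + (complex_of_real (x$2))\<^sup>2 + (complex_of_real (x$3))\<^sup>2) * (q x)\<^sup>2 = q x"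
    proof -
      have "((x$1)\<^sup>2 + (x$2)\<^sup>2 + (x$3)\<^sup>2) * (1 / (norm x)\<^sup>2)\<^sup>2 = 1 / (norm x)\<^sup>2"
        using norm_sq_sum[of x] by (simp add: sum_3 power2_eq_square)
      from arg_cong[OF this, of complex_of_real] show ?thesis by (simp add: q_def)
    qed
    have aq: "complex_of_real (a / (norm x)\<^sup>2) = (complex_of_real \<sigma> * complex_of_real \<sigma> - complex_of_real \<sigma>) * q x"
      by (simp add: q_def a power2_eq_square)
    have c: "cnj (c i x) = c i x" for i by (simp add: c_def q_def)
    show ?thesis
      unfolding aq G_def D_def sum_3 of_real_add complex_norm_square complex_cnj_add complex_cnj_mult c
      unfolding c_def of_real_mult of_real_numeral
      by (rule hardy_identity[OF q])
  qed
  have "sesq_form a f f = (LINT x|lborel. ((\<Sum>i\<in>UNIV. partial_deriv i f x * cnj (partial_deriv i f x))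
      + complex_of_real (a / (norm x)\<^sup>2) * f x * cnj (f x)) + (\<Sum>i\<in>UNIV. G i x))"
    unfolding sesq_form_def using annular_sesq[OF f f, of a] aG 0
    by (subst Bochner_Integration.integral_add) (simp_all add: annular_integrable)
  also have "\<dots> = complex_of_real (LINT x|lborel. (\<Sum>i\<in>UNIV. (norm (partial_deriv i f x + c i x * f x))\<^sup>2))"
    unfolding pointwise by (rule integral_complex_of_real)
  finally show ?thesis by (simp add: sum_nonneg)
qed

text \<open>Real numbers of the form \<sigma>^2 - \<sigma> are exactly those with a \<ge> -1/4, the
  range of Hardy's inequality; positivity is where this enters.\<close>

lemma semi_inner_form_sesq:
  assumes a: "a = \<sigma>\<^sup>2 - \<sigma>"
  shows "semi_inner_form C2a (sesq_form a)"
proof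
  fix f g h c
  show "(\<lambda>x. f x + c * g x) \<in> C2a" if "f \<in> C2a" "g \<in> C2a"
    using that by (auto simp: C2a_def simp del: C_k.simps intro!: C_k_add C_k_scale annular_add annular_scale)
  show "sesq_form a (\<lambda>x. f x + c * g x) h = sesq_form a f h + c * sesq_form a g h"
    if "f \<in> C2a" "g \<in> C2a" "h \<in> C2a"
  proof -
    have "sesq_form a (\<lambda>x. f x + c * g x) h = (LINT x|lborel.
        ((\<Sum>i\<in>UNIV. partial_deriv i f x * cnj (partial_deriv i h x)) + complex_of_real (a / (norm x)\<^sup>2) * f x * cnj (h x)) +
        c * ((\<Sum>i\<in>UNIV. partial_deriv i g x * cnj (partial_deriv i h x)) + complex_of_real (a / (norm x)\<^sup>2) * g x * cnj (h x)))"
      unfolding sesq_form_def partial_deriv_lin[OF C2aD(2)[OF that(1)] C2aD(2)[OF that(2)]]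
      by (intro Bochner_Integration.integral_cong refl)
        (simp add: algebra_simps sum.distrib sum_distrib_left add_divide_distrib)
    then show ?thesis
      using annular_sesq[OF that(1,3), of a] annular_sesq[OF that(2,3), of a]
      by (simp only: sesq_form_def Bochner_Integration.integral_add annular_integrable
        integrable_mult_right integral_mult_right_zero)
  qed
  show "sesq_form a g f = cnj (sesq_form a f g)"
    unfolding sesq_form_def Bochner_Integration.integral_cnj[symmetric]
    by (intro Bochner_Integration.integral_cong refl) (simp add: mult_ac)
  show "0 \<le> Re (sesq_form a f f)" if "f \<in> C2a" by (rule sesq_form_nonneg[OF that a])
qed

section \<open>L^2 as a semi-inner product space\<close>

lemma Lp_iff:
  assumes "0 \<le> p"
  shows "f \<in> Lp (ennreal p) \<longleftrightarrow> f \<in> borel_measurable lborel \<and> integrable lborel (\<lambda>x. norm (f x) powr p)"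
  using assms by (auto simp: Lp_def)

lemma Lp_2_iff:
  "f \<in> Lp 2 \<longleftrightarrow> f \<in> borel_measurable lborel \<and> integrable lborel (\<lambda>x. (norm (f x))\<^sup>2)"
  using Lp_iff[of 2 f] by (simp add: powr_numeral)

lemma Lp_2_measurable: "f \<in> Lp 2 \<Longrightarrow> f \<in> borel_measurable borel"
  by (simp add: Lp_2_iff)

lemma L2_mult_integrable:
  assumes "f \<in> Lp 2" "g \<in> Lp 2"
  shows "integrable lborel (\<lambda>x. f x * cnj (g x))"
proof (rule Bochner_Integration.integrable_bound)
  show "integrable lborel (\<lambda>x. (norm (f x))\<^sup>2 + (norm (g x))\<^sup>2)"
    using assms by (simp add: Lp_2_iff)
  show "(\<lambda>x. f x * cnj (g x)) \<in> borel_measurable lborel"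
  proof -
    have [measurable]: "f \<in> borel_measurable borel" "g \<in> borel_measurable borel"
      using assms by (auto intro: Lp_2_measurable)
    have [measurable]: "cnj \<in> borel_measurable borel"
      by (intro borel_measurable_continuous_onI continuous_intros)
    show ?thesis by measurable
  qed
  have "norm (f x) * norm (g x) \<le> (norm (f x))\<^sup>2 + (norm (g x))\<^sup>2" for x
  proof -
    have "0 \<le> norm (f x) * norm (g x)" by simp
    then show ?thesis using sum_squares_bound[of "norm (f x)" "norm (g x)"] by linarith
  qed
  then show "AE x in lborel. norm (f x * cnj (g x)) \<le> norm ((norm (f x))\<^sup>2 + (norm (g x))\<^sup>2)"
    by (auto simp: norm_mult)
qed

interpretation L2: semi_inner_form "Lp 2" L2_inner
proof
  fix f g h c
  show mem: "(\<lambda>x. f x + c * g x) \<in> Lp 2" if "f \<in> Lp 2" "g \<in> Lp 2"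
  proof -
    have [measurable]: "f \<in> borel_measurable borel" "g \<in> borel_measurable borel"
      using that by (auto intro: Lp_2_measurable)
    have "integrable lborel (\<lambda>x. (norm (f x + c * g x))\<^sup>2)"
    proof (rule Bochner_Integration.integrable_bound)
      show "integrable lborel (\<lambda>x. 2 * (norm (f x))\<^sup>2 + 2 * ((norm c)\<^sup>2 * (norm (g x))\<^sup>2))"
        using that by (simp add: Lp_2_iff)
      have "(norm (f x + c * g x))\<^sup>2 \<le> 2 * (norm (f x))\<^sup>2 + 2 * ((norm c)\<^sup>2 * (norm (g x))\<^sup>2)" for x
      proof -
        have "norm (f x + c * g x) \<le> norm (f x) + norm c * norm (g x)"
          by (metis norm_mult norm_triangle_ineq)
        then have "(norm (f x + c * g x))\<^sup>2 \<le> (norm (f x) + norm c * norm (g x))\<^sup>2"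
          by (simp add: power_mono)
        also have "\<dots> \<le> 2 * (norm (f x))\<^sup>2 + 2 * (norm c * norm (g x))\<^sup>2"
          using sum_squares_bound[of "norm (f x)" "norm c * norm (g x)"] by (simp add: power2_sum)
        finally show ?thesis by (simp add: power_mult_distrib)
      qed
      then show "AE x in lborel. norm ((norm (f x + c * g x))\<^sup>2) \<le> norm (2 * (norm (f x))\<^sup>2 + 2 * ((norm c)\<^sup>2 * (norm (g x))\<^sup>2))"
        by (auto simp: abs_of_nonneg)
    qed auto
    then show ?thesis by (simp add: Lp_2_iff)
  qed
  show "L2_inner (\<lambda>x. f x + c * g x) h = L2_inner f h + c * L2_inner g h"
    if "f \<in> Lp 2" "g \<in> Lp 2" "h \<in> Lp 2"
    using L2_mult_integrable[OF that(1,3)] L2_mult_integrable[OF that(2,3)]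
    by (simp add: L2_inner_def ring_distribs mult.assoc)
  show "L2_inner g f = cnj (L2_inner f g)"
    unfolding L2_inner_def Bochner_Integration.integral_cnj[symmetric] by (simp add: mult.commute)
  have "L2_inner f f = complex_of_real (LINT x|lborel. (norm (f x))\<^sup>2)"
    unfolding L2_inner_def complex_norm_square[symmetric] by (rule integral_complex_of_real)
  then show "0 \<le> Re (L2_inner f f)" by simp
qed

lemma Lp_norm_2: "Lp_norm 2 f = L2.N f"
proof -
  have "L2_inner f f = complex_of_real (LINT x|lborel. (norm (f x))\<^sup>2)"
    unfolding L2_inner_def complex_norm_square[symmetric] by (rule integral_complex_of_real)
  then show ?thesis by (simp add: L2.N_def Lp_norm_def powr_half_sqrt powr_numeral)
qed

lemma L2_inner_tendsto:
  assumes f: "\<And>n. f n \<in> Lp 2" "g \<in> Lp 2" "h \<in> Lp 2"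
    and lim: "(\<lambda>n. Lp_norm 2 (\<lambda>x. f n x - g x)) \<longlonglongrightarrow> 0"
  shows "(\<lambda>n. L2_inner (f n) h) \<longlonglongrightarrow> L2_inner g h" "(\<lambda>n. L2_inner h (f n)) \<longlonglongrightarrow> L2_inner h g"
proof -
  have "(\<lambda>n. L2_inner (f n) h - L2_inner g h) \<longlonglongrightarrow> 0"
  proof (rule Lim_null_comparison)
    show "\<forall>\<^sub>F n in sequentially. norm (L2_inner (f n) h - L2_inner g h) \<le> Lp_norm 2 (\<lambda>x. f n x - g x) * L2.N h"
      using L2.norm_le_N[OF L2.diff_mem[OF f(1,2)] f(3)] f by (simp add: L2.diff_left Lp_norm_2)
    show "(\<lambda>n. Lp_norm 2 (\<lambda>x. f n x - g x) * L2.N h) \<longlonglongrightarrow> 0"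
      using tendsto_mult_left_zero[OF lim] .
  qed
  then show *: "(\<lambda>n. L2_inner (f n) h) \<longlonglongrightarrow> L2_inner g h" by (simp add: LIM_zero_iff)
  show "(\<lambda>n. L2_inner h (f n)) \<longlonglongrightarrow> L2_inner h g"
    using tendsto_cnj[OF *] f by (simp add: L2.herm[of h])
qed

lemma annular_Lp_2: 
  assumes "annular f" shows "f \<in> Lp 2"
proof -
  have "integrable lborel (\<lambda>x. complex_of_real ((norm (f x))\<^sup>2))"
    unfolding complex_norm_square using assms by (intro annular_integrable annular_intros)
  then have "integrable lborel (\<lambda>x. (norm (f x))\<^sup>2)"
    by (subst (asm) complex_of_real_integrable_eq)
  then show ?thesis using assms borel_measurable_continuous_onI[of f] by (auto simp: Lp_2_iff annular_def)
qed

lemma test_functions_C2a: "f \<in> test_functions (-{0}) \<Longrightarrow> f \<in> C2a"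
  by (simp add: test_functions_punctured_iff C2a_def del: C_k.simps)

text \<open>Letting \<open>m\<close> tend to infinity in \<open>sesq_form a (\<phi> m) (\<psi> n) = L2_inner (\<phi> m) (lop a (\<psi> n))\<close> for
  fixed \<open>n\<close> uses only the convergence of \<open>\<phi>\<close> in \<open>L\<^sup>2\<close>, so that closability of the form is not
  needed separately.\<close>

lemma closed_form_eqI:
  assumes a: "a = \<sigma>\<^sup>2 - \<sigma>" and u: "u \<in> form_domain a" and v: "v \<in> form_domain a" and g: "g \<in> Lp 2"
    and weak: "\<And>\<psi>. \<psi> \<in> C2a \<Longrightarrow> L2_inner u (lop a \<psi>) = L2_inner g \<psi>"
  shows "closed_form a u v = L2_inner g v"
proof -
  interpret Q: semi_inner_form C2a "sesq_form a" by (rule semi_inner_form_sesq[OF a])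
  have u2: "u \<in> Lp 2" and v2: "v \<in> Lp 2" using u v by (auto simp: form_domain_def)
  have quad: "quad_form a f = (Q.N f)\<^sup>2" if "f \<in> C2a" for f
    using Q.N_sq[OF that] sesq_form_diagonal[of a f] by simp
  have cauchy: "\<exists>N. \<forall>m\<ge>N. \<forall>n\<ge>N. Q.N (\<lambda>x. \<phi> m x - \<phi> n x) < e"
    if \<phi>: "form_approx a \<phi> w" and e: "e > 0" for \<phi> w e
  proof -
    have \<phi>2: "(\<lambda>x. \<phi> m x - \<phi> n x) \<in> C2a" for m n
      using \<phi> by (intro Q.diff_mem) (auto simp: form_approx_def intro: test_functions_C2a)
    obtain N where "\<forall>m\<ge>N. \<forall>n\<ge>N. quad_form a (\<lambda>x. \<phi> m x - \<phi> n x) < e\<^sup>2"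
      using \<phi> e unfolding form_approx_def by (meson zero_less_power)
    then show ?thesis
      using e by (intro exI[of _ N]) (auto simp: quad[OF \<phi>2] intro: power2_less_imp_less)
  qed
  have lim: "(\<lambda>n. sesq_form a (\<phi> n) (\<psi> n)) \<longlonglongrightarrow> L2_inner g v"
    if \<phi>: "form_approx a \<phi> u" and \<psi>: "form_approx a \<psi> v" for \<phi> \<psi>
  proof -
    have C: "\<phi> n \<in> C2a" "\<psi> n \<in> C2a" for n
      using \<phi> \<psi> by (auto simp: form_approx_def intro: test_functions_C2a)
    have L: "\<phi> n \<in> Lp 2" "\<psi> n \<in> Lp 2" "lop a (\<psi> n) \<in> Lp 2" for n
      using C annular_lop by (auto intro: annular_Lp_2 C2aD)
    have approx: "(\<lambda>n. Lp_norm 2 (\<lambda>x. \<phi> n x - u x)) \<longlonglongrightarrow> 0" "(\<lambda>n. Lp_norm 2 (\<lambda>x. \<psi> n x - v x)) \<longlonglongrightarrow> 0"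
      using \<phi> \<psi> unfolding form_approx_def by blast+
    obtain N1 where N1: "\<And>m n. m \<ge> N1 \<Longrightarrow> n \<ge> N1 \<Longrightarrow> Q.N (\<lambda>x. \<psi> m x - \<psi> n x) < 1"
      using cauchy[OF \<psi>, of 1] by auto
    \<comment> \<open>A sequence that is Cauchy for the form is bounded in the form norm; the
      summand 1 bounds the tail and keeps \<open>K\<close> positive for the division below.\<close>
    define K where "K = 1 + Q.N (\<psi> N1)"
    have K: "Q.N (\<psi> n) \<le> K" if "n \<ge> N1" for n
      using Q.N_le[OF C(2)[of n] C(2)[of N1]] N1[OF that order_refl] by (simp add: K_def)
    have K0: "K > 0" using Q.N_nonneg[OF C(2)[of N1]] by (simp add: K_def)
    have "(\<lambda>n. sesq_form a (\<phi> n) (\<psi> n) - L2_inner g (\<psi> n)) \<longlonglongrightarrow> 0"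
    proof (rule LIMSEQ_I)
      fix e :: real assume e: "e > 0"
      obtain N2 where N2: "\<And>m n. m \<ge> N2 \<Longrightarrow> n \<ge> N2 \<Longrightarrow> Q.N (\<lambda>x. \<phi> m x - \<phi> n x) < e / (2 * K)"
        using cauchy[OF \<phi>, of "e / (2 * K)"] e K0 by auto
      \<comment> \<open>Only a non-strict bound survives the limit in \<open>m\<close>;
        \<open>e / 2\<close> still lies strictly below \<open>e\<close>.\<close>
      have "norm (sesq_form a (\<phi> n) (\<psi> n) - L2_inner g (\<psi> n)) \<le> e / 2" if n: "n \<ge> max N1 N2" for n
      proof (rule LIMSEQ_le_const2)
        show "(\<lambda>m. norm (sesq_form a (\<phi> n) (\<psi> n) - L2_inner (\<phi> m) (lop a (\<psi> n)))) \<longlonglongrightarrow>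
            norm (sesq_form a (\<phi> n) (\<psi> n) - L2_inner g (\<psi> n))"
          unfolding weak[OF C(2), symmetric]
          by (rule tendsto_norm[OF tendsto_diff[OF tendsto_const L2_inner_tendsto(1)[OF L(1) u2 L(3)]]])
            (rule approx(1))
        have "norm (sesq_form a (\<phi> n) (\<psi> n) - L2_inner (\<phi> m) (lop a (\<psi> n))) \<le> e / 2" if "m \<ge> N2" for m
        proof -
          have "norm (sesq_form a (\<phi> n) (\<psi> n) - L2_inner (\<phi> m) (lop a (\<psi> n))) =
              norm (sesq_form a (\<lambda>x. \<phi> n x - \<phi> m x) (\<psi> n))"
            using C by (simp add: sesq_form_eq_lop[symmetric] Q.diff_left)
          also have "\<dots> \<le> Q.N (\<lambda>x. \<phi> n x - \<phi> m x) * Q.N (\<psi> n)"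
            using C by (intro Q.norm_le_N Q.diff_mem)
          also have "\<dots> \<le> e / (2 * K) * K"
            using N2[of n m] K[of n] n that Q.N_nonneg[OF C(2)] Q.N_nonneg[OF Q.diff_mem[OF C(1) C(1)]] e K0
            by (intro mult_mono) (auto intro: less_imp_le)
          finally show ?thesis using K0 by simp
        qed
        then show "\<exists>N. \<forall>m\<ge>N. norm (sesq_form a (\<phi> n) (\<psi> n) - L2_inner (\<phi> m) (lop a (\<psi> n))) \<le> e / 2"
          by blast
      qed
      then show "\<exists>no. \<forall>n\<ge>no. norm (sesq_form a (\<phi> n) (\<psi> n) - L2_inner g (\<psi> n) - 0) < e"
        using e by (intro exI[of _ "max N1 N2"]) force
    qed
    moreover have "(\<lambda>n. L2_inner g (\<psi> n)) \<longlonglongrightarrow> L2_inner g v"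
      by (rule L2_inner_tendsto(2)[OF L(2) v2 g approx(2)])
    ultimately show ?thesis by (rule Lim_transform[rotated])
  qed
  \<comment> \<open>Without approximating sequences every \<open>c\<close> would satisfy the
    condition under \<open>THE\<close> vacuously; one pair makes the value unique.\<close>
  obtain \<phi>0 \<psi>0 where 0: "form_approx a \<phi>0 u" "form_approx a \<psi>0 v"
    using u v by (auto simp: form_domain_def)
  show ?thesis
    unfolding closed_form_def
  proof (rule the_equality)
    fix c assume "\<forall>\<phi> \<psi>. form_approx a \<phi> u \<longrightarrow> form_approx a \<psi> v \<longrightarrow> (\<lambda>n. sesq_form a (\<phi> n) (\<psi> n)) \<longlonglongrightarrow> c"
    then have "(\<lambda>n. sesq_form a (\<phi>0 n) (\<psi>0 n)) \<longlonglongrightarrow> c" using 0 by blast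
    then show "c = L2_inner g v" using lim[OF 0] by (rule LIMSEQ_unique)
  qed (use lim in blast)
qed

text \<open>A classical equation off the origin is tested only against functions supported off the
  origin. The behaviour at 0 is controlled solely by \<open>u \<in> form_domain a\<close>, which
  excludes solutions with a stronger singularity.\<close>

lemma friedrichsI:
  fixes u g :: wave
  assumes a: "a = \<sigma>\<^sup>2 - \<sigma>" and ud: "u \<in> form_domain a" and g: "g \<in> Lp 2"
    and u: "continuous_on (-{0}) u" "\<And>i. continuous_on (-{0}) (u1 i)" "\<And>i. continuous_on (-{0}) (u2 i)"
    and d: "\<And>i x. x \<noteq> 0 \<Longrightarrow> has_pd i u (u1 i x) x" "\<And>i x. x \<noteq> 0 \<Longrightarrow> has_pd i (u1 i) (u2 i x) x"
    and eq: "\<And>x. x \<noteq> 0 \<Longrightarrow> g x = complex_of_real (a / (norm x)\<^sup>2) * u x - (\<Sum>i\<in>UNIV. u2 i x)"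
  shows "(u, g) \<in> friedrichs a"
proof -
  have "L2_inner u (lop a \<psi>) = L2_inner g \<psi>" if \<psi>: "\<psi> \<in> C2a" for \<psi>
  proof -
    have 1: "annular (\<lambda>x. u x * cnj (complex_of_real (a / (norm x)\<^sup>2) * \<psi> x))"
      using \<psi> by (intro annular_mult_left[OF u(1)] annular_cnj annular_mult_left[OF continuous_on_inv_norm_sq] C2aD)
    have 2: "annular (\<lambda>x. u x * cnj (lap \<psi> x))"
      unfolding lap_def using \<psi> by (intro annular_mult_left[OF u(1)] annular_cnj annular_sum C2aD)
    have 3: "annular (\<lambda>x. (\<Sum>i\<in>UNIV. u2 i x) * cnj (\<psi> x))"
      using \<psi> u(3) by (intro annular_mult_left annular_cnj C2aD continuous_on_sum)
    \<comment> \<open>Nothing is known about \<open>g 0\<close> and \<open>u2 i 0\<close>; the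
      factor \<open>\<psi> 0\<close> makes the identity of integrands hold there too.\<close>
    have "\<psi> 0 = 0" using C2aD(6)[OF \<psi>] by (force simp: annular_def)
    then have e: "u x * cnj (complex_of_real (a / (norm x)\<^sup>2) * \<psi> x) - (\<Sum>i\<in>UNIV. u2 i x) * cnj (\<psi> x) = g x * cnj (\<psi> x)" for x
      by (cases "x = 0") (simp_all add: eq algebra_simps)
    have "L2_inner u (lop a \<psi>) = (LINT x|lborel. u x * cnj (complex_of_real (a / (norm x)\<^sup>2) * \<psi> x) - u x * cnj (lap \<psi> x))"
      unfolding L2_inner_def lop_def complex_cnj_diff right_diff_distrib ..
    also have "\<dots> = (LINT x|lborel. u x * cnj (complex_of_real (a / (norm x)\<^sup>2) * \<psi> x) - (\<Sum>i\<in>UNIV. u2 i x) * cnj (\<psi> x))"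
      using 1 2 3 integral_cnj_lap_eq[OF u d \<psi>]
      by (subst (1 2) Bochner_Integration.integral_diff) (auto dest: annular_integrable)
    also have "\<dots> = L2_inner g \<psi>" unfolding e L2_inner_def ..
    finally show ?thesis .
  qed
  then show ?thesis
    unfolding friedrichs_def using closed_form_eqI[OF a ud _ g] ud g by blast
qed

section \<open>Integrability of singular functions\<close>

text \<open>The singular factor alone is integrable on [0,1]. Beyond 1 it is at most 1, and the
  Gaussian is at most 1 / (c t^2) because c t^2 \<le> exp (c t^2). The one-sided majorant
  \<open>h\<close> and its reflection cover the line.\<close>

lemma nn_integral_powr_exp_real:
  fixes \<gamma> c :: real
  assumes \<gamma>: "0 \<le> \<gamma>" "\<gamma> < 1" and c: "c > 0"
  shows "(\<integral>\<^sup>+t. \<bar>t\<bar> powr (- \<gamma>) * exp (- c * t\<^sup>2) \<partial>lborel) < \<infinity>"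
proof -
  define h where "h t = (if t \<in> {0..1} then t powr (- \<gamma>) else 0) + 1 / c * (if t \<in> {1..} then t powr (- 2) else 0)" for t :: real
  have [measurable]: "h \<in> borel_measurable borel" unfolding h_def by measurable
  have h0: "h t \<ge> 0" for t using c by (auto simp: h_def)
  have "(h has_integral (1 powr (- \<gamma> + 1) / (- \<gamma> + 1) + 1 / c * (- (1 powr (- 2 + 1)) / (- 2 + 1)))) UNIV"
    unfolding h_def
    by (intro has_integral_add has_integral_mult_right)
      (use has_integral_powr_from_0[of "-\<gamma>" 1] has_integral_powr_to_inf[of "-2" 1] \<gamma> in \<open>auto simp only: has_integral_restrict_UNIV\<close>)
  from nn_integral_has_integral_lborel[OF _ h0 this]
  have h: "(\<integral>\<^sup>+t. h t \<partial>lborel) < \<infinity>" by simp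
  have h': "(\<integral>\<^sup>+t. h (- t) \<partial>lborel) < \<infinity>"
    using h by (subst (asm) nn_integral_real_affine[where c = "-1" and t = 0]) auto
  have le: "\<bar>t\<bar> powr (- \<gamma>) * exp (- c * t\<^sup>2) \<le> h t + h (- t)" for t
  proof -
    have *: "t powr (- \<gamma>) * exp (- c * t\<^sup>2) \<le> h t" if t: "t \<ge> 0" for t
    proof (cases "t \<le> 1")
      case True
      have "t powr (- \<gamma>) * exp (- c * t\<^sup>2) \<le> t powr (- \<gamma>) * 1"
        using c by (intro mult_left_mono) auto
      also have "\<dots> \<le> h t" using True t c by (auto simp: h_def)
      finally show ?thesis .
    next
      case False
      have "c * t\<^sup>2 \<le> exp (c * t\<^sup>2)" using exp_ge_add_one_self[of "c * t\<^sup>2"] by linarith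
      then have "exp (- c * t\<^sup>2) \<le> 1 / c * t powr (- 2)"
        using c False by (simp add: exp_minus powr_minus powr_numeral field_simps)
      moreover have "t powr (- \<gamma>) \<le> 1"
        using powr_mono[of "-\<gamma>" 0 t] False \<gamma> by auto
      ultimately have "t powr (- \<gamma>) * exp (- c * t\<^sup>2) \<le> 1 * (1 / c * t powr (- 2))"
        by (intro mult_mono) auto
      then show ?thesis using False by (simp add: h_def)
    qed
    show ?thesis
      using *[of t] *[of "-t"] h0[of t] h0[of "-t"] by (cases "t \<ge> 0") auto
  qed
  have "(\<integral>\<^sup>+t. \<bar>t\<bar> powr (- \<gamma>) * exp (- c * t\<^sup>2) \<partial>lborel) \<le> (\<integral>\<^sup>+t. ennreal (h t) + ennreal (h (- t)) \<partial>lborel)"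
    by (intro nn_integral_mono) (use le h0 in \<open>simp flip: ennreal_plus\<close>)
  also have "\<dots> = (\<integral>\<^sup>+t. h t \<partial>lborel) + (\<integral>\<^sup>+t. h (- t) \<partial>lborel)"
    by (rule nn_integral_add) auto
  also have "\<dots> < \<infinity>" using h h' by (simp add: ennreal_add_less_top)
  finally show ?thesis .
qed

text \<open>Coordinate hyperplanes must be discarded before comparing negative powers:
  \<open>0 powr (- \<gamma>)\<close> is 0, so the product of the coordinate functions would fail to
  dominate on them.\<close>

lemma AE_inner_Basis_neq_0:
  "AE x in lborel. \<forall>b\<in>Basis. (x::'a::euclidean_space) \<bullet> b \<noteq> 0"
proof -
  have "AE x in lborel. (x::'a) \<bullet> b \<noteq> 0" if b: "b \<in> Basis" for b
  proof -
    have "negligible {x::'a. b \<bullet> x = 0}" using b by (intro negligible_hyperplane) auto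
    then have "{x::'a. b \<bullet> x = 0} \<in> null_sets lborel"
      using closed_hyperplane[of b 0] by (auto simp: null_sets_completion_iff negligible_iff_null_sets)
    then show ?thesis
      by (rule AE_I') (auto simp: inner_commute)
  qed
  then show ?thesis by (subst AE_ball_countable) (auto intro: countable_finite)
qed

text \<open>The integrand is dominated by the product over the coordinates of the one-dimensional
  functions with exponent \<open>\<beta> / n\<close>.\<close>

lemma integrable_norm_powr_exp:
  fixes \<beta> c :: real
  assumes \<beta>: "0 \<le> \<beta>" "\<beta> < DIM('a)" and c: "c > 0"
  shows "integrable lborel (\<lambda>x::'a::euclidean_space. norm x powr (- \<beta>) * exp (- c * (norm x)\<^sup>2))"
proof -
  define \<gamma> where "\<gamma> = \<beta> / DIM('a)"
  have \<gamma>: "0 \<le> \<gamma>" "\<gamma> < 1" using \<beta> by (auto simp: \<gamma>_def field_simps)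
  have "(\<integral>\<^sup>+x. norm (x::'a) powr (- \<beta>) * exp (- c * (norm x)\<^sup>2) \<partial>lborel) \<le>
     (\<integral>\<^sup>+x. (\<Prod>b\<in>Basis. ennreal (\<bar>(x::'a) \<bullet> b\<bar> powr (- \<gamma>) * exp (- c * (x \<bullet> b)\<^sup>2))) \<partial>lborel)"
  proof (rule nn_integral_mono_AE, use AE_inner_Basis_neq_0 in eventually_elim)
    fix x :: 'a assume x: "\<forall>b\<in>Basis. x \<bullet> b \<noteq> 0"
    then have x0: "norm x > 0" using nonempty_Basis by force
    \<comment> \<open>Each coordinate is at most the norm, hence has the larger negative power; the
      n equal factors on the left recombine to exponent \<beta> = n \<gamma>.\<close>
    have "(\<Prod>b\<in>(Basis::'a set). norm x powr (- \<gamma>)) \<le> (\<Prod>b\<in>Basis. \<bar>x \<bullet> b\<bar> powr (- \<gamma>))"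
      by (rule prod_mono) (use x \<gamma> Basis_le_norm[of _ x] in \<open>auto intro!: powr_mono2'\<close>)
    also have "(\<Prod>b\<in>(Basis::'a set). norm x powr (- \<gamma>)) = norm x powr (- \<beta>)"
      using x0 by (simp add: powr_power \<gamma>_def)
    finally have 1: "norm x powr (- \<beta>) \<le> (\<Prod>b\<in>Basis. \<bar>x \<bullet> b\<bar> powr (- \<gamma>))" .
    have "(norm x)\<^sup>2 = (\<Sum>b\<in>Basis. (x \<bullet> b)\<^sup>2)"
      unfolding power2_norm_eq_inner by (subst euclidean_inner) (simp add: power2_eq_square)
    then have 2: "exp (- c * (norm x)\<^sup>2) = (\<Prod>b\<in>Basis. exp (- c * (x \<bullet> b)\<^sup>2))"
      by (simp add: exp_sum[symmetric] sum_negf[symmetric] sum_distrib_left)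
    show "ennreal (norm x powr (- \<beta>) * exp (- c * (norm x)\<^sup>2)) \<le> (\<Prod>b\<in>Basis. ennreal (\<bar>x \<bullet> b\<bar> powr (- \<gamma>) * exp (- c * (x \<bullet> b)\<^sup>2)))"
      unfolding 2 using 1 by (subst prod_ennreal) (auto simp: prod.distrib intro!: ennreal_leI mult_right_mono prod_nonneg)
  qed
  also have "\<dots> = (\<Prod>b\<in>(Basis::'a set). (\<integral>\<^sup>+t. ennreal (\<bar>t\<bar> powr (- \<gamma>) * exp (- c * t\<^sup>2)) \<partial>lborel))"
    by (rule nn_integral_lborel_prod) auto
  also have "\<dots> < \<infinity>"
    using nn_integral_powr_exp_real[OF \<gamma> c] by (simp add: power_less_top_ennreal)
  finally show ?thesis
    by (intro integrableI_nonneg) auto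
qed

text \<open>On a ball of radius r \<le> 1 the function is at least c r^(-\<sigma>). For finite q,
  the integral of |f|^q over the ball is then at least c^q r^(3 - \<sigma> q) times the unit volume,
  hence at least a positive constant, whereas integrability would force it to 0 as r shrinks. This
  treats the endpoint \<sigma> q = 3 together with the rest. For p = \<infinity> a small ball
  exceeds any bound.\<close>

lemma singular_notin_Lp:
  fixes f :: wave
  assumes \<sigma>: "\<sigma> > 0" and c: "c > 0" and p: "p \<ge> ennreal (3 / \<sigma>)"
    and f: "AE x in lborel. x \<in> ball 0 1 \<longrightarrow> c * norm x powr (- \<sigma>) \<le> norm (f x)"
  shows "f \<notin> Lp p"
proof
  assume fL: "f \<in> Lp p"
  then have [measurable]: "f \<in> borel_measurable borel" by (auto simp: Lp_def)
  have pos: "measure lborel (ball (0::real^3) r) = unit_ball_vol 3 * r ^ 3" if "r \<ge> 0" for r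
    using content_ball[OF that, of "0::real^3"] by simp
  \<comment> \<open>At the origin \<open>0 powr (- \<sigma>)\<close> is 0, so the comparison of
    powers needs x \<noteq> 0.\<close>
  have x0: "AE x::real^3 in lborel. x \<noteq> 0" by (rule AE_lborel_singleton)
  have lower: "AE x in lborel. x \<in> ball 0 r \<longrightarrow> c * r powr (- \<sigma>) \<le> norm (f x)" if r: "0 < r" "r \<le> 1" for r
    using f x0
  proof eventually_elim
    case (elim x)
    show ?case
    proof
      assume x: "x \<in> ball 0 r"
      then have "c * r powr (- \<sigma>) \<le> c * norm x powr (- \<sigma>)"
        using elim(2) \<sigma> c by (intro mult_left_mono powr_mono2') auto
      also have "\<dots> \<le> norm (f x)" using elim(1) x r by auto
      finally show "c * r powr (- \<sigma>) \<le> norm (f x)" .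
    qed
  qed
  show False
  proof (cases p)
    case top
    then obtain C where C: "AE x in lborel. norm (f x) \<le> C" using fL by (auto simp: Lp_def)
    \<comment> \<open>Solves c r^(-\<sigma>) = |C| + 1 for r, capped at 1 to stay in the ball where
      the lower bound is assumed.\<close>
    define r where "r = min 1 (((\<bar>C\<bar> + 1) / c) powr (- (1 / \<sigma>)))"
    have r: "0 < r" "r \<le> 1" using c by (auto simp: r_def)
    have "(((\<bar>C\<bar> + 1) / c) powr (- (1 / \<sigma>))) powr (- \<sigma>) \<le> r powr (- \<sigma>)"
      using \<sigma> r by (intro powr_mono2') (auto simp: r_def)
    then have "(\<bar>C\<bar> + 1) / c \<le> r powr (- \<sigma>)" using \<sigma> c by (simp add: powr_powr)
    then have big: "C < c * r powr (- \<sigma>)" using c by (simp add: field_simps) 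
    have "AE x in lborel. x \<notin> ball (0::real^3) r"
      using C lower[OF r] by eventually_elim (use big in force)
    from emeasure_eq_0_AE[OF this] have "emeasure lborel (ball (0::real^3) r) = 0"
      by (simp only: space_lborel space_borel UNIV_I simp_thms Collect_mem_eq)
    then have "measure lborel (ball (0::real^3) r) = 0" by (simp add: measure_def)
    then show False using pos[of r] r by auto
  next
    case (real q)
    then have q: "q \<ge> 3 / \<sigma>" "q > 0" using p \<sigma> by (auto, smt (verit) divide_pos_pos)
    then have q3: "\<sigma> * q \<ge> 3" using \<sigma> by (simp add: field_simps)
    have int: "integrable lborel (\<lambda>x. norm (f x) powr q)" using fL real q by (simp add: Lp_iff)
    define r where "r n = inverse (real (Suc n))" for n
    have r: "0 < r n" "r n \<le> 1" for n by (auto simp: r_def field_simps)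
    have r0: "r \<longlonglongrightarrow> 0" unfolding r_def by (rule LIMSEQ_inverse_real_of_nat)
    have "(\<lambda>n. LINT x|lborel. norm (f x) powr q * indicator (ball 0 (r n)) x) \<longlonglongrightarrow> (LINT x::real^3|lborel. 0)"
    proof (rule integral_dominated_convergence[where w = "\<lambda>x. norm (f x) powr q"])
      show "AE x in lborel. (\<lambda>n. norm (f x) powr q * indicator (ball 0 (r n)) x) \<longlonglongrightarrow> 0"
        using x0
      proof eventually_elim
        case (elim x)
        have "eventually (\<lambda>n. r n < norm x) sequentially"
          using order_tendstoD(2)[OF r0] elim by auto
        then have "eventually (\<lambda>n. norm (f x) powr q * indicator (ball 0 (r n)) x = 0) sequentially"
          by eventually_elim auto
        then show ?case by (rule tendsto_eventually)
      qed
    qed (use int in \<open>auto simp: indicator_def\<close>)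
    moreover have "c powr q * unit_ball_vol 3 \<le> (LINT x|lborel. norm (f x) powr q * indicator (ball 0 (r n)) x)" for n
    proof -
      have "c powr q * unit_ball_vol 3 \<le> c powr q * (r n powr (3 - \<sigma> * q)) * unit_ball_vol 3"
        using r[of n] q3 powr_mono'[of "3 - \<sigma> * q" 0 "r n"]
          mult_left_mono[of 1 "r n powr (3 - \<sigma> * q)" "c powr q"] by (intro mult_right_mono) auto
      also have "\<dots> = (c * r n powr (- \<sigma>)) powr q * measure lborel (ball (0::real^3) (r n))"
      proof -
        have "(c * r n powr (- \<sigma>)) powr q = c powr q * r n powr (- (\<sigma> * q))"
          using r[of n] c by (simp add: powr_mult powr_powr)
        moreover have "r n powr (3 - \<sigma> * q) = r n ^ 3 * r n powr (- (\<sigma> * q))"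
          using r[of n] powr_add[of "r n" 3 "- (\<sigma> * q)"] by (simp add: powr_numeral)
        ultimately show ?thesis using r[of n] by (simp add: pos)
      qed
      also have "\<dots> = (LINT x|lborel. (c * r n powr (- \<sigma>)) powr q * indicator (ball (0::real^3) (r n)) x)"
        by simp
      also have "\<dots> \<le> (LINT x|lborel. norm (f x) powr q * indicator (ball 0 (r n)) x)"
      proof (rule integral_mono_AE)
        show "integrable lborel (\<lambda>x. (c * r n powr (- \<sigma>)) powr q * indicator (ball (0::real^3) (r n)) x)"
          by (intro integrable_mult_right integrable_real_indicator) (use emeasure_lborel_ball_finite[of "0::real^3" "r n"] in auto)
        show "integrable lborel (\<lambda>x. norm (f x) powr q * indicator (ball 0 (r n)) x)"
          by (rule Bochner_Integration.integrable_bound[OF int]) (auto simp: indicator_def)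
        show "AE x in lborel. (c * r n powr (- \<sigma>)) powr q * indicator (ball 0 (r n)) x \<le> norm (f x) powr q * indicator (ball 0 (r n)) x"
          using lower[OF r(1,2)[of n]]
          by eventually_elim (use c q(2) in \<open>auto simp: indicator_def intro!: powr_mono2\<close>)
      qed
      finally show ?thesis .
    qed
    ultimately have "c powr q * unit_ball_vol 3 \<le> (LINT x::real^3|lborel. 0)"
      by (intro LIMSEQ_le_const[of _ "LINT x::real^3|lborel. 0"]) auto
    moreover have "c powr q * unit_ball_vol 3 > 0"
      using c by (intro mult_pos_pos unit_ball_vol_pos) auto
    ultimately show False by simp
  qed
qed

section \<open>Smooth cutoffs\<close>

text \<open>Profiles in s = |x|^2 are smooth only for s > 0, so regularity is relative to a set; the
  derivatives are two-sided, which suits open sets. The existential spares naming the successive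
  derivatives.\<close>

primrec C_k_on :: "nat \<Rightarrow> real set \<Rightarrow> (real \<Rightarrow> complex) \<Rightarrow> bool" where
  "C_k_on 0 S h \<longleftrightarrow> continuous_on S h"
| "C_k_on (Suc k) S h \<longleftrightarrow>
    (\<exists>h'. (\<forall>s\<in>S. (h has_vector_derivative h' s) (at s)) \<and> C_k_on k S h')"

lemma C_k_on_SucI:
  "(\<And>s. s \<in> S \<Longrightarrow> (h has_vector_derivative h' s) (at s)) \<Longrightarrow> C_k_on k S h' \<Longrightarrow> C_k_on (Suc k) S h"
  by auto

lemma C_k_on_Suc_imp: "C_k_on (Suc k) S h \<Longrightarrow> C_k_on k S h"
proof (induction k arbitrary: h)
  case 0
  then show ?case
    by (auto intro!: continuous_at_imp_continuous_on dest: has_vector_derivative_continuous)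
next
  case (Suc k)
  then show ?case by (metis C_k_on.simps(2))
qed

lemma C_k_on_add: "C_k_on k S f \<Longrightarrow> C_k_on k S g \<Longrightarrow> C_k_on k S (\<lambda>s. f s + g s)"
proof (induction k arbitrary: f g)
  case 0
  then show ?case by (auto intro: continuous_intros)
next
  case (Suc k)
  then obtain f' g' where "\<forall>s\<in>S. (f has_vector_derivative f' s) (at s)" "C_k_on k S f'"
    "\<forall>s\<in>S. (g has_vector_derivative g' s) (at s)" "C_k_on k S g'" by auto
  then show ?case
    using Suc.IH by (auto intro!: exI[of _ "\<lambda>s. f' s + g' s"] has_vector_derivative_add)
qed

lemma C_k_on_mult: "C_k_on k S f \<Longrightarrow> C_k_on k S g \<Longrightarrow> C_k_on k S (\<lambda>s. f s * g s)"
proof (induction k arbitrary: f g)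
  case 0
  then show ?case by (auto intro: continuous_intros)
next
  case (Suc k)
  then obtain f' g' where d: "\<forall>s\<in>S. (f has_vector_derivative f' s) (at s)" "C_k_on k S f'"
    "\<forall>s\<in>S. (g has_vector_derivative g' s) (at s)" "C_k_on k S g'" by auto
  have "C_k_on k S (\<lambda>s. f s * g' s + f' s * g s)"
    by (intro C_k_on_add Suc.IH d C_k_on_Suc_imp[OF Suc.prems(1)] C_k_on_Suc_imp[OF Suc.prems(2)])
  then show ?case
    using d by (auto intro!: exI[of _ "\<lambda>s. f s * g' s + f' s * g s"] has_vector_derivative_mult)
qed

lemma C_k_on_const: "C_k_on k S (\<lambda>s. c)"
proof (induction k arbitrary: c)
  case (Suc k)
  show ?case using Suc[of 0] by (auto intro!: exI[of _ "\<lambda>s. 0"])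
qed auto

lemma C_k_on_cong:
  assumes "open S" "\<And>s. s \<in> S \<Longrightarrow> f s = g s" "C_k_on k S f"
  shows "C_k_on k S g"
proof (cases k)
  case 0
  then show ?thesis using assms continuous_on_cong[of S S f g] by simp
next
  case (Suc l)
  then obtain f' where f': "\<And>s. s \<in> S \<Longrightarrow> (f has_vector_derivative f' s) (at s)" "C_k_on l S f'"
    using assms by auto
  have "(g has_vector_derivative f' s) (at s)" if "s \<in> S" for s
    by (rule has_vector_derivative_transform_within_open[OF f'(1)[OF that] assms(1) that assms(2)])
  then show ?thesis unfolding Suc using f'(2) by (rule C_k_on_SucI)
qed

lemma C_k_on_subset:
  assumes "C_k_on k S f" "T \<subseteq> S"
  shows "C_k_on k T f"
  using assms(1)
proof (induction k arbitrary: f)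
  case 0
  then show ?case using assms(2) continuous_on_subset by auto
next
  case (Suc k)
  then show ?case using assms(2) by (auto simp: subset_iff)
qed

lemma C_k_on_Un:
  assumes "open S" "open T" "C_k_on k S f" "C_k_on k T f"
  shows "C_k_on k (S \<union> T) f"
  using assms(3,4)
proof (induction k arbitrary: f)
  case 0
  then show ?case using assms(1,2) by (simp add: continuous_on_open_Un)
next
  case (Suc k)
  obtain f' where f': "\<forall>s\<in>S. (f has_vector_derivative f' s) (at s)" "C_k_on k S f'"
    using Suc.prems(1) by auto
  obtain f'' where f'': "\<forall>s\<in>T. (f has_vector_derivative f'' s) (at s)" "C_k_on k T f''"
    using Suc.prems(2) by auto
  \<comment> \<open>The two chosen derivatives may differ off their own sets but agree on the
    overlap by uniqueness, so \<open>g\<close> inherits regularity from either side.\<close>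
  define g where "g s = (if s \<in> S then f' s else f'' s)" for s
  have d: "(f has_vector_derivative g s) (at s)" if "s \<in> S \<union> T" for s
    using that f'(1) f''(1) by (auto simp: g_def)
  have "C_k_on k S g" by (rule C_k_on_cong[OF assms(1) _ f'(2)]) (simp add: g_def)
  moreover have "C_k_on k T g"
    by (rule C_k_on_cong[OF assms(2) _ f''(2)]) (use d f''(1) vector_derivative_unique_at in blast)
  ultimately show ?case using d Suc.IH by auto
qed

lemma C_k_on_affine:
  assumes "C_k_on k UNIV h"
  shows "C_k_on k UNIV (\<lambda>s. h (\<alpha> * s + \<beta>))"
  using assms
proof (induction k arbitrary: h)
  case 0
  then show ?case by (auto intro!: continuous_on_compose2[of UNIV h] continuous_intros)
next
  case (Suc k)
  then obtain h' where h': "\<And>s. (h has_vector_derivative h' s) (at s)" "C_k_on k UNIV h'" by auto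
  have "((\<lambda>s. h (\<alpha> * s + \<beta>)) has_vector_derivative complex_of_real \<alpha> * h' (\<alpha> * s + \<beta>)) (at s)" for s
  proof -
    have "((\<lambda>s. \<alpha> * s + \<beta>) has_vector_derivative \<alpha>) (at s)"
      by (auto intro!: derivative_eq_intros simp flip: has_real_derivative_iff_has_vector_derivative)
    from vector_diff_chain_at[OF this h'(1)] show ?thesis by (simp add: o_def scaleR_conv_of_real)
  qed
  moreover have "C_k_on k UNIV (\<lambda>s. complex_of_real \<alpha> * h' (\<alpha> * s + \<beta>))"
    by (intro C_k_on_mult C_k_on_const Suc.IH h')
  ultimately show ?case by (intro C_k_on_SucI) auto
qed

lemma C_k_on_powr: "C_k_on k {0<..} (\<lambda>s. complex_of_real (s powr q))"
proof (induction k arbitrary: q)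
  case 0
  show ?case by (auto intro!: continuous_intros)
next
  case (Suc k)
  have "((\<lambda>s. complex_of_real (s powr q)) has_vector_derivative complex_of_real q * complex_of_real (s powr (q - 1))) (at s)"
    if "s > 0" for s
    using has_vector_derivative_of_real[of "\<lambda>s. s powr q" "q * s powr (q - 1)" "at s"] that
    by (auto intro!: derivative_eq_intros simp: powr_diff simp flip: has_real_derivative_iff_has_vector_derivative)
  moreover have "C_k_on k {0<..} (\<lambda>s. complex_of_real q * complex_of_real (s powr (q - 1)))"
    by (intro C_k_on_mult C_k_on_const Suc)
  ultimately show ?case by (intro C_k_on_SucI) auto
qed

lemma C_k_on_exp: "C_k_on k S (\<lambda>s. exp (z * complex_of_real s))"
proof (induction k)
  case 0
  show ?case by (auto intro!: continuous_intros)
next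
  case (Suc k)
  have "((\<lambda>s. exp (z * complex_of_real s)) has_vector_derivative z * exp (z * complex_of_real s)) (at s)" for s
  proof -
    have "((\<lambda>w. exp (z * w)) has_field_derivative z * exp (z * complex_of_real s)) (at (complex_of_real s))"
      by (auto intro!: derivative_eq_intros)
    from has_vector_derivative_real_field[OF this] show ?thesis by simp
  qed
  moreover have "C_k_on k S (\<lambda>s. z * exp (z * complex_of_real s))"
    by (intro C_k_on_mult C_k_on_const Suc)
  ultimately show ?case by (intro C_k_on_SucI) auto
qed

text \<open>The i-th partial derivative of h(|x|^2) is 2 x_i h'(|x|^2), again a coordinate times a
  radial function, which is what lets the induction on \<open>k\<close> close.\<close>

lemma C_k_radial:
  assumes "C_k_on k UNIV h"
  shows "C_k k (\<lambda>x. h ((norm x)\<^sup>2))"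
  using assms
proof (induction k arbitrary: h)
  case 0
  then show ?case by (auto intro!: continuous_on_compose2[of UNIV h] continuous_intros)
next
  case (Suc k)
  then obtain h' where h': "\<And>s. (h has_vector_derivative h' s) (at s)" "C_k_on k UNIV h'" by auto
  have d: "((\<lambda>x. h ((norm x)\<^sup>2)) has_derivative (\<lambda>v. (2 * (x \<bullet> v)) *\<^sub>R h' ((norm x)\<^sup>2))) (at x)" for x :: "real^3"
  proof -
    have "((\<lambda>x. (norm x)\<^sup>2) has_derivative (\<lambda>v. 2 * (x \<bullet> v))) (at x)"
      unfolding power2_norm_eq_inner by (auto intro!: derivative_eq_intros simp: inner_commute)
    then show ?thesis
      by (rule has_derivative_compose) (use h'(1) in \<open>simp add: has_vector_derivative_def\<close>)
  qed
  have "partial_deriv i (\<lambda>x. h ((norm x)\<^sup>2)) = (\<lambda>x. complex_of_real (x $ i) * (2 * h' ((norm x)\<^sup>2)))" for i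
    using partial_derivI[OF d] by (auto simp: inner_axis scaleR_conv_of_real)
  moreover have "C_k k (\<lambda>x. complex_of_real (x $ i) * (2 * h' ((norm x)\<^sup>2)))" for i
    by (intro C_k_mult C_k_coord C_k_const Suc.IH h')
  ultimately show ?case using d by (auto simp: differentiable_def)
qed

section \<open>The flat function exp (-1/r) and the derived cutoffs\<close>

lemma tendsto_poly_div_exp_0: "((\<lambda>x. poly p x / exp x) \<longlongrightarrow> (0::real)) at_top"
proof -
  have "((\<lambda>x. \<Sum>i\<le>degree p. coeff p i * (x ^ i / exp x)) \<longlongrightarrow> (\<Sum>i\<le>degree p. coeff p i * 0)) at_top"
    by (intro tendsto_intros tendsto_power_div_exp_0)
  then show ?thesis by (simp add: poly_altdef sum_divide_distrib)
qed

text \<open>exp (-1/r), extended by 0, times a polynomial in 1/r: the smallest natural family that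
  contains the standard smooth step and is closed under differentiation.\<close>

definition flat :: "real poly \<Rightarrow> real \<Rightarrow> real" where
  "flat p r = (if r > 0 then poly p (1 / r) * exp (- (1 / r)) else 0)"

text \<open>The square of the variable is the factor 1 / r^2 from the inner derivative of 1/r;
  differentiating the exponential and the polynomial gives \<open>p\<close> and
  \<open>- pderiv p\<close>.\<close>

definition flat_deriv :: "real poly \<Rightarrow> real poly" where
  "flat_deriv p = [:0, 0, 1:] * (p - pderiv p)"

lemma flat_has_derivative:
  "(flat p has_real_derivative flat (flat_deriv p) r) (at r)"
proof -
  consider "r > 0" | "r < 0" | "r = 0" by linarith
  then show ?thesis
  proof cases
    case 1
    have "((\<lambda>r. poly p (1 / r) * exp (- (1 / r))) has_real_derivative flat (flat_deriv p) r) (at r)"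
      using 1 by (auto intro!: derivative_eq_intros DERIV_chain2[OF poly_DERIV] simp: flat_def flat_deriv_def field_simps power2_eq_square)
    then show ?thesis
      by (rule has_field_derivative_transform_within_open[where S = "{0<..}"]) (use 1 in \<open>auto simp: flat_def\<close>)
  next
    case 2
    have "((\<lambda>r. 0) has_real_derivative flat (flat_deriv p) r) (at r)"
      using 2 by (simp add: flat_def)
    then show ?thesis
      by (rule has_field_derivative_transform_within_open[where S = "{..<0}"]) (use 2 in \<open>auto simp: flat_def\<close>)
  next
    case 3
    \<comment> \<open>\<open>pCons 0 p\<close> absorbs the factor 1/h of the difference
      quotient.\<close>
    have "((\<lambda>h. poly (pCons 0 p) (inverse h) / exp (inverse h)) \<longlongrightarrow> 0) (at_right 0)"
      by (rule filterlim_compose[OF tendsto_poly_div_exp_0 filterlim_inverse_at_top_right])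
    then have "((\<lambda>h. flat p h / h) \<longlongrightarrow> 0) (at_right 0)"
      by (rule Lim_transform_eventually)
        (auto simp: eventually_at_right_field flat_def exp_minus field_simps intro!: exI[of _ 1])
    moreover have "((\<lambda>h. flat p h / h) \<longlongrightarrow> 0) (at_left 0)"
      by (rule tendsto_eventually) (auto simp: eventually_at_left_field flat_def intro!: exI[of _ "-1"])
    ultimately have "((\<lambda>h. flat p h / h) \<longlongrightarrow> 0) (at 0)"
      by (simp add: filterlim_split_at)
    then show ?thesis using 3 by (simp add: DERIV_def flat_def)
  qed
qed

lemma C_k_on_flat: "C_k_on k UNIV (\<lambda>r. complex_of_real (flat p r))"
proof -
  have d: "((\<lambda>r. complex_of_real (flat p r)) has_vector_derivative complex_of_real (flat (flat_deriv p) r)) (at r)" for p r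
    using flat_has_derivative by (intro has_vector_derivative_of_real) (simp flip: has_real_derivative_iff_has_vector_derivative)
  show ?thesis
  proof (induction k arbitrary: p)
    case 0
    show ?case
      by (auto intro!: continuous_at_imp_continuous_on DERIV_isCont[OF flat_has_derivative])
  next
    case (Suc k)
    show ?case by (rule C_k_on_SucI[OF d Suc])
  qed
qed

text \<open>Evaluated at s = |x|^2. No plateau at 1 is built in: values in [0,1], pointwise
  convergence to 1 and a derivative bound independent of \<open>N\<close> suffice, and the product
  formula keeps the derivative explicit.\<close>

definition cutoff :: "real \<Rightarrow> real \<Rightarrow> real" where
  "cutoff N s = flat 1 (N * s - 1) * flat 1 (N - s)"

definition cutoff' :: "real \<Rightarrow> real \<Rightarrow> real" where
  "cutoff' N s = N * flat [:0, 0, 1:] (N * s - 1) * flat 1 (N - s) - flat 1 (N * s - 1) * flat [:0, 0, 1:] (N - s)"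

lemma cutoff_has_derivative: "(cutoff N has_real_derivative cutoff' N s) (at s)"
proof -
  have d: "(flat 1 has_real_derivative flat [:0, 0, 1:] r) (at r)" for r
    using flat_has_derivative[of 1 r] by (simp add: flat_deriv_def pderiv_1)
  show ?thesis
    unfolding cutoff_def cutoff'_def
    by (auto intro!: derivative_eq_intros DERIV_chain2[OF d])
qed

lemma flat_1_bounds: "0 \<le> flat 1 r" "flat 1 r \<le> 1"
  by (auto simp: flat_def)

lemma exp_quadratic_bound:
  assumes "(y::real) \<ge> 0" shows "(y + y\<^sup>2) * exp (- y) \<le> 2" "y\<^sup>2 * exp (- y) \<le> 2"
proof -
  have "1 + y + y\<^sup>2 / 2 \<le> exp y" using exp_lower_Taylor_quadratic[OF assms] .
  then have "y + y\<^sup>2 \<le> 2 * exp y" "y\<^sup>2 \<le> 2 * exp y" using assms by auto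
  then show "(y + y\<^sup>2) * exp (- y) \<le> 2" "y\<^sup>2 * exp (- y) \<le> 2" by (auto simp: exp_minus field_simps)
qed

text \<open>The polynomial [:0, 0, 1:] belongs to the derivative of \<open>flat 1\<close>. The last
  bound is tailored to r = N s - 1: then r + 1 = N s, so the factor N from the chain rule costs only
  2 / s.\<close>

lemma flat_2_bounds: "0 \<le> flat [:0, 0, 1:] r" "flat [:0, 0, 1:] r \<le> 2" "(r + 1) * flat [:0, 0, 1:] r \<le> 2"
proof -
  show "0 \<le> flat [:0, 0, 1:] r" by (auto simp: flat_def)
  show "flat [:0, 0, 1:] r \<le> 2"
    using exp_quadratic_bound(2)[of "1 / r"] by (auto simp: flat_def power2_eq_square)
  show "(r + 1) * flat [:0, 0, 1:] r \<le> 2"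
  proof (cases "r > 0")
    case True
    then have "(r + 1) * flat [:0, 0, 1:] r = (1 / r + (1 / r)\<^sup>2) * exp (- (1 / r))"
      by (simp add: flat_def field_simps power2_eq_square)
    then show ?thesis using exp_quadratic_bound(1)[of "1 / r"] True by simp
  qed (simp add: flat_def)
qed

lemma cutoff_bounds: "0 \<le> cutoff N s" "cutoff N s \<le> 1"
  using flat_1_bounds by (auto simp: cutoff_def mult_le_one)

text \<open>Uniform in \<open>N\<close>: the cutoff at the origin contributes 2 / s and the one at
  infinity 2. After the factor 2 |x| from s = |x|^2 these are multiples of 1 / |x| and |x|.\<close>

lemma cutoff'_bound:
  assumes "s > 0" "N > 0"
  shows "\<bar>cutoff' N s\<bar> \<le> 2 / s + 2"
proof -
  have "N * flat [:0, 0, 1:] (N * s - 1) \<le> 2 / s"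
    using flat_2_bounds(3)[of "N * s - 1"] assms by (simp add: field_simps)
  then have 1: "N * flat [:0, 0, 1:] (N * s - 1) * flat 1 (N - s) \<le> 2 / s * 1"
    using flat_1_bounds assms by (intro mult_mono) auto
  have 2: "flat 1 (N * s - 1) * flat [:0, 0, 1:] (N - s) \<le> 1 * 2"
    using flat_1_bounds flat_2_bounds by (intro mult_mono) auto
  have "0 \<le> N * flat [:0, 0, 1:] (N * s - 1) * flat 1 (N - s)" "0 \<le> flat 1 (N * s - 1) * flat [:0, 0, 1:] (N - s)"
    using flat_1_bounds flat_2_bounds assms by auto
  then show ?thesis unfolding cutoff'_def using 1 2 assms by (auto simp: abs_le_iff add_increasing)
qed

lemma cutoff_support: "cutoff N s \<noteq> 0 \<Longrightarrow> N * s > 1 \<and> s < N"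
  by (auto simp: cutoff_def flat_def split: if_splits)

lemma cutoff_tendsto:
  assumes "s > 0"
  shows "(\<lambda>n. cutoff (real (Suc n)) s) \<longlonglongrightarrow> 1" "(\<lambda>n. cutoff' (real (Suc n)) s) \<longlonglongrightarrow> 0"
proof -
  have N: "filterlim (\<lambda>n. real (Suc n)) at_top sequentially"
    by (rule filterlim_compose[OF filterlim_real_sequentially filterlim_Suc])
  have i: "((\<lambda>N::real. inverse N) \<longlongrightarrow> 0) at_top" by (rule tendsto_inverse_0_at_top[OF filterlim_ident])
  have e: "eventually (\<lambda>N. N > 0 \<and> N > 1 / s \<and> N > s) at_top"
    by (intro eventually_conj eventually_gt_at_top)
  \<comment> \<open>Written with \<open>inverse N\<close>, the exponent 1 / (N s - 1) has a limit by
    continuity alone.\<close>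
  have "((\<lambda>N. exp (- (inverse N / (s - inverse N)))) \<longlongrightarrow> exp (- (0 / (s - 0)))) at_top"
    using assms by (intro tendsto_intros i) auto
  moreover have "eventually (\<lambda>N. exp (- (inverse N / (s - inverse N))) = flat 1 (N * s - 1)) at_top"
    using e by eventually_elim (use assms in \<open>auto simp: flat_def field_simps\<close>)
  ultimately have l1: "((\<lambda>N. flat 1 (N * s - 1)) \<longlongrightarrow> 1) at_top"
    using Lim_transform_eventually by fastforce
  have "((\<lambda>N. exp (- (inverse N / (1 - inverse N * s)))) \<longlongrightarrow> exp (- (0 / (1 - 0 * s)))) at_top"
    by (intro tendsto_intros i) auto
  moreover have "eventually (\<lambda>N. exp (- (inverse N / (1 - inverse N * s))) = flat 1 (N - s)) at_top"
    using e by eventually_elim (use assms in \<open>auto simp: flat_def field_simps\<close>)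
  ultimately have l2: "((\<lambda>N. flat 1 (N - s)) \<longlongrightarrow> 1) at_top"
    using Lim_transform_eventually by fastforce
  have le: "flat [:0, 0, 1:] r \<le> 1 / r\<^sup>2" for r
    by (auto simp: flat_def power2_eq_square mult_le_one divide_right_mono)
  have l3: "((\<lambda>N. N * flat [:0, 0, 1:] (N * s - 1)) \<longlongrightarrow> 0) at_top"
  proof (rule tendsto_sandwich[OF _ _ tendsto_const])
    show "eventually (\<lambda>N. 0 \<le> N * flat [:0, 0, 1:] (N * s - 1)) at_top"
      using e by eventually_elim (simp add: flat_2_bounds)
    show "eventually (\<lambda>N. N * flat [:0, 0, 1:] (N * s - 1) \<le> inverse N / (s - inverse N)\<^sup>2) at_top"
      using e
    proof eventually_elim
      case (elim N)
      have "N * flat [:0, 0, 1:] (N * s - 1) \<le> N * (1 / (N * s - 1)\<^sup>2)"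
        using elim le by (intro mult_left_mono) auto
      also have "\<dots> = N * (1 / (N * (s - inverse N))\<^sup>2)" using elim by (simp add: right_diff_distrib)
      also have "\<dots> = inverse N / (s - inverse N)\<^sup>2"
        using elim by (simp add: power_mult_distrib power2_eq_square divide_inverse)
      finally show ?case .
    qed
    have "((\<lambda>N. inverse N / (s - inverse N)\<^sup>2) \<longlongrightarrow> 0 / (s - 0)\<^sup>2) at_top"
      using assms by (intro tendsto_intros i) auto
    then show "((\<lambda>N. inverse N / (s - inverse N)\<^sup>2) \<longlongrightarrow> 0) at_top" by simp
  qed
  have l4: "((\<lambda>N. flat [:0, 0, 1:] (N - s)) \<longlongrightarrow> 0) at_top"
  proof (rule tendsto_sandwich[OF _ _ tendsto_const])
    show "eventually (\<lambda>N. flat [:0, 0, 1:] (N - s) \<le> 1 / (N - s)\<^sup>2) at_top" by (simp add: le)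
    have "filterlim (\<lambda>N. N - s) at_top at_top"
      using filterlim_tendsto_add_at_top[OF tendsto_const[of "-s"] filterlim_ident] by simp
    then have "((\<lambda>N. (inverse (N - s))\<^sup>2) \<longlongrightarrow> 0\<^sup>2) at_top"
      by (intro tendsto_power tendsto_inverse_0_at_top)
    then show "((\<lambda>N. 1 / (N - s)\<^sup>2) \<longlongrightarrow> 0) at_top" by (simp add: power_inverse divide_inverse)
  qed (simp add: flat_2_bounds)
  have "((\<lambda>N. cutoff N s) \<longlongrightarrow> 1 * 1) at_top" "((\<lambda>N. cutoff' N s) \<longlongrightarrow> 0 * 1 - 1 * 0) at_top"
    unfolding cutoff_def cutoff'_def by (intro tendsto_intros l1 l2 l3 l4)+
  then show "(\<lambda>n. cutoff (real (Suc n)) s) \<longlonglongrightarrow> 1" "(\<lambda>n. cutoff' (real (Suc n)) s) \<longlonglongrightarrow> 0"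
    using filterlim_compose[OF _ N] by force+
qed

lemma flat_measurable [measurable]: "flat p \<in> borel_measurable borel"
  by (auto intro!: borel_measurable_continuous_onI continuous_at_imp_continuous_on DERIV_isCont[OF flat_has_derivative])

lemma cutoff_measurable [measurable]:
  "cutoff N \<in> borel_measurable borel" "cutoff' N \<in> borel_measurable borel"
  unfolding cutoff_def[abs_def] cutoff'_def[abs_def] by measurable

section \<open>Singular Gaussians\<close>

definition profile :: "real \<Rightarrow> complex \<Rightarrow> complex \<Rightarrow> real \<Rightarrow> complex" where
  "profile \<sigma> C z s = C * (complex_of_real (s powr (- (\<sigma> / 2))) * exp (- z * complex_of_real s))"

text \<open>Logarithmic derivative of \<open>profile\<close> in s: every derivative of the profile
  becomes an explicit factor times the profile itself.\<close>

definition log_deriv :: "real \<Rightarrow> complex \<Rightarrow> real \<Rightarrow> complex" where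
  "log_deriv \<sigma> z s = complex_of_real (- (\<sigma> / 2) / s) - z"

definition sgauss :: "real \<Rightarrow> complex \<Rightarrow> complex \<Rightarrow> wave" where
  "sgauss \<sigma> C z x = profile \<sigma> C z ((norm x)\<^sup>2)"

lemma profile_has_derivative:
  assumes "s > 0"
  shows "(profile \<sigma> C z has_vector_derivative log_deriv \<sigma> z s * profile \<sigma> C z s) (at s)"
proof -
  have "((\<lambda>s. complex_of_real (s powr (- (\<sigma> / 2)))) has_vector_derivative complex_of_real (- (\<sigma> / 2) / s * s powr (- (\<sigma> / 2)))) (at s)"
    by (rule has_vector_derivative_of_real)
      (use assms in \<open>auto intro!: derivative_eq_intros simp: powr_diff simp flip: has_real_derivative_iff_has_vector_derivative\<close>)
  moreover have "((\<lambda>s. exp (- z * complex_of_real s)) has_vector_derivative - z * exp (- z * complex_of_real s)) (at s)"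
  proof -
    have "((\<lambda>w. exp (- z * w)) has_field_derivative - z * exp (- z * complex_of_real s)) (at (complex_of_real s))"
      by (auto intro!: derivative_eq_intros)
    from has_vector_derivative_real_field[OF this] show ?thesis by simp
  qed
  ultimately have "((\<lambda>s. C * (complex_of_real (s powr (- (\<sigma> / 2))) * exp (- z * complex_of_real s))) has_vector_derivative
     C * (complex_of_real (s powr (- (\<sigma> / 2))) * (- z * exp (- z * complex_of_real s)) +
       complex_of_real (- (\<sigma> / 2) / s * s powr (- (\<sigma> / 2))) * exp (- z * complex_of_real s))) (at s)"
    by (intro has_vector_derivative_mult_right has_vector_derivative_mult)
  then show ?thesis
    unfolding profile_def[abs_def] log_deriv_def by (simp add: algebra_simps minus_diff_commute)
qed

lemma log_deriv_has_derivative: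
  assumes "s > 0"
  shows "(log_deriv \<sigma> z has_vector_derivative complex_of_real (\<sigma> / 2 / s\<^sup>2)) (at s)"
proof -
  have "((\<lambda>s. complex_of_real (- (\<sigma> / 2) / s) - z) has_vector_derivative complex_of_real (\<sigma> / 2 / s\<^sup>2) - 0) (at s)"
    by (intro has_vector_derivative_diff has_vector_derivative_of_real has_vector_derivative_const)
      (use assms in \<open>auto intro!: derivative_eq_intros simp: power2_eq_square simp flip: has_real_derivative_iff_has_vector_derivative\<close>)
  then show ?thesis unfolding log_deriv_def[abs_def] by simp
qed

lemma profile_has_second_derivative:
  assumes "s > 0"
  shows "((\<lambda>s. log_deriv \<sigma> z s * profile \<sigma> C z s) has_vector_derivative
    ((log_deriv \<sigma> z s)\<^sup>2 + complex_of_real (\<sigma> / 2 / s\<^sup>2)) * profile \<sigma> C z s) (at s)"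
  using has_vector_derivative_mult[OF log_deriv_has_derivative[OF assms, of \<sigma> z] profile_has_derivative[OF assms, of \<sigma> C z]]
  by (simp add: algebra_simps power2_eq_square)

lemma norm_profile:
  "norm (profile \<sigma> C z s) = norm C * (s powr (- (\<sigma> / 2)) * exp (- Re z * s))"
  by (simp add: profile_def norm_mult)

lemma norm_sgauss:
  "norm (sgauss \<sigma> C z x) = norm C * (norm x powr (- \<sigma>) * exp (- Re z * (norm x)\<^sup>2))"
proof -
  have "((norm x)\<^sup>2) powr (- (\<sigma> / 2)) = norm x powr (- \<sigma>)"
    using powr_powr[of "norm x" 2 "- (\<sigma> / 2)"] by (simp add: powr_numeral)
  then show ?thesis by (simp add: sgauss_def norm_profile)
qed

lemma profile_measurable [measurable]: "profile \<sigma> C z \<in> borel_measurable borel"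
proof -
  have [measurable]: "(\<lambda>s. exp (- z * complex_of_real s)) \<in> borel_measurable borel"
    by (intro borel_measurable_continuous_onI continuous_intros)
  show ?thesis unfolding profile_def[abs_def] by measurable
qed

lemma sgauss_measurable [measurable]: "sgauss \<sigma> C z \<in> borel_measurable borel"
  unfolding sgauss_def[abs_def] by measurable

lemma sgauss_powr_integrable:
  assumes "0 \<le> \<sigma>" "q > 0" "\<sigma> * q < 3" "Re z > 0"
  shows "integrable lborel (\<lambda>x. norm (sgauss \<sigma> C z x) powr q)"
proof -
  have "norm (sgauss \<sigma> C z x) powr q = norm C powr q * (norm x powr (- (\<sigma> * q)) * exp (- (q * Re z) * (norm x)\<^sup>2))" for x
    by (simp add: norm_sgauss powr_mult powr_powr exp_powr_real mult_ac)
  moreover have "integrable lborel (\<lambda>x::real^3. norm x powr (- (\<sigma> * q)) * exp (- (q * Re z) * (norm x)\<^sup>2))"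
    by (rule integrable_norm_powr_exp) (use assms in auto)
  ultimately show ?thesis by simp
qed

lemma sgauss_Lp:
  assumes "0 \<le> \<sigma>" "q > 0" "\<sigma> * q < 3" "Re z > 0"
  shows "sgauss \<sigma> C z \<in> Lp (ennreal q)"
  using sgauss_powr_integrable[OF assms] assms(2) by (simp add: Lp_iff)

text \<open>Half of the Gaussian decay pays for the polynomial. In the coefficient, 2 covers the
  constant term of 2 + 2 s^2, and 4 / c^2 times the quadratic Taylor term (c s)^2 / 2 is exactly 2
  s^2.\<close>

lemma quadratic_exp_bound:
  assumes "c > 0" "(s::real) \<ge> 0"
  shows "(1 + s)\<^sup>2 * exp (- (2 * c) * s) \<le> (2 + 4 / c\<^sup>2) * exp (- c * s)"
proof -
  have "1 + c * s + (c * s)\<^sup>2 / 2 \<le> exp (c * s)"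
    using assms by (intro exp_lower_Taylor_quadratic) auto
  then have "(2 + 4 / c\<^sup>2) * (1 + c * s + (c * s)\<^sup>2 / 2) \<le> (2 + 4 / c\<^sup>2) * exp (c * s)"
    using assms by (intro mult_left_mono) auto
  moreover have "(1 + s)\<^sup>2 \<le> 2 + 2 * s\<^sup>2"
    using sum_squares_bound[of 1 s] by (simp add: power2_sum)
  moreover have "2 + 2 * s\<^sup>2 \<le> (2 + 4 / c\<^sup>2) * (1 + c * s + (c * s)\<^sup>2 / 2)"
  proof -
    have "(2 + 4 / c\<^sup>2) * (1 + c * s + (c * s)\<^sup>2 / 2) =
      2 + 2 * s\<^sup>2 + (2 * c * s + (c * s)\<^sup>2 + 4 / c\<^sup>2 + 4 / c * s)"
      using assms by (simp add: field_simps power2_eq_square)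
    moreover have "0 \<le> 2 * c * s + (c * s)\<^sup>2 + 4 / c\<^sup>2 + 4 / c * s" using assms by auto
    ultimately show ?thesis by linarith
  qed
  ultimately have "(1 + s)\<^sup>2 \<le> (2 + 4 / c\<^sup>2) * exp (c * s)" by linarith
  then have "(1 + s)\<^sup>2 * exp (- (2 * c) * s) \<le> (2 + 4 / c\<^sup>2) * exp (c * s) * exp (- (2 * c) * s)"
    by (intro mult_right_mono) auto
  then show ?thesis by (simp add: mult.assoc exp_add[symmetric])
qed

lemma Lp_norm_tendsto_0:
  fixes F :: "nat \<Rightarrow> wave"
  assumes q: "q > 0" and [measurable]: "\<And>n. F n \<in> borel_measurable borel"
    and lim: "AE x in lborel. (\<lambda>n. F n x) \<longlonglongrightarrow> 0"
    and w: "integrable lborel (\<lambda>x. w x powr q)" and bound: "\<And>n. AE x in lborel. norm (F n x) \<le> w x"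
  shows "(\<lambda>n. Lp_norm q (F n)) \<longlonglongrightarrow> 0"
proof -
  have "(\<lambda>n. LINT x|lborel. norm (F n x) powr q) \<longlonglongrightarrow> (LINT x::real^3|lborel. 0)"
  proof (rule integral_dominated_convergence[OF _ _ w])
    show "AE x in lborel. (\<lambda>n. norm (F n x) powr q) \<longlonglongrightarrow> 0"
      using lim by eventually_elim (intro tendsto_zero_powrI[OF tendsto_norm_zero tendsto_const] q always_eventually, auto)
    show "AE x in lborel. norm (norm (F n x) powr q) \<le> w x powr q" for n
      using bound[of n] by eventually_elim (use q in \<open>auto intro: powr_mono2\<close>)
  qed auto
  then show ?thesis
    unfolding Lp_norm_def
    by (intro tendsto_zero_powrI[OF _ tendsto_const]) (use q in auto)
qed

section \<open>Approximation of singular Gaussians by test functions\<close>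

definition cut_gauss :: "real \<Rightarrow> real \<Rightarrow> complex \<Rightarrow> complex \<Rightarrow> wave" where
  "cut_gauss N \<sigma> C z x = complex_of_real (cutoff N ((norm x)\<^sup>2)) * sgauss \<sigma> C z x"

lemma cut_gauss_test_function:
  assumes N: "N > 0"
  shows "cut_gauss N \<sigma> C z \<in> test_functions (-{0})"
proof -
  define h where "h s = complex_of_real (cutoff N s) * profile \<sigma> C z s" for s
  have eq: "cut_gauss N \<sigma> C z = (\<lambda>x. h ((norm x)\<^sup>2))"
    by (auto simp: cut_gauss_def sgauss_def h_def)
  \<comment> \<open>The profile is smooth for s > 0 and the cutoff vanishes for s < 1 / N; these two
    open sets cover the line, so the product is smooth on all of it.\<close>
  have "C_k_on k ({0<..} \<union> {..<1 / N}) h" for k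
  proof (rule C_k_on_Un)
    have cut: "C_k_on k UNIV (\<lambda>s. complex_of_real (cutoff N s))" for k
      using C_k_on_mult[OF C_k_on_affine[OF C_k_on_flat, of k 1 N "-1"] C_k_on_affine[OF C_k_on_flat, of k 1 "-1" N]]
      by (simp add: cutoff_def)
    have "C_k_on k {0<..} (\<lambda>s. complex_of_real (cutoff N s))"
      using cut[of k] by (rule C_k_on_subset) auto
    then show "C_k_on k {0<..} h"
      unfolding h_def profile_def by (intro C_k_on_mult C_k_on_const C_k_on_powr C_k_on_exp)
    show "C_k_on k {..<1 / N} h"
    proof (rule C_k_on_cong[OF _ _ C_k_on_const[of _ _ 0]])
      show "0 = h s" if "s \<in> {..<1 / N}" for s
        using that cutoff_support[of N s] N by (auto simp: h_def field_simps)
    qed auto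
  qed auto
  moreover have "{0<..} \<union> {..<1 / N} = UNIV" using N by (auto simp: not_less intro: le_less_trans[of _ 0])
  ultimately have "\<forall>k. C_k k (cut_gauss N \<sigma> C z)"
    unfolding eq using C_k_radial by metis
  moreover have "annular (cut_gauss N \<sigma> C z)"
  proof -
    have "continuous_on UNIV (cut_gauss N \<sigma> C z)" using calculation C_k_continuous by blast
    moreover have "sqrt (1 / N) \<le> norm x \<and> norm x \<le> sqrt N" if "cut_gauss N \<sigma> C z x \<noteq> 0" for x
    proof -
      have "N * (norm x)\<^sup>2 > 1" "(norm x)\<^sup>2 < N"
        using cutoff_support[of N "(norm x)\<^sup>2"] that by (auto simp: cut_gauss_def)
      then show ?thesis
        using N by (auto intro!: real_le_lsqrt real_le_rsqrt simp: field_simps)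
    qed
    moreover have "sqrt (1 / N) > 0" using N by simp
    ultimately show ?thesis unfolding annular_def by blast
  qed
  ultimately show ?thesis by (simp add: test_functions_punctured_iff)
qed

text \<open>Away from the origin this is the squared distance between the gradients of \<open>cut_gauss N\<close>
  and \<open>sgauss\<close>, which are both radial.\<close>

definition grad_error :: "real \<Rightarrow> real \<Rightarrow> complex \<Rightarrow> complex \<Rightarrow> real^3 \<Rightarrow> real" where
  "grad_error N \<sigma> C z x = 4 * (norm x)\<^sup>2 * (norm (complex_of_real (cutoff' N ((norm x)\<^sup>2)) +
     complex_of_real (cutoff N ((norm x)\<^sup>2) - 1) * log_deriv \<sigma> z ((norm x)\<^sup>2)) * norm (sgauss \<sigma> C z x))\<^sup>2"

lemma partial_deriv_cut_gauss:
  assumes x: "x \<noteq> 0" and N: "N > 0"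
  shows "partial_deriv i (cut_gauss N \<sigma> C z) x = complex_of_real (2 * x $ i) *
    ((complex_of_real (cutoff' N ((norm x)\<^sup>2)) + complex_of_real (cutoff N ((norm x)\<^sup>2)) * log_deriv \<sigma> z ((norm x)\<^sup>2)) * sgauss \<sigma> C z x)"
proof (rule has_pd_unique[OF has_pd_partial_deriv])
  show "cut_gauss N \<sigma> C z differentiable (at x)"
    using test_functions_C2a[OF cut_gauss_test_function[OF N]] by (rule C2aD)
  define s where "s = (norm x)\<^sup>2"
  have s: "s > 0" using x by (simp add: s_def)
  have "((\<lambda>s. complex_of_real (cutoff N s)) has_vector_derivative complex_of_real (cutoff' N s)) (at s)"
    using cutoff_has_derivative by (intro has_vector_derivative_of_real) (simp flip: has_real_derivative_iff_has_vector_derivative)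
  from has_vector_derivative_mult[OF this profile_has_derivative[OF s, of \<sigma> C z]]
  have "((\<lambda>s. complex_of_real (cutoff N s) * profile \<sigma> C z s) has_vector_derivative
     (complex_of_real (cutoff' N s) + complex_of_real (cutoff N s) * log_deriv \<sigma> z s) * profile \<sigma> C z s) (at ((norm x)\<^sup>2))"
    by (simp add: s_def algebra_simps)
  from has_pd_radial[OF this, of i]
  show "has_pd i (cut_gauss N \<sigma> C z) (complex_of_real (2 * x $ i) *
    ((complex_of_real (cutoff' N ((norm x)\<^sup>2)) + complex_of_real (cutoff N ((norm x)\<^sup>2)) * log_deriv \<sigma> z ((norm x)\<^sup>2)) * sgauss \<sigma> C z x)) x"
    unfolding cut_gauss_def sgauss_def s_def by simp
qed

text \<open>Each gradient is compared with that of the limit; subtracting its term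
  \<open>log_deriv\<close> from both sides cancels in the difference and leaves two errors, each
  depending on one cutoff parameter.\<close>

lemma grad_sq_cut_gauss_diff:
  assumes x: "x \<noteq> 0" and N: "N > 0" "M > 0"
  shows "grad_sq (\<lambda>y. cut_gauss M \<sigma> C z y - cut_gauss N \<sigma> C z y) x \<le>
    2 * grad_error M \<sigma> C z x + 2 * grad_error N \<sigma> C z x"
proof -
  define A where "A N = (complex_of_real (cutoff' N ((norm x)\<^sup>2)) +
     complex_of_real (cutoff N ((norm x)\<^sup>2) - 1) * log_deriv \<sigma> z ((norm x)\<^sup>2)) * sgauss \<sigma> C z x" for N
  have C1: "C_k (Suc 0) (cut_gauss M \<sigma> C z)" "C_k (Suc 0) (cut_gauss N \<sigma> C z)"
    using test_functions_C2a[OF cut_gauss_test_function] N C2aD(2) by blast+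
  have "partial_deriv i (\<lambda>y. cut_gauss M \<sigma> C z y - cut_gauss N \<sigma> C z y) x = complex_of_real (2 * x $ i) * (A M - A N)" for i
    using partial_deriv_lin[OF C1, of i "-1" x]
    by (simp add: partial_deriv_cut_gauss[OF x] N A_def algebra_simps)
  then have "grad_sq (\<lambda>y. cut_gauss M \<sigma> C z y - cut_gauss N \<sigma> C z y) x =
      (\<Sum>i\<in>UNIV. 4 * (x $ i)\<^sup>2 * (norm (A M - A N))\<^sup>2)"
    unfolding grad_sq_def by (intro sum.cong refl) (simp add: norm_mult power_mult_distrib)
  also have "\<dots> = 4 * (norm x)\<^sup>2 * (norm (A M - A N))\<^sup>2"
    by (simp add: norm_sq_sum sum_distrib_left sum_distrib_right)
  also have "(norm (A M - A N))\<^sup>2 \<le> 2 * (norm (A M))\<^sup>2 + 2 * (norm (A N))\<^sup>2"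
  proof -
    have "(norm (A M - A N))\<^sup>2 \<le> (norm (A M) + norm (A N))\<^sup>2"
      by (simp add: power_mono norm_triangle_ineq4)
    also have "\<dots> \<le> 2 * (norm (A M))\<^sup>2 + 2 * (norm (A N))\<^sup>2"
      using sum_squares_bound[of "norm (A M)" "norm (A N)"] by (simp add: power2_sum)
    finally show ?thesis .
  qed
  then have "4 * (norm x)\<^sup>2 * (norm (A M - A N))\<^sup>2 \<le> 4 * (norm x)\<^sup>2 * (2 * (norm (A M))\<^sup>2 + 2 * (norm (A N))\<^sup>2)"
    by (intro mult_left_mono) auto
  also have "\<dots> = 2 * grad_error M \<sigma> C z x + 2 * grad_error N \<sigma> C z x"
    by (simp add: grad_error_def A_def norm_mult distrib_left)
  finally show ?thesis .
qed

text \<open>A majorant independent of \<open>N\<close>. Near the origin it behaves like |x|^2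
  |x|^(-4) |x|^(-2 \<sigma>), integrable in dimension 3 because 2 + 2 \<sigma> < 3. The constant 3 +
  |z| collects 2 / s + 2 + \<sigma> / (2 s) + |z|.\<close>

lemma grad_error_bound:
  assumes x: "x \<noteq> 0" and N: "N > 0" and \<sigma>: "0 < \<sigma>" "\<sigma> < 1 / 2" and z: "Re z > 0"
  shows "grad_error N \<sigma> C z x \<le> 4 * (3 + norm z)\<^sup>2 * (norm C)\<^sup>2 * (2 + 4 / (Re z)\<^sup>2) *
     (norm x powr (- (2 + 2 * \<sigma>)) * exp (- Re z * (norm x)\<^sup>2))"
proof -
  define s where "s = (norm x)\<^sup>2"
  define k where "k = 3 + norm z"
  have s: "s > 0" using x by (simp add: s_def)
  have "norm (complex_of_real (cutoff' N s) + complex_of_real (cutoff N s - 1) * log_deriv \<sigma> z s) \<le>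
    (2 / s + 2) + 1 * (\<sigma> / 2 / s + norm z)"
  proof (rule order_trans[OF norm_triangle_ineq], rule add_mono)
    show "norm (complex_of_real (cutoff' N s)) \<le> 2 / s + 2"
      using cutoff'_bound[OF s N] by simp
    have "norm (log_deriv \<sigma> z s) \<le> \<sigma> / 2 / s + norm z"
      unfolding log_deriv_def using norm_triangle_ineq4[of "complex_of_real (- (\<sigma> / 2) / s)" z] s \<sigma> by (simp add: norm_divide)
    moreover have "norm (complex_of_real (cutoff N s - 1)) \<le> 1"
      unfolding norm_of_real using cutoff_bounds[of N s] by auto
    ultimately show "norm (complex_of_real (cutoff N s - 1) * log_deriv \<sigma> z s) \<le> 1 * (\<sigma> / 2 / s + norm z)"
      unfolding norm_mult by (intro mult_mono) auto
  qed
  also have "\<dots> \<le> k * (1 / s + 1)"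
  proof -
    have "\<sigma> / 2 / s \<le> 1 / s" "0 \<le> norm z / s" using s \<sigma> divide_right_mono[of "\<sigma> / 2" 1 s] by auto
    then show ?thesis by (simp add: k_def distrib_left distrib_right add_divide_distrib)
  qed
  finally have "norm (complex_of_real (cutoff' N s) + complex_of_real (cutoff N s - 1) * log_deriv \<sigma> z s) * norm (sgauss \<sigma> C z x)
     \<le> k * (1 / s + 1) * norm (sgauss \<sigma> C z x)" by (rule mult_right_mono) simp
  then have "grad_error N \<sigma> C z x \<le> 4 * s * (k * (1 / s + 1) * norm (sgauss \<sigma> C z x))\<^sup>2"
    unfolding grad_error_def s_def[symmetric] using s by (intro mult_left_mono power_mono) auto
  also have "\<dots> = 4 * k\<^sup>2 * (norm C)\<^sup>2 * (norm x powr (- (2 + 2 * \<sigma>)) * ((1 + s)\<^sup>2 * exp (- (2 * Re z) * s)))"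
  proof -
    have 1: "s * (1 / s + 1)\<^sup>2 = (1 + s)\<^sup>2 * norm x powr (-2)"
      using x by (simp add: s_def powr_minus powr_numeral field_simps power2_eq_square)
    have "(norm x powr (- \<sigma>))\<^sup>2 = norm x powr (- (2 * \<sigma>))"
      by (simp add: power2_eq_square flip: powr_add)
    moreover have "norm x powr (- (2 + 2 * \<sigma>)) = norm x powr (-2) * norm x powr (- (2 * \<sigma>))"
      by (simp flip: powr_add)
    moreover have "(exp (- Re z * s))\<^sup>2 = exp (- (2 * Re z) * s)"
      by (simp add: power2_eq_square flip: exp_add)
    ultimately show ?thesis using 1
      by (simp add: norm_sgauss s_def[symmetric] power_mult_distrib mult_ac)
  qed
  also have "\<dots> \<le> 4 * k\<^sup>2 * (norm C)\<^sup>2 * (norm x powr (- (2 + 2 * \<sigma>)) * ((2 + 4 / (Re z)\<^sup>2) * exp (- Re z * s)))"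
    using quadratic_exp_bound[OF z, of s] s by (intro mult_left_mono) auto
  finally show ?thesis by (simp add: k_def s_def mult_ac)
qed

lemma grad_error_tendsto:
  assumes \<sigma>: "0 < \<sigma>" "\<sigma> < 1 / 2" and z: "Re z > 0"
  shows "(\<lambda>n. LINT x|lborel. grad_error (real (Suc n)) \<sigma> C z x) \<longlonglongrightarrow> 0"
    and "integrable lborel (grad_error (real (Suc n)) \<sigma> C z)"
proof -
  define w where "w x = 4 * (3 + norm z)\<^sup>2 * (norm C)\<^sup>2 * (2 + 4 / (Re z)\<^sup>2) *
     (norm x powr (- (2 + 2 * \<sigma>)) * exp (- Re z * (norm x)\<^sup>2))" for x :: "real^3"
  have w: "integrable lborel w"
    unfolding w_def by (intro integrable_mult_right integrable_norm_powr_exp) (use \<sigma> z in auto)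
  have m: "grad_error N \<sigma> C z \<in> borel_measurable borel" for N
    unfolding grad_error_def[abs_def] log_deriv_def[abs_def] by measurable
  have x0: "AE x::real^3 in lborel. x \<noteq> 0" by (rule AE_lborel_singleton)
  have b: "AE x in lborel. norm (grad_error (real (Suc n)) \<sigma> C z x) \<le> w x" for n
    using x0
  proof eventually_elim
    case (elim x)
    have "0 \<le> grad_error (real (Suc n)) \<sigma> C z x" by (simp add: grad_error_def)
    then show ?case using grad_error_bound[OF elim _ \<sigma> z, of "real (Suc n)" C] by (simp add: w_def)
  qed
  have l: "AE x in lborel. (\<lambda>n. grad_error (real (Suc n)) \<sigma> C z x) \<longlonglongrightarrow> 0"
    using x0
  proof eventually_elim
    case (elim x)
    define s where "s = (norm x)\<^sup>2"
    have s: "s > 0" using elim by (simp add: s_def)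
    have "(\<lambda>n. 4 * s * (norm (complex_of_real (cutoff' (real (Suc n)) s) + complex_of_real (cutoff (real (Suc n)) s - 1) * log_deriv \<sigma> z s)
       * norm (sgauss \<sigma> C z x))\<^sup>2) \<longlonglongrightarrow> 4 * s * (norm (complex_of_real 0 + complex_of_real (1 - 1) * log_deriv \<sigma> z s)
       * norm (sgauss \<sigma> C z x))\<^sup>2"
      by (intro tendsto_intros cutoff_tendsto[OF s])
    then show ?case unfolding grad_error_def s_def[symmetric] by simp
  qed
  show "integrable lborel (grad_error (real (Suc n)) \<sigma> C z)"
    by (rule Bochner_Integration.integrable_bound[OF w]) (use b[of n] m in \<open>auto elim!: eventually_mono\<close>)
  have "(\<lambda>n. LINT x|lborel. grad_error (real (Suc n)) \<sigma> C z x) \<longlonglongrightarrow> (LINT x::real^3|lborel. 0)"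
    by (rule integral_dominated_convergence[OF _ _ w l b]) (use m in auto)
  then show "(\<lambda>n. LINT x|lborel. grad_error (real (Suc n)) \<sigma> C z x) \<longlonglongrightarrow> 0" by simp
qed

lemma cut_gauss_grad_cauchy:
  assumes \<sigma>: "0 < \<sigma>" "\<sigma> < 1 / 2" and z: "Re z > 0" and e: "e > 0"
  shows "\<exists>N. \<forall>m\<ge>N. \<forall>n\<ge>N. (LINT x|lborel. grad_sq (\<lambda>y. cut_gauss (real (Suc m)) \<sigma> C z y - cut_gauss (real (Suc n)) \<sigma> C z y) x) < e"
proof -
  obtain N where N: "\<And>n. n \<ge> N \<Longrightarrow> (LINT x|lborel. grad_error (real (Suc n)) \<sigma> C z x) < e / 4"
    using order_tendstoD(2)[OF grad_error_tendsto(1)[OF \<sigma> z], of "e / 4" C] e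
    unfolding eventually_sequentially by auto
  show ?thesis
  proof (intro exI[of _ N] allI impI)
    fix m n assume mn: "m \<ge> N" "n \<ge> N"
    have "(LINT x|lborel. grad_sq (\<lambda>y. cut_gauss (real (Suc m)) \<sigma> C z y - cut_gauss (real (Suc n)) \<sigma> C z y) x) \<le>
      (LINT x|lborel. 2 * grad_error (real (Suc m)) \<sigma> C z x + 2 * grad_error (real (Suc n)) \<sigma> C z x)"
    \<comment> \<open>This rule needs only the majorant to be integrable and nonnegative.\<close>
    proof (rule integral_mono_AE')
      show "AE x in lborel. grad_sq (\<lambda>y. cut_gauss (real (Suc m)) \<sigma> C z y - cut_gauss (real (Suc n)) \<sigma> C z y) x
         \<le> 2 * grad_error (real (Suc m)) \<sigma> C z x + 2 * grad_error (real (Suc n)) \<sigma> C z x"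
        using AE_lborel_singleton[of 0] by eventually_elim (rule grad_sq_cut_gauss_diff, auto)
      show "integrable lborel (\<lambda>x. 2 * grad_error (real (Suc m)) \<sigma> C z x + 2 * grad_error (real (Suc n)) \<sigma> C z x)"
        using grad_error_tendsto(2)[OF \<sigma> z] by (intro Bochner_Integration.integrable_add integrable_mult_right)
      show "AE x in lborel. 0 \<le> 2 * grad_error (real (Suc m)) \<sigma> C z x + 2 * grad_error (real (Suc n)) \<sigma> C z x"
        by (simp add: grad_error_def)
    qed
    also have "\<dots> = 2 * (LINT x|lborel. grad_error (real (Suc m)) \<sigma> C z x) + 2 * (LINT x|lborel. grad_error (real (Suc n)) \<sigma> C z x)"
      using grad_error_tendsto(2)[OF \<sigma> z] by simp
    also have "\<dots> < e" using N[OF mn(1)] N[OF mn(2)] by linarith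
    finally show "(LINT x|lborel. grad_sq (\<lambda>y. cut_gauss (real (Suc m)) \<sigma> C z y - cut_gauss (real (Suc n)) \<sigma> C z y) x) < e" .
  qed
qed

lemma cut_gauss_Lp_tendsto:
  assumes "0 < \<sigma>" "q > 0" "\<sigma> * q < 3" "Re z > 0"
  shows "(\<lambda>n. Lp_norm q (\<lambda>x. cut_gauss (real (Suc n)) \<sigma> C z x - sgauss \<sigma> C z x)) \<longlonglongrightarrow> 0"
proof (rule Lp_norm_tendsto_0[where w = "\<lambda>x. norm (sgauss \<sigma> C z x)"])
  show "integrable lborel (\<lambda>x. norm (sgauss \<sigma> C z x) powr q)"
    by (rule sgauss_powr_integrable) (use assms in auto)
  show "(\<lambda>x. cut_gauss (real (Suc n)) \<sigma> C z x - sgauss \<sigma> C z x) \<in> borel_measurable borel" for n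
    unfolding cut_gauss_def by measurable
  have eq: "cut_gauss N \<sigma> C z x - sgauss \<sigma> C z x = complex_of_real (cutoff N ((norm x)\<^sup>2) - 1) * sgauss \<sigma> C z x" for N x
    by (simp add: cut_gauss_def algebra_simps)
  show "AE x in lborel. norm (cut_gauss (real (Suc n)) \<sigma> C z x - sgauss \<sigma> C z x) \<le> norm (sgauss \<sigma> C z x)" for n
  proof (rule AE_I2)
    fix x :: "real^3"
    have "\<bar>cutoff (real (Suc n)) ((norm x)\<^sup>2) - 1\<bar> \<le> 1"
      using cutoff_bounds[of "real (Suc n)" "(norm x)\<^sup>2"] by linarith
    then show "norm (cut_gauss (real (Suc n)) \<sigma> C z x - sgauss \<sigma> C z x) \<le> norm (sgauss \<sigma> C z x)"
      unfolding eq norm_mult norm_of_real by (intro mult_left_le_one_le) auto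
  qed
  show "AE x in lborel. (\<lambda>n. cut_gauss (real (Suc n)) \<sigma> C z x - sgauss \<sigma> C z x) \<longlonglongrightarrow> 0"
    using AE_lborel_singleton[of 0]
  proof eventually_elim
    case (elim x)
    have "(\<lambda>n. complex_of_real (cutoff (real (Suc n)) ((norm x)\<^sup>2) - 1) * sgauss \<sigma> C z x) \<longlonglongrightarrow> complex_of_real (1 - 1) * sgauss \<sigma> C z x"
      by (intro tendsto_intros cutoff_tendsto) (use elim in simp)
    then show ?case unfolding eq by simp
  qed
qed (use assms in auto)

text \<open>The exponent 6 of the Sobolev embedding requires 6 \<sigma> < 3, the same condition
  \<sigma> < 1/2 that makes the gradient square integrable.\<close>

lemma sgauss_homogeneous_H1:
  assumes \<sigma>: "0 < \<sigma>" "\<sigma> < 1 / 2" and z: "Re z > 0"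
  shows "sgauss \<sigma> C z \<in> homogeneous_H1"
proof -
  have "sgauss \<sigma> C z \<in> Lp 6"
    using sgauss_Lp[of \<sigma> 6 z C] \<sigma> z by simp
  moreover have "cut_gauss (real (Suc n)) \<sigma> C z \<in> test_functions UNIV" for n
    using cut_gauss_test_function[of "real (Suc n)" \<sigma> C z] by (auto simp: test_functions_def)
  moreover have "(\<lambda>n. Lp_norm 6 (\<lambda>x. cut_gauss (real (Suc n)) \<sigma> C z x - sgauss \<sigma> C z x)) \<longlonglongrightarrow> 0"
    by (rule cut_gauss_Lp_tendsto) (use \<sigma> z in auto)
  ultimately show ?thesis
    unfolding homogeneous_H1_def using cut_gauss_grad_cauchy[OF \<sigma> z]
    by (auto intro!: exI[of _ "\<lambda>n. cut_gauss (real (Suc n)) \<sigma> C z"])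
qed

text \<open>A nonpositive potential only lowers the form, so Cauchy sequences for the gradient norm
  are Cauchy for the form.\<close>

lemma quad_form_le:
  assumes a: "a \<le> 0" and f: "f \<in> C2a"
  shows "quad_form a f \<le> (LINT x|lborel. grad_sq f x)"
  unfolding quad_form_def
proof (rule integral_mono_AE')
  have "integrable lborel (\<lambda>x. complex_of_real (grad_sq f x))"
    using annular_integrable[OF annular_sesq[OF f f, of 0]] by (simp add: grad_sq_def complex_norm_square del: of_real_power)
  then show "integrable lborel (grad_sq f)" by (subst (asm) complex_of_real_integrable_eq)
  show "AE x in lborel. grad_sq f x + a / (norm x)\<^sup>2 * (norm (f x))\<^sup>2 \<le> grad_sq f x"
    using a by (auto intro!: AE_I2 mult_nonpos_nonneg divide_nonpos_nonneg)
  show "AE x in lborel. 0 \<le> grad_sq f x" by (auto simp: grad_sq_def sum_nonneg)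
qed

lemma sgauss_form_domain:
  assumes \<sigma>: "0 < \<sigma>" "\<sigma> < 1 / 2" and z: "Re z > 0" and a: "a \<le> 0"
  shows "sgauss \<sigma> C z \<in> form_domain a"
proof -
  let ?\<phi> = "\<lambda>n. cut_gauss (real (Suc n)) \<sigma> C z"
  have T: "?\<phi> n \<in> test_functions (-{0})" for n by (rule cut_gauss_test_function) simp
  have d: "(\<lambda>x. ?\<phi> m x - ?\<phi> n x) \<in> C2a" for m n
  proof -
    \<comment> \<open>Serves only closure of \<open>C2a\<close> under differences; a = 0 with
      \<sigma> = 0 is the simplest instance.\<close>
    interpret semi_inner_form C2a "sesq_form 0" by (rule semi_inner_form_sesq[of _ 0]) simp
    show ?thesis using T by (intro diff_mem test_functions_C2a)
  qed
  have "sgauss \<sigma> C z \<in> Lp 2"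
    using sgauss_Lp[of \<sigma> 2 z C] \<sigma> z by simp
  moreover have "(\<lambda>n. Lp_norm 2 (\<lambda>x. ?\<phi> n x - sgauss \<sigma> C z x)) \<longlonglongrightarrow> 0"
    by (rule cut_gauss_Lp_tendsto) (use \<sigma> z in auto)
  moreover have "\<exists>N. \<forall>m\<ge>N. \<forall>n\<ge>N. quad_form a (\<lambda>x. ?\<phi> m x - ?\<phi> n x) < e" if "e > 0" for e
    using cut_gauss_grad_cauchy[OF \<sigma> z that, of C] quad_form_le[OF a d] by (meson order_le_less_trans)
  ultimately show ?thesis
    unfolding form_domain_def form_approx_def using T by (auto intro!: exI[of _ ?\<phi>])
qed

text \<open>The image of \<open>sgauss\<close> under the operator. With d = 3 - 2 \<sigma> the
  factor is 2 d z - 4 z^2 |x|^2, as for a Gaussian under minus the Laplacian in dimension d.\<close>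

definition sgauss_gen :: "real \<Rightarrow> complex \<Rightarrow> complex \<Rightarrow> wave" where
  "sgauss_gen \<sigma> C z x = (complex_of_real (6 - 4 * \<sigma>) * z - 4 * z\<^sup>2 * complex_of_real ((norm x)\<^sup>2)) * sgauss \<sigma> C z x"

lemma sgauss_gen_measurable [measurable]: "sgauss_gen \<sigma> C z \<in> borel_measurable borel"
  unfolding sgauss_gen_def[abs_def] by measurable

lemma norm_sgauss_gen_le:
  assumes "0 < \<sigma>" "\<sigma> < 1 / 2"
  shows "norm (sgauss_gen \<sigma> C z x) \<le> 6 * (norm z + (norm z)\<^sup>2) * (1 + (norm x)\<^sup>2) * norm (sgauss \<sigma> C z x)"
proof -
  have "norm (complex_of_real (6 - 4 * \<sigma>) * z - 4 * z\<^sup>2 * complex_of_real ((norm x)\<^sup>2)) \<le>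
     (6 - 4 * \<sigma>) * norm z + 4 * (norm z)\<^sup>2 * (norm x)\<^sup>2"
    by (rule order_trans[OF norm_triangle_ineq4]) (use assms in \<open>simp add: norm_mult norm_power del: of_real_diff\<close>)
  also have "\<dots> \<le> 6 * norm z * 1 + 6 * (norm z)\<^sup>2 * (norm x)\<^sup>2"
    using assms by (intro add_mono mult_right_mono) (auto intro!: mult_right_mono)
  also have "\<dots> \<le> 6 * (norm z + (norm z)\<^sup>2) * (1 + (norm x)\<^sup>2)"
    by (simp add: algebra_simps)
  finally show ?thesis unfolding sgauss_gen_def norm_mult by (rule mult_right_mono) simp
qed

lemma weighted_gauss_sq_integrable:
  assumes "0 < \<sigma>" "\<sigma> < 1 / 2" "c > 0"
  shows "integrable lborel (\<lambda>x::real^3. ((1 + (norm x)\<^sup>2) * (norm x powr (- \<sigma>) * exp (- c * (norm x)\<^sup>2)))\<^sup>2)"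
proof (rule Bochner_Integration.integrable_bound)
  show "integrable lborel (\<lambda>x::real^3. (2 + 4 / c\<^sup>2) * (norm x powr (- (2 * \<sigma>)) * exp (- c * (norm x)\<^sup>2)))"
    by (intro integrable_mult_right integrable_norm_powr_exp) (use assms in auto)
  have "((1 + (norm x)\<^sup>2) * (norm x powr (- \<sigma>) * exp (- c * (norm x)\<^sup>2)))\<^sup>2 \<le>
     (2 + 4 / c\<^sup>2) * (norm x powr (- (2 * \<sigma>)) * exp (- c * (norm x)\<^sup>2))" for x :: "real^3"
  proof -
    have 1: "(norm x powr (- \<sigma>))\<^sup>2 = norm x powr (- (2 * \<sigma>))"
      by (simp add: power2_eq_square flip: powr_add)
    have 2: "(exp (- c * (norm x)\<^sup>2))\<^sup>2 = exp (- (2 * c) * (norm x)\<^sup>2)"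
      by (simp add: power2_eq_square flip: exp_add)
    have "((1 + (norm x)\<^sup>2) * (norm x powr (- \<sigma>) * exp (- c * (norm x)\<^sup>2)))\<^sup>2 =
        norm x powr (- (2 * \<sigma>)) * ((1 + (norm x)\<^sup>2)\<^sup>2 * exp (- (2 * c) * (norm x)\<^sup>2))"
      unfolding power_mult_distrib 1 2 by (simp only: mult_ac)
    also have "\<dots> \<le> norm x powr (- (2 * \<sigma>)) * ((2 + 4 / c\<^sup>2) * exp (- c * (norm x)\<^sup>2))"
      by (intro mult_left_mono quadratic_exp_bound) (use assms in auto)
    finally show ?thesis by (simp only: mult_ac)
  qed
  then show "AE x::real^3 in lborel. norm (((1 + (norm x)\<^sup>2) * (norm x powr (- \<sigma>) * exp (- c * (norm x)\<^sup>2)))\<^sup>2) \<le>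
     norm ((2 + 4 / c\<^sup>2) * (norm x powr (- (2 * \<sigma>)) * exp (- c * (norm x)\<^sup>2)))"
    by (auto intro!: AE_I2 simp: abs_mult)
qed auto

lemma sgauss_gen_Lp:
  assumes "0 < \<sigma>" "\<sigma> < 1 / 2" "Re z > 0"
  shows "sgauss_gen \<sigma> C z \<in> Lp 2"
  unfolding Lp_2_iff
proof
  show "integrable lborel (\<lambda>x. (norm (sgauss_gen \<sigma> C z x))\<^sup>2)"
  proof (rule Bochner_Integration.integrable_bound)
    let ?k = "6 * (norm z + (norm z)\<^sup>2) * norm C"
    show "integrable lborel (\<lambda>x::real^3. ?k\<^sup>2 * ((1 + (norm x)\<^sup>2) * (norm x powr (- \<sigma>) * exp (- Re z * (norm x)\<^sup>2)))\<^sup>2)"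
      by (intro integrable_mult_right weighted_gauss_sq_integrable assms)
    have "(norm (sgauss_gen \<sigma> C z x))\<^sup>2 \<le> (?k * ((1 + (norm x)\<^sup>2) * (norm x powr (- \<sigma>) * exp (- Re z * (norm x)\<^sup>2))))\<^sup>2" for x
      using norm_sgauss_gen_le[OF assms(1,2), of C z x] by (intro power_mono) (simp_all only: norm_sgauss mult_ac norm_ge_zero)
    then show "AE x in lborel. norm ((norm (sgauss_gen \<sigma> C z x))\<^sup>2) \<le>
       norm (?k\<^sup>2 * ((1 + (norm x)\<^sup>2) * (norm x powr (- \<sigma>) * exp (- Re z * (norm x)\<^sup>2)))\<^sup>2)"
      by (auto intro!: AE_I2 simp: power_mult_distrib)
  qed auto
qed auto

text \<open>In the Laplacian the terms of order 1 / |x|^2 add up to (\<sigma>^2 - \<sigma>) / |x|^2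
  times the function, and the potential cancels them; what remains is bounded by a polynomial times
  \<open>sgauss\<close>, hence in L^2.\<close>

lemma sgauss_friedrichs:
  assumes \<sigma>: "0 < \<sigma>" "\<sigma> < 1 / 2" and z: "Re z > 0" and a: "a = \<sigma>\<^sup>2 - \<sigma>"
  shows "(sgauss \<sigma> C z, sgauss_gen \<sigma> C z) \<in> friedrichs a"
proof -
  define V1 where "V1 s = log_deriv \<sigma> z s * profile \<sigma> C z s" for s
  define V2 where "V2 s = ((log_deriv \<sigma> z s)\<^sup>2 + complex_of_real (\<sigma> / 2 / s\<^sup>2)) * profile \<sigma> C z s" for s
  define u1 where "u1 i x = complex_of_real (x $ i) * (2 * V1 ((norm x)\<^sup>2))" for i :: 3 and x :: "real^3"
  define u2 where "u2 i x = complex_of_real (x $ i) * (complex_of_real (2 * x $ i) * (2 * V2 ((norm x)\<^sup>2))) + 1 * (2 * V1 ((norm x)\<^sup>2))"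
    for i :: 3 and x :: "real^3"
  have cp: "continuous_on (-{0::real^3}) (\<lambda>x. profile \<sigma> C z ((norm x)\<^sup>2))"
    unfolding profile_def by (auto intro!: continuous_intros)
  have cl: "continuous_on (-{0::real^3}) (\<lambda>x. log_deriv \<sigma> z ((norm x)\<^sup>2))"
    unfolding log_deriv_def by (auto intro!: continuous_intros)
  have a0: "a \<le> 0" using \<sigma> a by (simp add: power2_eq_square mult_left_le_one_le)
  show ?thesis
  proof (rule friedrichsI[OF a sgauss_form_domain[OF \<sigma> z a0] sgauss_gen_Lp[OF \<sigma> z]])
    show "continuous_on (-{0}) (sgauss \<sigma> C z)" using cp unfolding sgauss_def[abs_def] .
    show "continuous_on (-{0}) (u1 i)" for i
      unfolding u1_def[abs_def] V1_def by (intro continuous_intros cp cl)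
    show "continuous_on (-{0}) (u2 i)" for i
      unfolding u2_def[abs_def] V1_def V2_def by (intro continuous_intros cp cl) auto
    fix i x assume x: "x \<noteq> (0::real^3)"
    then have s: "(norm x)\<^sup>2 > 0" by simp
    show "has_pd i (sgauss \<sigma> C z) (u1 i x) x"
      using has_pd_radial[OF profile_has_derivative[OF s, of \<sigma> C z], of i]
      by (simp add: sgauss_def u1_def V1_def mult_ac)
    show "has_pd i (u1 i) (u2 i x) x"
      unfolding u1_def u2_def
    proof (intro has_pd_mult has_pd_coord)
      show "has_pd i (\<lambda>x. 2 * V1 ((norm x)\<^sup>2)) (complex_of_real (2 * x $ i) * (2 * V2 ((norm x)\<^sup>2))) x"
        using has_pd_radial[OF has_vector_derivative_mult_right[OF profile_has_second_derivative[OF s, of \<sigma> z C], of 2], of i]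
        by (simp only: V1_def V2_def)
    qed
  next
    fix x assume x: "x \<noteq> (0::real^3)"
    define s where "s = (norm x)\<^sup>2"
    define S where "S = complex_of_real s"
    have s: "s > 0" using x by (simp add: s_def)
    then have S: "S \<noteq> 0" by (simp add: S_def)
    have "u2 i x = complex_of_real ((x $ i)\<^sup>2) * (4 * V2 s) + 2 * V1 s" for i
      by (simp add: u2_def s_def power2_eq_square)
    then have "(\<Sum>i\<in>UNIV. u2 i x) = (\<Sum>i\<in>UNIV. complex_of_real ((x $ i)\<^sup>2) * (4 * V2 s)) + 6 * V1 s"
      by (simp only: sum.distrib) simp
    also have "(\<Sum>i\<in>UNIV. complex_of_real ((x $ i)\<^sup>2) * (4 * V2 s)) = S * (4 * V2 s)"
      unfolding S_def s_def norm_sq_sum of_real_sum sum_distrib_right ..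
    \<comment> \<open>The Laplacian of V(|x|^2) in three dimensions is 4 s V'' + 6 V' at s = |x|^2;
      \<open>V1\<close> and \<open>V2\<close> are V' and V''.\<close>
    finally have sum: "(\<Sum>i\<in>UNIV. u2 i x) = S * (4 * V2 s) + 6 * V1 s" .
    have as: "complex_of_real (a / s) = ((complex_of_real \<sigma>)\<^sup>2 - complex_of_real \<sigma>) / S"
      by (simp add: a S_def)
    have ld: "log_deriv \<sigma> z s = - complex_of_real \<sigma> / (2 * S) - z" "complex_of_real (\<sigma> / 2 / s\<^sup>2) = complex_of_real \<sigma> / (2 * S\<^sup>2)"
      by (simp_all add: log_deriv_def S_def)
    show "sgauss_gen \<sigma> C z x = complex_of_real (a / (norm x)\<^sup>2) * sgauss \<sigma> C z x - (\<Sum>i\<in>UNIV. u2 i x)"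
      unfolding sum sgauss_gen_def sgauss_def V1_def V2_def s_def[symmetric] S_def[symmetric] as ld
      using S by (simp add: field_simps power2_eq_square)
  qed
qed

section \<open>The explicit solution\<close>

definition zt :: "real \<Rightarrow> complex" where
  "zt t = inverse (1 + 4 * \<i> * complex_of_real t)"

definition sol :: "real \<Rightarrow> real \<Rightarrow> wave" where
  "sol \<sigma> t = sgauss \<sigma> (zt t powr complex_of_real (3 / 2 - \<sigma>)) (zt t)"

definition sol_gen :: "real \<Rightarrow> real \<Rightarrow> wave" where
  "sol_gen \<sigma> t = sgauss_gen \<sigma> (zt t powr complex_of_real (3 / 2 - \<sigma>)) (zt t)"

lemma norm_zt_denominator: "(norm (1 + 4 * \<i> * complex_of_real t))\<^sup>2 = 1 + 16 * t\<^sup>2"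
  by (simp add: cmod_power2 power_mult_distrib)

lemma zt_denominator_neq_0: "1 + 4 * \<i> * complex_of_real t \<noteq> 0"
  by (simp add: complex_eq_iff)

lemma Re_zt: "Re (zt t) = 1 / (1 + 16 * t\<^sup>2)"
  by (simp add: zt_def power_mult_distrib)

lemma Re_zt_pos: "Re (zt t) > 0"
  unfolding Re_zt by (simp add: add_pos_nonneg)

lemma norm_zt_le: "norm (zt t) \<le> 1"
proof -
  have "1 \<le> norm (1 + 4 * \<i> * complex_of_real t)"
    by (rule power2_le_imp_le) (simp_all add: norm_zt_denominator del: norm_one)
  then show ?thesis unfolding zt_def norm_inverse by (simp add: inverse_le_1_iff)
qed

lemma zt_has_derivative: "(zt has_vector_derivative - 4 * \<i> * (zt t)\<^sup>2) (at t)"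
proof -
  have "((\<lambda>w. inverse (1 + 4 * \<i> * w)) has_field_derivative - 4 * \<i> * (zt t)\<^sup>2) (at (complex_of_real t))"
    using zt_denominator_neq_0[of t]
    by (auto intro!: derivative_eq_intros simp: zt_def power2_eq_square)
  from has_vector_derivative_real_field[OF this] show ?thesis by (simp add: zt_def[abs_def])
qed

text \<open>For real exponents the modulus of the principal power is the power of the modulus, so
  the amplitude is bounded uniformly in time.\<close>

lemma norm_sol_coeff_le:
  assumes "\<kappa> \<ge> 0"
  shows "norm (zt t powr complex_of_real \<kappa>) \<le> 1"
proof -
  have z: "zt t \<noteq> 0" using Re_zt_pos[of t] by auto
  then have "norm (zt t powr complex_of_real \<kappa>) = exp (\<kappa> * ln (norm (zt t)))"
    by (simp add: powr_def Re_Ln)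
  also have "\<dots> \<le> 1"
    using assms norm_zt_le[of t] z by (simp add: mult_nonneg_nonpos)
  finally show ?thesis .
qed

text \<open>The positive real part keeps \<open>zt t\<close> off the branch cut, so the principal
  power is differentiable along the whole curve. The factor |x|^(-\<sigma>) is constant in
  time.\<close>

lemma sol_has_derivative:
  "((\<lambda>t. sol \<sigma> t x) has_vector_derivative - \<i> * sol_gen \<sigma> t x) (at t)"
proof -
  define \<kappa> where "\<kappa> = complex_of_real (3 / 2 - \<sigma>)"
  define S where "S = complex_of_real ((norm x)\<^sup>2)"
  have z: "zt t \<notin> \<real>\<^sub>\<le>\<^sub>0" "zt t \<noteq> 0" using Re_zt_pos[of t] by (auto simp: complex_nonpos_Reals_iff)
  have "((\<lambda>w. w powr \<kappa> * exp (- w * S)) has_field_derivative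
      (zt t powr \<kappa> * (\<kappa> / zt t - S) * exp (- zt t * S))) (at (zt t))"
    using z by (auto intro!: derivative_eq_intros simp: powr_diff field_simps)
  from field_vector_diff_chain_at[OF zt_has_derivative this]
  have "((\<lambda>t. zt t powr \<kappa> * exp (- zt t * S)) has_vector_derivative
     - 4 * \<i> * (zt t)\<^sup>2 * (zt t powr \<kappa> * (\<kappa> / zt t - S) * exp (- zt t * S))) (at t)"
    by (simp add: o_def)
  also have "- 4 * \<i> * (zt t)\<^sup>2 * (zt t powr \<kappa> * (\<kappa> / zt t - S) * exp (- zt t * S)) =
     - \<i> * ((complex_of_real (6 - 4 * \<sigma>) * zt t - 4 * (zt t)\<^sup>2 * S) * (zt t powr \<kappa> * exp (- zt t * S)))"
  proof -
    have *: "4 * (zt t)\<^sup>2 * (\<kappa> / zt t - S) = complex_of_real (6 - 4 * \<sigma>) * zt t - 4 * (zt t)\<^sup>2 * S"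
      using z(2) by (simp add: \<kappa>_def field_simps power2_eq_square)
    have "- 4 * \<i> * (zt t)\<^sup>2 * (P * Q * E) = - \<i> * ((4 * (zt t)\<^sup>2 * Q) * (P * E))" for P Q E
      by (simp add: mult_ac)
    then show ?thesis unfolding *[symmetric] .
  qed
  finally have "((\<lambda>t. complex_of_real (((norm x)\<^sup>2) powr (- (\<sigma> / 2))) * (zt t powr \<kappa> * exp (- zt t * S))) has_vector_derivative
     complex_of_real (((norm x)\<^sup>2) powr (- (\<sigma> / 2))) *
     (- \<i> * ((complex_of_real (6 - 4 * \<sigma>) * zt t - 4 * (zt t)\<^sup>2 * S) * (zt t powr \<kappa> * exp (- zt t * S))))) (at t)"
    by (rule has_vector_derivative_mult_right)
  then show ?thesis
    by (simp add: sol_def sol_gen_def sgauss_def sgauss_gen_def profile_def S_def \<kappa>_def mult_ac)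
qed

context
  fixes \<sigma> :: real
  assumes \<sigma>: "0 < \<sigma>" "\<sigma> < 1 / 2"
begin

lemma sol_Lp_2: "sol \<sigma> t \<in> Lp 2"
  unfolding sol_def using sgauss_Lp[of \<sigma> 2 "zt t"] \<sigma> Re_zt_pos by simp

lemma sol_gen_Lp_2: "sol_gen \<sigma> t \<in> Lp 2"
  unfolding sol_gen_def by (rule sgauss_gen_Lp[OF \<sigma> Re_zt_pos])

lemma norm_sol_gen_le:
  assumes "c \<le> Re (zt t)"
  shows "norm (sol_gen \<sigma> t x) \<le> 12 * ((1 + (norm x)\<^sup>2) * (norm x powr (- \<sigma>) * exp (- c * (norm x)\<^sup>2)))"
proof -
  let ?C = "zt t powr complex_of_real (3 / 2 - \<sigma>)"
  have "norm (sgauss \<sigma> ?C (zt t) x) \<le> 1 * (norm x powr (- \<sigma>) * exp (- c * (norm x)\<^sup>2))"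
    unfolding norm_sgauss using assms \<sigma>
    by (intro mult_mono norm_sol_coeff_le) (auto intro!: mult_left_mono mult_right_mono)
  moreover have "norm (zt t) + (norm (zt t))\<^sup>2 \<le> 2"
    using norm_zt_le[of t] power_le_one[of "norm (zt t)" 2] by simp
  ultimately
  have "6 * (norm (zt t) + (norm (zt t))\<^sup>2) * (1 + (norm x)\<^sup>2) * norm (sgauss \<sigma> ?C (zt t) x) \<le>
     6 * 2 * (1 + (norm x)\<^sup>2) * (1 * (norm x powr (- \<sigma>) * exp (- c * (norm x)\<^sup>2)))"
    by (intro mult_mono) auto
  also have "\<dots> = 12 * ((1 + (norm x)\<^sup>2) * (norm x powr (- \<sigma>) * exp (- c * (norm x)\<^sup>2)))"
    by (simp add: mult.assoc)
  finally show ?thesis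
    unfolding sol_gen_def by (rule order_trans[OF norm_sgauss_gen_le[OF \<sigma>]])
qed

text \<open>Pointwise derivatives become derivatives in L^2 by dominated convergence along
  sequences: the mean value inequality in time bounds the quotients by a weight \<open>w\<close>
  valid for all times within distance 1 of \<open>t\<close>.\<close>

lemma sol_L2_derivative:
  "((\<lambda>h. Lp_norm 2 (\<lambda>x. (sol \<sigma> (t + h) x - sol \<sigma> t x) / complex_of_real h - (- \<i> * sol_gen \<sigma> t x))) \<longlongrightarrow> 0) (at 0)"
  unfolding tendsto_at_iff_sequentially
proof (intro allI impI)
  fix X :: "nat \<Rightarrow> real"
  assume X: "\<forall>i. X i \<in> UNIV - {0}" "X \<longlonglongrightarrow> 0"
  obtain k where "\<forall>n\<ge>k. \<bar>X n\<bar> < 1"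
    using LIMSEQ_D[OF X(2), of 1] by auto
  then have k: "\<bar>X (n + k)\<bar> < 1" for n by simp
  define Y where "Y n = X (n + k)" for n
  have Y: "Y n \<noteq> 0" "\<bar>Y n\<bar> < 1" for n using X(1) k by (auto simp: Y_def)
  have Y0: "Y \<longlonglongrightarrow> 0" using LIMSEQ_ignore_initial_segment[OF X(2), of k] by (simp add: Y_def[abs_def])
  \<comment> \<open>The value of \<open>Re (zt s)\<close> at s = |t| + 1, a lower bound for all s
    with |s - t| \<le> 1: the Gaussian decay does not degenerate nearby.\<close>
  define c where "c = 1 / (1 + 16 * (\<bar>t\<bar> + 1)\<^sup>2)"
  have c: "c > 0" unfolding c_def by (simp add: add_pos_nonneg)
  have cz: "c \<le> Re (zt s)" if "\<bar>s - t\<bar> \<le> 1" for s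
  proof -
    have "s\<^sup>2 \<le> (\<bar>t\<bar> + 1)\<^sup>2"
      using that by (subst abs_le_square_iff[symmetric]) auto
    then show ?thesis
      unfolding Re_zt c_def by (intro divide_left_mono) (auto intro!: mult_pos_pos add_pos_nonneg)
  qed
  define w where "w x = 12 * ((1 + (norm x)\<^sup>2) * (norm x powr (- \<sigma>) * exp (- c * (norm x)\<^sup>2)))" for x :: "real^3"
  have w0: "w x \<ge> 0" for x by (simp add: w_def)
  have diff: "norm (sol \<sigma> (t + h) x - sol \<sigma> t x) \<le> w x * \<bar>h\<bar>" if h: "\<bar>h\<bar> \<le> 1" for h x
  proof -
    have "norm (sol \<sigma> (t + h) x - sol \<sigma> t x) \<le> w x * norm (t + h - t)"
    proof (rule differentiable_bound[where S = "{t - 1..t + 1}" and f' = "\<lambda>s r. r *\<^sub>R (- \<i> * sol_gen \<sigma> s x)"])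
      fix s assume s: "s \<in> {t - 1..t + 1}"
      show "((\<lambda>s. sol \<sigma> s x) has_derivative (\<lambda>r. r *\<^sub>R (- \<i> * sol_gen \<sigma> s x))) (at s within {t - 1..t + 1})"
        using sol_has_derivative[of \<sigma> x s] unfolding has_vector_derivative_def by (rule has_derivative_at_withinI)
      have "norm (sol_gen \<sigma> s x) \<le> w x"
        unfolding w_def by (rule norm_sol_gen_le[OF cz]) (use s in auto)
      then show "onorm (\<lambda>r. r *\<^sub>R (- \<i> * sol_gen \<sigma> s x)) \<le> w x"
        by (intro onorm_le) (simp add: norm_mult mult.commute[of "w x"] mult_left_mono)
    qed (use h in auto)
    then show ?thesis by simp
  qed
  have "(\<lambda>n. Lp_norm 2 (\<lambda>x. (sol \<sigma> (t + Y n) x - sol \<sigma> t x) / complex_of_real (Y n) - (- \<i> * sol_gen \<sigma> t x))) \<longlonglongrightarrow> 0"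
  \<comment> \<open>One copy of \<open>w\<close> bounds the quotient and one the derivative.\<close>
  proof (rule Lp_norm_tendsto_0[where w = "\<lambda>x. 2 * w x"])
    show "(\<lambda>x. (sol \<sigma> (t + Y n) x - sol \<sigma> t x) / complex_of_real (Y n) - (- \<i> * sol_gen \<sigma> t x)) \<in> borel_measurable borel" for n
      unfolding sol_def sol_gen_def by measurable
    have "(\<lambda>x. (2 * w x) powr 2) = (\<lambda>x. 24\<^sup>2 * ((1 + (norm x)\<^sup>2) * (norm x powr (- \<sigma>) * exp (- c * (norm x)\<^sup>2)))\<^sup>2)"
      using w0 by (auto simp: powr_numeral w_def power_mult_distrib)
    then show "integrable lborel (\<lambda>x. (2 * w x) powr 2)"
      using weighted_gauss_sq_integrable[OF \<sigma> c] by simp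
    show "AE x in lborel. norm ((sol \<sigma> (t + Y n) x - sol \<sigma> t x) / complex_of_real (Y n) - (- \<i> * sol_gen \<sigma> t x)) \<le> 2 * w x" for n
    proof (rule AE_I2)
      fix x
      have "norm ((sol \<sigma> (t + Y n) x - sol \<sigma> t x) / complex_of_real (Y n)) \<le> w x"
        using diff[of "Y n" x] Y[of n] by (simp add: norm_divide divide_le_eq)
      moreover have "norm (- \<i> * sol_gen \<sigma> t x) \<le> w x"
        using norm_sol_gen_le[OF cz[of t], of x] by (simp add: w_def norm_mult)
      ultimately show "norm ((sol \<sigma> (t + Y n) x - sol \<sigma> t x) / complex_of_real (Y n) - (- \<i> * sol_gen \<sigma> t x)) \<le> 2 * w x"
        using norm_triangle_ineq4[of "(sol \<sigma> (t + Y n) x - sol \<sigma> t x) / complex_of_real (Y n)" "- \<i> * sol_gen \<sigma> t x"] by linarith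
    qed
    show "AE x in lborel. (\<lambda>n. (sol \<sigma> (t + Y n) x - sol \<sigma> t x) / complex_of_real (Y n) - (- \<i> * sol_gen \<sigma> t x)) \<longlonglongrightarrow> 0"
    proof (rule AE_I2)
      fix x
      have "(\<lambda>h. norm (sol \<sigma> (t + h) x - sol \<sigma> t x - h *\<^sub>R (- \<i> * sol_gen \<sigma> t x)) / norm h) \<midarrow>0\<rightarrow> 0"
        using sol_has_derivative[of \<sigma> x t] unfolding has_vector_derivative_def has_derivative_at by blast
      moreover have "filterlim Y (at 0) sequentially"
        unfolding filterlim_at using Y0 Y by auto
      ultimately have "(\<lambda>n. norm (sol \<sigma> (t + Y n) x - sol \<sigma> t x - Y n *\<^sub>R (- \<i> * sol_gen \<sigma> t x)) / norm (Y n)) \<longlonglongrightarrow> 0"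
        by (rule filterlim_compose)
      moreover have "norm (sol \<sigma> (t + Y n) x - sol \<sigma> t x - Y n *\<^sub>R (- \<i> * sol_gen \<sigma> t x)) / norm (Y n) =
         norm ((sol \<sigma> (t + Y n) x - sol \<sigma> t x) / complex_of_real (Y n) - (- \<i> * sol_gen \<sigma> t x))" for n
      proof -
        have "(sol \<sigma> (t + Y n) x - sol \<sigma> t x) / complex_of_real (Y n) - (- \<i> * sol_gen \<sigma> t x) =
            (sol \<sigma> (t + Y n) x - sol \<sigma> t x - Y n *\<^sub>R (- \<i> * sol_gen \<sigma> t x)) / complex_of_real (Y n)"
          using Y(1)[of n] by (simp add: scaleR_conv_of_real diff_divide_distrib add_divide_distrib)
        then show ?thesis by (simp add: norm_divide)
      qed
      ultimately show "(\<lambda>n. (sol \<sigma> (t + Y n) x - sol \<sigma> t x) / complex_of_real (Y n) - (- \<i> * sol_gen \<sigma> t x)) \<longlonglongrightarrow> 0"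
        by (simp add: tendsto_norm_zero_iff)
    qed
  qed simp
  then have "(\<lambda>n. ((\<lambda>h. Lp_norm 2 (\<lambda>x. (sol \<sigma> (t + h) x - sol \<sigma> t x) / complex_of_real h - (- \<i> * sol_gen \<sigma> t x))) \<circ> X) (n + k)) \<longlonglongrightarrow> 0"
    by (simp add: Y_def o_def)
  then show "((\<lambda>h. Lp_norm 2 (\<lambda>x. (sol \<sigma> (t + h) x - sol \<sigma> t x) / complex_of_real h - (- \<i> * sol_gen \<sigma> t x))) \<circ> X) \<longlonglongrightarrow> 0"
    by (rule LIMSEQ_offset)
qed

end

section \<open>Uniqueness of differentiable orbits\<close>

lemma L2_N_eq: "L2.N f = sqrt (LINT x|lborel. (norm (f x))\<^sup>2)"
  using Lp_norm_2[of f] by (simp add: Lp_norm_def powr_half_sqrt powr_numeral)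

lemma L2_N_scale: "L2.N (\<lambda>x. c * f x) = norm c * L2.N f"
  by (simp add: L2_N_eq norm_mult power_mult_distrib real_sqrt_mult)

lemma L2_N_cong:
  assumes "f \<in> Lp 2" "g \<in> Lp 2" "AE x in lborel. f x = g x"
  shows "L2.N f = L2.N g"
proof -
  have [measurable]: "f \<in> borel_measurable borel" "g \<in> borel_measurable borel"
    using assms by (auto intro: Lp_2_measurable)
  have "(LINT x|lborel. (norm (f x))\<^sup>2) = (LINT x|lborel. (norm (g x))\<^sup>2)"
    by (rule integral_cong_AE) (use assms(3) in \<open>auto elim!: eventually_mono\<close>)
  then show ?thesis by (simp add: L2_N_eq)
qed

lemma L2_N_eq_0:
  assumes "f \<in> Lp 2" "L2.N f = 0"
  shows "AE x in lborel. f x = 0"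
proof -
  have "(LINT x|lborel. (norm (f x))\<^sup>2) = 0" using assms(2) by (simp add: L2_N_eq)
  then have "AE x in lborel. (norm (f x))\<^sup>2 = 0"
    using assms(1) by (subst (asm) integral_nonneg_eq_0_iff_AE) (auto simp: Lp_2_iff)
  then show ?thesis by (auto elim!: eventually_mono)
qed

text \<open>Uniqueness for the Cauchy problem: the distance \<open>N\<close> between the two orbits satisfies
  \<open>|N (t + h) - N t| \<le> \<parallel>U h (v t) - v (t + h)\<parallel> = o(h)\<close>, because \<open>U h (v t)\<close> and \<open>v (t + h)\<close>
  have the same derivative in \<open>h\<close> at 0.\<close>

lemma schroedinger_group_unique_solution:
  fixes v g :: "real \<Rightarrow> wave"
  assumes U: "is_schroedinger_group L U"
    and v: "\<And>t. v t \<in> Lp 2" and g: "\<And>t. g t \<in> Lp 2" and L: "\<And>t. (v t, g t) \<in> L"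
    and dv: "\<And>t. ((\<lambda>h. Lp_norm 2 (\<lambda>x. (v (t + h) x - v t x) / complex_of_real h - (- \<i> * g t x))) \<longlongrightarrow> 0) (at 0)"
  shows "AE x in lborel. U t (v 0) x = v t x"
proof -
  have ug: "unitary_group U" using U by (simp add: is_schroedinger_group_def)
  have mem: "U t f \<in> Lp 2" if "f \<in> Lp 2" for t f
    using ug that by (simp add: unitary_group_def)
  have lin: "AE x in lborel. U t (\<lambda>y. c * f y + g y) x = c * U t f x + U t g x" if "f \<in> Lp 2" "g \<in> Lp 2" for t c f g
    using ug that by (simp add: unitary_group_def)
  have inner: "L2_inner (U t f) (U t g) = L2_inner f g" if "f \<in> Lp 2" "g \<in> Lp 2" for t f g
    using ug that by (simp add: unitary_group_def)
  have zero: "AE x in lborel. U 0 f x = f x" if "f \<in> Lp 2" for f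
    using ug that by (simp add: unitary_group_def)
  have add: "AE x in lborel. U (s + t) f x = U s (U t f) x" if "f \<in> Lp 2" for s t f
    using ug that by (simp add: unitary_group_def)
  have N_U: "L2.N (U t f) = L2.N f" if "f \<in> Lp 2" for t f
    using inner[OF that that] by (simp add: L2.N_def)
  note dm = L2.diff_mem
  define n where "n t = L2.N (\<lambda>x. U t (v 0) x - v t x)" for t
  define e1 where "e1 t h = (\<lambda>x. (v (t + h) x - v t x) / complex_of_real h - (- \<i> * g t x))" for t h
  define e2 where "e2 t h = (\<lambda>x. (U h (v t) x - v t x) / complex_of_real h - (- \<i> * g t x))" for t h
  have scale: "(\<lambda>x. c * f x) \<in> Lp 2" if "f \<in> Lp 2" for c f
    using L2.lin_mem[OF dm[OF that that] that, of c] by simp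
  have e: "e1 t h \<in> Lp 2" "e2 t h \<in> Lp 2" for t h
    using dm[OF scale[OF dm[OF v v], of "1 / complex_of_real h" "t + h" t] scale[OF g, of "- \<i>" t]]
      dm[OF scale[OF dm[OF mem[OF v] v], of "1 / complex_of_real h" h t t] scale[OF g, of "- \<i>" t]]
    by (simp_all add: e1_def e2_def)
  have step: "\<bar>n (t + h) - n t\<bar> \<le> \<bar>h\<bar> * (L2.N (e1 t h) + L2.N (e2 t h))" if h: "h \<noteq> 0" for t h
  proof -
    define w where "w = (\<lambda>x. U t (v 0) x - v t x)"
    \<comment> \<open>The difference of the orbits at time t + h is \<open>A - B\<close> almost
      everywhere. \<open>A\<close> is \<open>U h\<close> applied to the difference at time t, so its
      norm is \<open>n t\<close>; \<open>B\<close> is the defect of \<open>v\<close> over a time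
      step h.\<close>
    define A where "A = (\<lambda>x. U h (U t (v 0)) x - U h (v t) x)"
    define B where "B = (\<lambda>x. v (t + h) x - U h (v t) x)"
    have w: "w \<in> Lp 2" and A: "A \<in> Lp 2" and B: "B \<in> Lp 2"
      unfolding w_def A_def B_def by (intro dm mem v)+
    have "L2.N A = L2.N (U h w)"
    proof (rule L2_N_cong[OF A mem[OF w]])
      show "AE x in lborel. A x = U h w x"
        using lin[OF v mem[OF v], of h "-1" t t 0] by eventually_elim (simp add: A_def w_def)
    qed
    then have NA: "L2.N A = n t" using N_U[OF w] by (simp add: n_def w_def)
    have "n (t + h) = L2.N (\<lambda>x. A x - B x)"
      unfolding n_def
    proof (rule L2_N_cong)
      show "AE x in lborel. U (t + h) (v 0) x - v (t + h) x = A x - B x"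
        using add[OF v, of h t 0] by eventually_elim (simp add: A_def B_def add.commute)
    qed (intro dm mem v A B)+
    then have 1: "n (t + h) \<le> n t + L2.N B" "n t \<le> n (t + h) + L2.N B"
      using L2.N_diff[OF A B] L2.N_le[OF A B] NA by auto
    \<comment> \<open>The common derivative term cancels between \<open>e1\<close> and
      \<open>e2\<close>, leaving \<open>B\<close> as h times a difference of two vanishing
      errors.\<close>
    have "B = (\<lambda>x. complex_of_real h * (e1 t h x - e2 t h x))"
      using h by (auto simp: B_def e1_def e2_def field_simps)
    then have "L2.N B = \<bar>h\<bar> * L2.N (\<lambda>x. e1 t h x - e2 t h x)"
      by (simp add: L2_N_scale)
    also have "\<dots> \<le> \<bar>h\<bar> * (L2.N (e1 t h) + L2.N (e2 t h))"
      by (intro mult_left_mono L2.N_diff e) auto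
    finally show ?thesis using 1 by linarith
  qed
  have d: "(n has_real_derivative 0) (at t)" for t
    unfolding DERIV_def
  proof (rule Lim_null_comparison)
    \<comment> \<open>Here the generator is used: membership of \<open>(v t, g t)\<close> in
      \<open>L\<close> is differentiability at 0 of the orbit starting at
      \<open>v t\<close>.\<close>
    have "((\<lambda>h. Lp_norm 2 (e2 t h)) \<longlongrightarrow> 0) (at 0)"
      using U v[of t] g[of t] L[of t] unfolding is_schroedinger_group_def e2_def by blast
    then show "((\<lambda>h. L2.N (e1 t h) + L2.N (e2 t h)) \<longlongrightarrow> 0) (at 0)"
      using dv[of t] unfolding e1_def[symmetric] Lp_norm_2 by (rule tendsto_add_zero[rotated])
    show "\<forall>\<^sub>F h in at 0. norm ((n (t + h) - n t) / h) \<le> L2.N (e1 t h) + L2.N (e2 t h)"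
      using eventually_neq_at_within[of 0 0 UNIV]
      by eventually_elim (use step[of _ t] in \<open>simp add: divide_le_eq mult.commute\<close>)
  qed
  have "n t = n 0" by (rule DERIV_isconst_all) (use d in auto)
  also have "n 0 = L2.N (\<lambda>x. v 0 x - v 0 x)"
    unfolding n_def
  proof (rule L2_N_cong)
    show "AE x in lborel. U 0 (v 0) x - v 0 x = v 0 x - v 0 x"
      using zero[OF v, of 0] by eventually_elim simp
  qed (intro dm mem v)+
  also have "\<dots> = 0" by (simp add: L2_N_eq)
  finally have "AE x in lborel. U t (v 0) x - v t x = 0"
    unfolding n_def by (rule L2_N_eq_0[rotated]) (intro dm mem v)
  then show ?thesis by eventually_elim simp
qed

section \<open>Conjugate exponents and the conclusion\<close>

lemma holder_conjugate_top: "holder_conjugate \<infinity> = 1"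
  by (simp add: holder_conjugate_def)

lemma holder_conjugate_real:
  assumes "q > 1"
  shows "holder_conjugate (ennreal q) = ennreal (inverse (1 - inverse q))"
proof -
  have "1 - inverse (ennreal q) = ennreal (1 - inverse q)"
    using assms by (simp add: inverse_ennreal ennreal_minus[symmetric])
  moreover have "1 - inverse q > 0" using assms by (simp add: inverse_less_1_iff)
  ultimately show ?thesis by (simp add: holder_conjugate_def inverse_ennreal)
qed

theorem proposition3p1:
  fixes a \<sigma> :: real and p :: ennreal and U :: "real \<Rightarrow> wave \<Rightarrow> wave"
  assumes "- (1 / 4) < a" and "a < 0"
    and "\<sigma> = 1 / 2 - sqrt (1 / 4 + a)"
    and "p \<ge> ennreal (3 / \<sigma>)"
    and "is_schroedinger_group (friedrichs a) U"
  shows "\<exists>f \<in> homogeneous_H1 \<inter> Lp (holder_conjugate p). \<forall>t. U t f \<notin> Lp p"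
proof -
  have "0 < sqrt (1 / 4 + a)" using assms(1) by simp
  moreover have "sqrt (1 / 4 + a) < 1 / 2"
    using assms(2) by (intro real_less_lsqrt) (auto simp: power2_eq_square)
  ultimately have \<sigma>: "0 < \<sigma>" "\<sigma> < 1 / 2" using assms(3) by auto
  have "(1 / 2 - \<sigma>)\<^sup>2 = 1 / 4 + a" using assms(1,3) by simp
  \<comment> \<open>\<sigma> is the smaller root of this quadratic, the one below 1/2.\<close>
  then have a: "a = \<sigma>\<^sup>2 - \<sigma>" by (simp add: power2_eq_square algebra_simps)
  have eq: "AE x in lborel. U t (sol \<sigma> 0) x = sol \<sigma> t x" for t
  proof (rule schroedinger_group_unique_solution[OF assms(5)])
    show "(sol \<sigma> t, sol_gen \<sigma> t) \<in> friedrichs a" for t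
      unfolding sol_def sol_gen_def by (rule sgauss_friedrichs[OF \<sigma> Re_zt_pos a])
  qed (intro sol_Lp_2 sol_gen_Lp_2 sol_L2_derivative \<sigma>)+
  have "U t (sol \<sigma> 0) \<notin> Lp p" for t
  proof (rule singular_notin_Lp[OF \<sigma>(1) _ assms(4)])
    let ?C = "zt t powr complex_of_real (3 / 2 - \<sigma>)"
    \<comment> \<open>On the unit ball the Gaussian factor is at least its value at |x| = 1.\<close>
    let ?c = "norm ?C * exp (- Re (zt t))"
    have z: "zt t \<noteq> 0" using Re_zt_pos[of t] by auto
    then show "0 < ?c" by simp
    show "AE x in lborel. x \<in> ball 0 1 \<longrightarrow> ?c * norm x powr (- \<sigma>) \<le> norm (U t (sol \<sigma> 0) x)"
      using eq[of t]
    proof eventually_elim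
      case (elim x)
      show ?case
      proof
        assume "x \<in> ball 0 1"
        then have "(norm x)\<^sup>2 \<le> 1" by (simp add: power_le_one)
        then have "Re (zt t) * (norm x)\<^sup>2 \<le> Re (zt t)" using Re_zt_pos[of t] by simp
        then have "exp (- Re (zt t)) \<le> exp (- Re (zt t) * (norm x)\<^sup>2)" by simp
        then have "norm ?C * (norm x powr (- \<sigma>) * exp (- Re (zt t))) \<le>
            norm ?C * (norm x powr (- \<sigma>) * exp (- Re (zt t) * (norm x)\<^sup>2))"
          by (intro mult_left_mono) auto
        then show "?c * norm x powr (- \<sigma>) \<le> norm (U t (sol \<sigma> 0) x)"
          unfolding elim unfolding sol_def norm_sgauss by (simp only: mult_ac)
      qed
    qed
  qed
  moreover have "sol \<sigma> 0 \<in> homogeneous_H1"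
    unfolding sol_def by (rule sgauss_homogeneous_H1[OF \<sigma> Re_zt_pos])
  moreover have "sol \<sigma> 0 \<in> Lp (holder_conjugate p)"
  proof -
    \<comment> \<open>Since 3 / \<sigma> > 6, the exponent p exceeds 6 and its conjugate is at most
      2, where \<sigma> q \<le> 1 < 3.\<close>
    have Lp: "sol \<sigma> 0 \<in> Lp (ennreal q)" if "0 < q" "q \<le> 2" for q
    proof -
      have "\<sigma> * q \<le> (1 / 2) * 2" using that \<sigma> by (intro mult_mono) auto
      then show ?thesis
        unfolding sol_def using that \<sigma> Re_zt_pos by (intro sgauss_Lp) auto
    qed
    show ?thesis
    proof (cases p)
      case top
      then show ?thesis using Lp[of 1] by (simp add: holder_conjugate_top flip: infinity_ennreal_def)
    next
      case (real q)
      have "3 / \<sigma> > 6" using \<sigma> by (simp add: field_simps)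
      moreover have "q \<ge> 3 / \<sigma>" using assms(4) real \<open>3 / \<sigma> > 6\<close> by simp
      ultimately have q: "q > 6" by simp
      then have "inverse q < 1 / 2" "inverse q > 0" by (auto simp: field_simps)
      then have "0 < inverse (1 - inverse q)" "inverse (1 - inverse q) \<le> 2"
        by (auto simp: field_simps)
      then show ?thesis using Lp q real by (simp add: holder_conjugate_real)
    qed
  qed
  ultimately show ?thesis by blast
qed

end
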